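(* Let $\delta,\varepsilon\in(0,1)$, let $T\ge1$ be an integer, and let $\mathfrak{B}_u:=\sup_{u\in\mathcal U}\|u\|$. Let the expert be the robust MPC controller $\boldsymbol\pi$ with disturbance set $\mathcal W=\mathbb B(\varepsilon)$. Assume that $\Pi$ is a finite class of maps containing the expert $\boldsymbol\pi$ with $\pi(x)\in\mathcal U$ for all $\pi\in\Pi$ and all $x$, and that the support of $\mathcal D$ is almost surely bounded. Choose integers $\ell,n$ with $$\ell\ge\frac{10\ln(T/\delta)}{\delta},\qquad n\ge\frac{14\,\ell\,\|B\|\,\mathfrak{B}_u\ln(2T\ell|\Pi|/\delta)}{\varepsilon\,\delta}.$$ Run Forward-Switch with parameters $n,T,\ell$, and let $\hat\tau_\infty$, $\hat\pi$ and $\tilde\pi_{0:T-1}$ be the resulting stopping time, learned controllers and output controller; write $\hat x_t=\varphi_t(x_0;\hat\pi_{0:t-1})$. Then there is a constant $C$ depending only on the system parameters, and an event $\bar{\mathcal E}$ of probability at least $1-3\delta$ over the randomness in the training process, under which $\hat\tau_\infty\le\tau_\infty^\star$, $\ \mathbb P[\hat x_{\hat\tau_\infty}\in\bar{\mathcal O}_\infty\mid\hat\tau_\infty,\hat\pi]\ge1-\delta$ and $\mathbb P[\forall t\in\{0,\dots,\hat\tau_\infty-1\}:\|\boldsymbol\pi(\hat x_t)-\hat\pi_t(\hat x_t)\|\le\varepsilon/\|B\|\mid\hat\tau_\infty,\hat\pi]\ge1-\delta$ (probabilities over $x_0\sim\mathcal D$), and moreover, under this same event $\bar{\mathcal E}$,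 for any initial state $x_0$ (in the support of $\mathcal D$) satisfying $$\hat x_{\hat\tau_\infty}\in\bar{\mathcal O}_\infty\quad\text{and}\quad \|\boldsymbol\pi(\hat x_t)-\hat\pi_t(\hat x_t)\|\le\varepsilon/\|B\|\ \text{ for all }t\in\{0,\dots,\hat\tau_\infty-1\},$$ one has $$\tilde J_T(x_0)-\bar J_T(x_0)\ \le\ C\,\tau_\infty^\star\,\varepsilon .$$
   Context: Dynamics: $x_{t+1}=Ax_t+Bu_t$ with constraints $x_t\in\mathcal X\subseteq\mathbb R^{d_x}$, $u_t\in\mathcal U\subseteq\mathbb R^{d_u}$, where $\mathcal X,\mathcal U$ are closed convex (polytopic) sets containing the origin. For controllers $\pi_{0:t-1}=(\pi_0,\dots,\pi_{t-1})$, $\varphi_t(x_0;\pi_{0:t-1})$ is the state at time $t$ started from $x_0$ with $u_s=\pi_s(x_s)$; for a time-invariant controller $\pi$ write $\varphi_t(x_0;\pi)$. $\|\cdot\|$ is the Euclidean/operator norm, $\mathbb B(r)$ the ball of radius $r$ centered at the origin, $\oplus$ (or $+$) the Minkowski sum, and $\mathcal X\ominus\mathcal Y=\{x\in\mathcal X: x+\mathcal Y\subseteq\mathcal X\}$. LQR: let $Q\succeq0$, $R\succ0$, let $P^{\rm lqr}$ be the unique positive definite solution of $P=A^\top PA-A^\top PB(R+B^\top PB)^{-1}B^\top PA+Q$, $K=-(R+B^\top P^{\rm lqr}B)^{-1}B^\top P^{\rm lqr}A$, $\pi^{\rm lqr}(x)=Kx$, $A_K=A+BK$, with spectral radius $\rho(A_K)<1$.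 Fix $\rho\in(\rho(A_K),1)$ and $\tau>0$ with $\|A_K^k\|\le\tau\rho^k$ for all $k\ge0$ and put $\kappa=\tau/(1-\rho)$. Disturbance invariant set: $\mathcal W=\mathbb B(\varepsilon)$ and $\Delta_{\mathcal W}$ is a fixed disturbance invariant set, i.e. a neighborhood around the origin with $A_K\Delta_{\mathcal W}+\mathcal W\subseteq\Delta_{\mathcal W}$, with $\Delta_{\mathcal W}\subseteq\mathbb B(\kappa\varepsilon)$ (the minimal such set is $\sum_{k\ge0}A_K^k\mathcal W$). Tightened sets: $\bar{\mathcal X}=\mathcal X\ominus\Delta_{\mathcal W}$, $\bar{\mathcal U}=\mathcal U\ominus K\Delta_{\mathcal W}$. $\bar{\mathcal O}_\infty$ is the maximal set $\mathcal O\subseteq\bar{\mathcal X}$ such that whenever $x_0\in\mathcal O$, the sequence $x_{t+1}=A_Kx_t$ satisfies $x_t\in\mathcal O$ and $Kx_t\in\bar{\mathcal U}$ for all $t\ge0$. The terminal set is $\bar{\mathcal X}_{\rm f}=\bar{\mathcal O}_\infty$. MPC with tightened constraints: for a horizon $N$, a state $x$ and $\boldsymbol u=(u_0,\dots,u_{N-1})$, let $V_N(x,\boldsymbol u)=\sum_{k=0}^{N-1}(x_k^\top Qx_k+u_k^\top Ru_k)+x_N^\top P^{\rm lqr}x_N$ where $x_0=x$, $x_{k+1}=Ax_k+Bu_k$. The problem $\overline{\rm MPC}$ at $x$ is: minimize $V_N(x,\boldsymbol u)$ over $\boldsymbol u$ subject to $x_k\in\bar{\mathcal X}$, $u_k\in\bar{\mathcal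 U}$ for all $k$ and $x_N\in\bar{\mathcal X}_{\rm f}$. $\bar{\mathcal X}_0$ is the set of $x$ for which it is feasible. The reference controller $\bar\pi:\bar{\mathcal X}_0\to\bar{\mathcal U}$ maps $x$ to the first input $u_0$ of the optimal solution of $\overline{\rm MPC}$ at $x$. Robust MPC: for $x\in(\bar{\mathcal X}_0\oplus\Delta_{\mathcal W})\cap\mathcal X$, minimize $V_N(x_0,\boldsymbol u)$ over $(x_0,\boldsymbol u)$ subject to the constraints of $\overline{\rm MPC}$ at $x_0$ and $x\in x_0\oplus\Delta_{\mathcal W}$; let $\bar x_0(x),\bar u_0(x),\dots,\bar u_{N-1}(x)$ be the optimal solution. The robust MPC controller is $\boldsymbol\pi(x)=\bar u_0(x)+K(x-\bar x_0(x))$. Outside the domain on which it is defined, the expert is evaluated at the projection of the state onto its domain. Initial states: $\mathcal D$ is a probability distribution on initial states supported almost surely in $\bar{\mathcal X}_0$. $\tau_\infty^\star$: a time step (depending only on the system parameters, independent of $T$) such that for every initial state $x_0$ in the support of $\mathcal D$ and every disturbance sequence $w_t\in\mathcal W$, the trajectory $x_{t+1}=Ax_t+B\boldsymbol\pi(x_t)+w_t$ satisfies $\bar x_0(x_{\tau_\infty^\star})\in\bar{\mathcal O}_\infty\ominus\Delta_{\mathcal W}$, and hence $x_{\tau_\infty^\star}\in\bar{\mathcal O}_\infty$. Forward Training Algorithm with parameters $n,T$ and expert $\pi^\star$: at stage $t=0,1,\dots,T-1$, given $\hat\pi_0,\dots,\hat\pi_{t-1}$, draw $m_t=\lceil n_t\rceil$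 fresh i.i.d. initial states $x_0^{(i)}\sim\mathcal D$, where $n_t=c\,n\,t\lceil\ln^2(t+1)\rceil+n$, $c=\sum_{s\ge1}\frac1{s\ln^2(s+1)}$, set $\hat x_t^{(i)}=\varphi_t(x_0^{(i)};\hat\pi_{0:t-1})$, and choose $\hat\pi_t\in\arg\min_{\pi\in\Pi}\frac1{m_t}\sum_{i=1}^{m_t}\|\pi^\star(\hat x_t^{(i)})-\pi(\hat x_t^{(i)})\|$. Forward-Switch with parameters $n,T,\ell$: initialize $\hat\tau_\infty=T$ and run the Forward Training Algorithm with expert $\pi^\star=\boldsymbol\pi$. At the end of each stage $t-1$ ($t\ge1$), sample $\ell$ fresh independent initial states from $\mathcal D$ and generate the corresponding states $\hat x_t^{(i)}$, $i=1,\dots,\ell$, at time $t$ under $\hat\pi_{0:t-1}$. If $\hat x_t^{(i)}\in\bar{\mathcal O}_\infty$ for all $i=1,\dots,\ell$, terminate the training and set $\hat\tau_\infty=t$; otherwise proceed to the next stage. Output $\tilde\pi_{0:T-1}$ with $\tilde\pi_t=\hat\pi_t$ for $t<\hat\tau_\infty$ and $\tilde\pi_t=\pi^{\rm lqr}$ for $\hat\tau_\infty\le t\le T-1$. "Randomness in the training process" is that of all initial states sampled by the algorithm. Costs: with stage cost $\ell_{\rm st}(x,u)=x^\top Qx+u^\top Ru$, the $T$-step costs are $\bar J_T(x_0)=\sum_{s=0}^{T-1}\ell_{\rm st}(\bar x_s,\bar\pi(\bar x_s))$ with $\bar x_s=\varphi_s(x_0;\bar\pi)$, and $\tilde J_T(x_0)=\sum_{s=0}^{T-1}\ell_{\rm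 st}(\tilde x_s,\tilde\pi_s(\tilde x_s))$ with $\tilde x_s=\varphi_s(x_0;\tilde\pi_{0:s-1})$. "System parameters" are the data defining the control problem ($A,B,Q,R,N,\mathcal X,\mathcal U$, the support of $\mathcal D$).
   Formalization: The bound P[x̂_τ̂∞ ∈ Ō∞] ≥ 1−δ is claimed only if τ̂∞ < T or τ*∞ ≤ T (it can fail when T < τ*∞ and τ̂∞ = T, e.g. T=1 and D far from Ō∞), and τ*∞ is taken ≥ 1 since the algorithm first tests at time 1. *)

theory Defs
  imports "HOL-Probability.Probability"
begin

section \<open>Constrained linear systems and the LQR\<close>

record ('n::finite, 'm::finite) mpc_system =
  Amat :: "real ^ 'n ^ 'n"
  Bmat :: "real ^ 'm ^ 'n"
  Qmat :: "real ^ 'n ^ 'n"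
  Rmat :: "real ^ 'm ^ 'm"
  horizon :: nat
  Xset :: "(real ^ 'n) set"
  Uset :: "(real ^ 'm) set"

definition pos_semidef :: "real ^ 'n ^ 'n \<Rightarrow> bool" where
  "pos_semidef M \<longleftrightarrow> transpose M = M \<and> (\<forall>x. 0 \<le> x \<bullet> (M *v x))"

definition pos_def :: "real ^ 'n ^ 'n \<Rightarrow> bool" where
  "pos_def M \<longleftrightarrow> transpose M = M \<and> (\<forall>x. x \<noteq> 0 \<longrightarrow> 0 < x \<bullet> (M *v x))"

definition riccati :: "('n::finite, 'm::finite) mpc_system \<Rightarrow> real ^ 'n ^ 'n \<Rightarrow> bool" where
  "riccati sys P \<longleftrightarrow>
     (let A = Amat sys; B = Bmat sys in
      P = transpose A ** P ** A
          - transpose A ** P ** B ** matrix_inv (Rmat sys + transpose B ** P ** B)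
              ** transpose B ** P ** A
          + Qmat sys)"

definition Plqr :: "('n::finite, 'm::finite) mpc_system \<Rightarrow> real ^ 'n ^ 'n" where
  "Plqr sys = (THE P. pos_def P \<and> riccati sys P)"

definition Kgain :: "('n::finite, 'm::finite) mpc_system \<Rightarrow> real ^ 'n ^ 'm" where
  "Kgain sys =
     (let A = Amat sys; B = Bmat sys; P = Plqr sys in
      - (matrix_inv (Rmat sys + transpose B ** P ** B) ** transpose B ** P ** A))"

definition AK :: "('n::finite, 'm::finite) mpc_system \<Rightarrow> real ^ 'n ^ 'n" where
  "AK sys = Amat sys + Bmat sys ** Kgain sys"

definition lqr_control :: "('n::finite, 'm::finite) mpc_system \<Rightarrow> real ^ 'n \<Rightarrow> real ^ 'm" where
  "lqr_control sys x = Kgain sys *v x"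

definition spectral_radius :: "real ^ 'n ^ 'n \<Rightarrow> real" where
  "spectral_radius M =
     Sup {cmod z | z. \<exists>v::complex ^ 'n. v \<noteq> 0 \<and> map_matrix complex_of_real M *v v = z *s v}"

definition mpc_data :: "('n::finite, 'm::finite) mpc_system \<Rightarrow> bool" where
  "mpc_data sys \<longleftrightarrow>
     pos_semidef (Qmat sys) \<and> pos_def (Rmat sys) \<and>
     (\<exists>!P. pos_def P \<and> riccati sys P) \<and> spectral_radius (AK sys) < 1 \<and>
     1 \<le> horizon sys \<and>
     polyhedron (Xset sys) \<and> 0 \<in> Xset sys \<and> polyhedron (Uset sys) \<and> 0 \<in> Uset sys"

definition stage_cost :: "('n::finite, 'm::finite) mpc_system \<Rightarrow> real ^ 'n \<Rightarrow> real ^ 'm \<Rightarrow> real" where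
  "stage_cost sys x u = x \<bullet> (Qmat sys *v x) + u \<bullet> (Rmat sys *v u)"

primrec open_loop ::
  "('n::finite, 'm::finite) mpc_system \<Rightarrow> real ^ 'n \<Rightarrow> (nat \<Rightarrow> real ^ 'm) \<Rightarrow> nat \<Rightarrow> real ^ 'n" where
  "open_loop sys x u 0 = x"
| "open_loop sys x u (Suc k) = Amat sys *v open_loop sys x u k + Bmat sys *v u k"

primrec closed_loop ::
  "('n::finite, 'm::finite) mpc_system \<Rightarrow> (nat \<Rightarrow> real ^ 'n \<Rightarrow> real ^ 'm) \<Rightarrow> real ^ 'n \<Rightarrow> nat \<Rightarrow> real ^ 'n"
where
  "closed_loop sys pol x 0 = x"
| "closed_loop sys pol x (Suc t) =
     Amat sys *v closed_loop sys pol x t + Bmat sys *v pol t (closed_loop sys pol x t)"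

primrec disturbed_loop ::
  "('n::finite, 'm::finite) mpc_system \<Rightarrow> (real ^ 'n \<Rightarrow> real ^ 'm) \<Rightarrow> (nat \<Rightarrow> real ^ 'n) \<Rightarrow> real ^ 'n
    \<Rightarrow> nat \<Rightarrow> real ^ 'n"
where
  "disturbed_loop sys pol w x 0 = x"
| "disturbed_loop sys pol w x (Suc t) =
     Amat sys *v disturbed_loop sys pol w x t + Bmat sys *v pol (disturbed_loop sys pol w x t) + w t"

definition total_cost ::
  "('n::finite, 'm::finite) mpc_system \<Rightarrow> (nat \<Rightarrow> real ^ 'n \<Rightarrow> real ^ 'm) \<Rightarrow> nat \<Rightarrow> real ^ 'n \<Rightarrow> real"
where
  "total_cost sys pol T x =
     (\<Sum>s<T. stage_cost sys (closed_loop sys pol x s) (pol s (closed_loop sys pol x s)))"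


section \<open>Tightened constraints and robust MPC\<close>

definition disturbance_invariant ::
  "('n::finite, 'm::finite) mpc_system \<Rightarrow> (real ^ 'n) set \<Rightarrow> (real ^ 'n) set \<Rightarrow> bool" where
  "disturbance_invariant sys W \<Delta> \<longleftrightarrow>
     0 \<in> interior \<Delta> \<and> {AK sys *v x + w | x w. x \<in> \<Delta> \<and> w \<in> W} \<subseteq> \<Delta>"

definition set_erosion :: "'a::ab_group_add set \<Rightarrow> 'a set \<Rightarrow> 'a set"  (infixl "\<ominus>\<^sub>s" 65) where
  "X \<ominus>\<^sub>s Y = {x \<in> X. \<forall>y\<in>Y. x + y \<in> X}"

definition Xbar :: "('n::finite, 'm::finite) mpc_system \<Rightarrow> (real ^ 'n) set \<Rightarrow> (real ^ 'n) set" where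
  "Xbar sys \<Delta> = Xset sys \<ominus>\<^sub>s \<Delta>"

definition Ubar :: "('n::finite, 'm::finite) mpc_system \<Rightarrow> (real ^ 'n) set \<Rightarrow> (real ^ 'm) set" where
  "Ubar sys \<Delta> = Uset sys \<ominus>\<^sub>s ((*v) (Kgain sys) ` \<Delta>)"

text \<open>Powers of matrices are written as iterates of the linear map, because multiplication, and
  hence \<open>^\<close>, on the type of matrices is componentwise.\<close>

definition lqr_admissible ::
  "('n::finite, 'm::finite) mpc_system \<Rightarrow> (real ^ 'n) set \<Rightarrow> (real ^ 'n) set \<Rightarrow> bool" where
  "lqr_admissible sys \<Delta> Z \<longleftrightarrow> Z \<subseteq> Xbar sys \<Delta> \<and>
     (\<forall>x\<in>Z. \<forall>t. ((*v) (AK sys) ^^ t) x \<in> Z \<and> Kgain sys *v ((*v) (AK sys) ^^ t) x \<in> Ubar sys \<Delta>)"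

text \<open>Admissibility is closed under arbitrary unions, so the union of all admissible sets is the
  maximal one.\<close>

definition Obar :: "('n::finite, 'm::finite) mpc_system \<Rightarrow> (real ^ 'n) set \<Rightarrow> (real ^ 'n) set" where
  "Obar sys \<Delta> = \<Union> {Z. lqr_admissible sys \<Delta> Z}"

definition mpc_value ::
  "('n::finite, 'm::finite) mpc_system \<Rightarrow> real ^ 'n \<Rightarrow> (nat \<Rightarrow> real ^ 'm) \<Rightarrow> real" where
  "mpc_value sys x u =
     (let N = horizon sys; z = open_loop sys x u in
      (\<Sum>k<N. stage_cost sys (z k) (u k)) + z N \<bullet> (Plqr sys *v z N))"

definition mpc_feasible ::
  "('n::finite, 'm::finite) mpc_system \<Rightarrow> (real ^ 'n) set \<Rightarrow> real ^ 'n \<Rightarrow> (nat \<Rightarrow> real ^ 'm) \<Rightarrow> bool" where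
  "mpc_feasible sys \<Delta> x u \<longleftrightarrow>
     (\<forall>k<horizon sys. open_loop sys x u k \<in> Xbar sys \<Delta> \<and> u k \<in> Ubar sys \<Delta>) \<and>
     open_loop sys x u (horizon sys) \<in> Obar sys \<Delta>"

definition Xbar0 :: "('n::finite, 'm::finite) mpc_system \<Rightarrow> (real ^ 'n) set \<Rightarrow> (real ^ 'n) set" where
  "Xbar0 sys \<Delta> = {x. \<exists>u. mpc_feasible sys \<Delta> x u}"

text \<open>An input sequence is a function on all of \<open>nat\<close> of which only the first \<open>horizon sys\<close>
  values matter.  Minimisers are therefore unique only up to the irrelevant later values, and
  \<open>arg_min\<close> picks one of them.\<close>

definition mpc_control ::
  "('n::finite, 'm::finite) mpc_system \<Rightarrow> (real ^ 'n) set \<Rightarrow> real ^ 'n \<Rightarrow> real ^ 'm" where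
  "mpc_control sys \<Delta> x = (arg_min (mpc_value sys x) (mpc_feasible sys \<Delta> x)) 0"

definition rmpc_domain ::
  "('n::finite, 'm::finite) mpc_system \<Rightarrow> (real ^ 'n) set \<Rightarrow> (real ^ 'n) set" where
  "rmpc_domain sys \<Delta> = {z + d | z d. z \<in> Xbar0 sys \<Delta> \<and> d \<in> \<Delta>} \<inter> Xset sys"

definition rmpc_solution ::
  "('n::finite, 'm::finite) mpc_system \<Rightarrow> (real ^ 'n) set \<Rightarrow> real ^ 'n
    \<Rightarrow> (real ^ 'n) \<times> (nat \<Rightarrow> real ^ 'm)" where
  "rmpc_solution sys \<Delta> x =
     arg_min (\<lambda>(z, u). mpc_value sys z u)
       (\<lambda>(z, u). mpc_feasible sys \<Delta> z u \<and> x \<in> {z + d | d. d \<in> \<Delta>})"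

definition xbar0 ::
  "('n::finite, 'm::finite) mpc_system \<Rightarrow> (real ^ 'n) set \<Rightarrow> real ^ 'n \<Rightarrow> real ^ 'n" where
  "xbar0 sys \<Delta> x = fst (rmpc_solution sys \<Delta> x)"

definition ubar0 ::
  "('n::finite, 'm::finite) mpc_system \<Rightarrow> (real ^ 'n) set \<Rightarrow> real ^ 'n \<Rightarrow> real ^ 'm" where
  "ubar0 sys \<Delta> x = snd (rmpc_solution sys \<Delta> x) 0"

definition rmpc_control ::
  "('n::finite, 'm::finite) mpc_system \<Rightarrow> (real ^ 'n) set \<Rightarrow> real ^ 'n \<Rightarrow> real ^ 'm" where
  "rmpc_control sys \<Delta> x = ubar0 sys \<Delta> x + Kgain sys *v (x - xbar0 sys \<Delta> x)"

definition expert ::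
  "('n::finite, 'm::finite) mpc_system \<Rightarrow> (real ^ 'n) set \<Rightarrow> real ^ 'n \<Rightarrow> real ^ 'm" where
  "expert sys \<Delta> x = rmpc_control sys \<Delta> (closest_point (rmpc_domain sys \<Delta>) x)"

text \<open>\<open>reaching_time sys \<Delta> W S \<tau>\<close>: the robust closed loop started anywhere in \<open>S\<close> has its
  nominal state \<open>xbar0\<close> in the eroded terminal set at time \<open>\<tau>\<close>, whatever the disturbances.
  The time is positive, since the algorithm below first tests at time 1.\<close>

definition reaching_time ::
  "('n::finite, 'm::finite) mpc_system \<Rightarrow> (real ^ 'n) set \<Rightarrow> (real ^ 'n) set \<Rightarrow> (real ^ 'n) set
    \<Rightarrow> nat \<Rightarrow> bool" where
  "reaching_time sys \<Delta> W S \<tau> \<longleftrightarrow> 1 \<le> \<tau> \<and>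
     (\<forall>x0\<in>S. \<forall>w. (\<forall>t. w t \<in> W) \<longrightarrow>
        xbar0 sys \<Delta> (disturbed_loop sys (expert sys \<Delta>) w x0 \<tau>) \<in> Obar sys \<Delta> \<ominus>\<^sub>s \<Delta>)"


section \<open>Forward-Switch\<close>

definition measure_support :: "'a::topological_space measure \<Rightarrow> 'a set" where
  "measure_support D = {x. \<forall>V. open V \<longrightarrow> x \<in> V \<longrightarrow> 0 < measure D V}"

definition train_const :: real where
  "train_const = (\<Sum>j. 1 / (real (Suc j) * (ln (real (Suc j) + 1))\<^sup>2))"

definition num_train :: "nat \<Rightarrow> nat \<Rightarrow> nat" where
  "num_train n t =
     nat \<lceil>train_const * real n * real t * of_int \<lceil>(ln (real t + 1))\<^sup>2\<rceil> + real n\<rceil>"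

text \<open>\<open>Train t i\<close> labels the \<open>i\<close>-th initial state drawn for learning the controller of stage
  \<open>t\<close>; \<open>Test t i\<close> labels the \<open>i\<close>-th initial state drawn at the end of stage \<open>t - 1\<close> in order to
  test the states at time \<open>t\<close>.  All samples that may ever be used are put into one
  product space; those of stages after termination are simply not looked at.\<close>

datatype sample_label = Train nat nat | Test nat nat

definition sample_labels :: "nat \<Rightarrow> nat \<Rightarrow> nat \<Rightarrow> sample_label set" where
  "sample_labels n T l =
     {Train t i | t i. t < T \<and> i < num_train n t} \<union> {Test t i | t i. 1 \<le> t \<and> t \<le> T \<and> i < l}"

definition training_space ::
  "(real ^ 'n) measure \<Rightarrow> nat \<Rightarrow> nat \<Rightarrow> nat \<Rightarrow> (sample_label \<Rightarrow> real ^ 'n) measure" where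
  "training_space D n T l = PiM (sample_labels n T l) (\<lambda>_. D)"

text \<open>The labels of the samples available when the controller of stage \<open>t\<close> is chosen.\<close>

definition seen_labels :: "nat \<Rightarrow> nat \<Rightarrow> nat \<Rightarrow> nat \<Rightarrow> sample_label set" where
  "seen_labels n T l t =
     sample_labels n T l \<inter> ({Train s i | s i. s \<le> t} \<union> {Test s i | s i. s \<le> t})"

definition empirical_loss ::
  "('n::finite, 'm::finite) mpc_system \<Rightarrow> (real ^ 'n \<Rightarrow> real ^ 'm) \<Rightarrow> nat
    \<Rightarrow> (sample_label \<Rightarrow> real ^ 'n) \<Rightarrow> (nat \<Rightarrow> real ^ 'n \<Rightarrow> real ^ 'm) \<Rightarrow> nat
    \<Rightarrow> (real ^ 'n \<Rightarrow> real ^ 'm) \<Rightarrow> real" where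
  "empirical_loss sys pstar n \<omega> pihat t p =
     1 / real (num_train n t) *
       (\<Sum>i<num_train n t.
          let x = closed_loop sys pihat (\<omega> (Train t i)) t in norm (pstar x - p x))"

definition test_passed ::
  "('n::finite, 'm::finite) mpc_system \<Rightarrow> (real ^ 'n) set \<Rightarrow> nat \<Rightarrow> (sample_label \<Rightarrow> real ^ 'n)
    \<Rightarrow> (nat \<Rightarrow> real ^ 'n \<Rightarrow> real ^ 'm) \<Rightarrow> nat \<Rightarrow> bool" where
  "test_passed sys Z l \<omega> pihat t \<longleftrightarrow> (\<forall>i<l. closed_loop sys pihat (\<omega> (Test t i)) t \<in> Z)"

definition stop_time ::
  "('n::finite, 'm::finite) mpc_system \<Rightarrow> (real ^ 'n) set \<Rightarrow> nat \<Rightarrow> nat \<Rightarrow> (sample_label \<Rightarrow> real ^ 'n)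
    \<Rightarrow> (nat \<Rightarrow> real ^ 'n \<Rightarrow> real ^ 'm) \<Rightarrow> nat" where
  "stop_time sys Z T l \<omega> pihat =
     (if \<exists>t\<in>{1..T}. test_passed sys Z l \<omega> pihat t
      then LEAST t. t \<in> {1..T} \<and> test_passed sys Z l \<omega> pihat t
      else T)"

text \<open>\<open>pihat \<omega> t\<close> is the controller learned at stage \<open>t\<close> when the samples are \<open>\<omega>\<close>.  It may be any
  empirical risk minimiser; ties are broken by an arbitrary measurable rule that uses only the
  samples drawn so far (a rule looking at future samples would make these not fresh).  At stages
  that are not reached, \<open>pihat\<close> has no meaning and no minimisation is required.\<close>

definition forward_switch_run ::
  "('n::finite, 'm::finite) mpc_system \<Rightarrow> (real ^ 'n) set \<Rightarrow> (real ^ 'n) measure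
    \<Rightarrow> (real ^ 'n \<Rightarrow> real ^ 'm) \<Rightarrow> (real ^ 'n \<Rightarrow> real ^ 'm) set \<Rightarrow> nat \<Rightarrow> nat \<Rightarrow> nat
    \<Rightarrow> ((sample_label \<Rightarrow> real ^ 'n) \<Rightarrow> nat \<Rightarrow> real ^ 'n \<Rightarrow> real ^ 'm) \<Rightarrow> bool" where
  "forward_switch_run sys Z D pstar Pols n T l pihat \<longleftrightarrow>
     (let \<Omega> = training_space D n T l in
      (\<forall>\<omega>\<in>space \<Omega>. \<forall>t < stop_time sys Z T l \<omega> (pihat \<omega>).
         is_arg_min (empirical_loss sys pstar n \<omega> (pihat \<omega>) t) (\<lambda>p. p \<in> Pols) (pihat \<omega> t)) \<and>
      (\<forall>t<T. \<forall>\<omega>\<in>space \<Omega>. \<forall>\<omega>'\<in>space \<Omega>.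
         (\<forall>j\<in>seen_labels n T l t. \<omega> j = \<omega>' j) \<longrightarrow> pihat \<omega> t = pihat \<omega>' t) \<and>
      (\<forall>t<T. \<forall>p\<in>Pols. {\<omega> \<in> space \<Omega>. pihat \<omega> t = p} \<in> sets \<Omega>))"

definition switched_policy ::
  "('n::finite, 'm::finite) mpc_system \<Rightarrow> nat \<Rightarrow> (nat \<Rightarrow> real ^ 'n \<Rightarrow> real ^ 'm)
    \<Rightarrow> nat \<Rightarrow> real ^ 'n \<Rightarrow> real ^ 'm" where
  "switched_policy sys \<tau> pihat t = (if t < \<tau> then pihat t else lqr_control sys)"

end

theory Submission
  imports Defs "HOL-Library.Function_Algebras" "HOL-Real_Asymp.Real_Asymp"
begin

text \<open>The theorem joins a deterministic perturbation bound for robust MPC to a union bound over three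
  bad events of the training.

  \<^bold>\<open>The MPC law is Lipschitz, uniformly in the tightening.\<close>
  Completing the square with the Riccati equation (\<open>complete_square\<close>) turns the MPC cost of an input
  sequence into \<open>x \<bullet> P x\<close> plus a weighted square norm of the deviations \<open>v k = u k - K x k\<close> from
  the LQR.  Hence MPC selects the deviations of least norm in a polyhedron that moves linearly with
  the state (\<open>pre_opt\<close>).  The tightening \<open>\<Delta>\<close> changes only the right-hand sides of
  the inequalities.  For small \<open>\<epsilon>\<close> a fixed ball lies in the terminal set (\<open>cball_subset_Obar\<close>), so that,
  on bounded sets of states, the inequalities of finitely many time steps describe the polyhedron
  (\<open>truncation\<close>).  The point of least norm of a polyhedron with finitely many fixed normals is
  Lipschitz in the shift of the polyhedron, with a constant independent of the right-hand sides
  (\<open>opt_lipschitz\<close>); this gives \<open>first_input_lipschitz\<close>.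

  \<^bold>\<open>The learner follows the reference.\<close>
  Along the reference closed loop the weighted squares of the applied deviations have a bounded sum,
  and \<open>A + B K\<close> is stable; therefore the reference enters a small ball around the origin within a
  time depending on the system only (\<open>mpc_run_converges\<close>).  As long as the learner is
  \<open>\<epsilon> / onorm B\<close>-close to the robust expert, it is a robust closed loop with disturbances of norm at
  most \<open>\<epsilon>\<close>, and the nominal state of the robust problem satisfies the reference recursion up to
  \<open>O(\<epsilon>)\<close> (\<open>learner_tracks\<close>).  During the bounded initial phase the Lipschitz bound controls the growth of the
  distance to the reference; afterwards both trajectories stay in the terminal set, where the law is linear
  and stable, and the distance remains \<open>O(\<epsilon>)\<close> forever (\<open>tracking_error\<close>).  The stage costs therefore differ
  by \<open>O(\<epsilon>)\<close> before the switch and by a geometric series afterwards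
  (\<open>small_disturbance_regret\<close>).  When \<open>\<epsilon>\<close> is not small, it is enough to bound the cost of the
  learner by a multiple of \<open>\<tau>star\<close>, which holds because the optimal value of the robust problem never increases
  (\<open>robust_state_bound\<close>).

  \<^bold>\<open>Training succeeds.\<close>
  The expert belongs to the policy class and has empirical loss zero, so each learned controller agrees with the expert
  on its training states.  A controller that is far from the expert with probability more than
  \<open>r\<close> survives \<open>m\<close> fresh samples with probability at most \<open>(1 - r) ^ m\<close>.  The controllers learned before
  a stage form one of finitely many tuples, and the event that they form a given tuple is
  independent of the fresh samples of that stage (\<open>prob_learned_fresh\<close>).  Three bad events have
  probability at most \<open>\<delta>\<close> each: some stage overlooks a far controller, the test at time \<open>\<tau>star\<close> fails although
  it should succeed, or some test passes although the probability of being in the terminal set is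
  below \<open>1 - \<delta>\<close>.  Outside of them the claims on the stopping time and on the two probabilities hold
  (\<open>good_event\<close>).\<close>

section \<open>Points of least norm in a moving polyhedron\<close>

text \<open>A local Lipschitz bound on each member of a finite closed cover is a global one: start in a
  member containing \<open>a\<close>, jump to its last point in the interval, and continue with the other
  members. The function \<open>D\<close> plays the role of \<open>dist (f s) (f t)\<close> for a curve \<open>f\<close> in a
  seminormed space.\<close>

lemma lipschitz_glue:
  fixes D :: "real \<Rightarrow> real \<Rightarrow> real"
  assumes fin: "finite F" and cl: "\<And>A. A \<in> F \<Longrightarrow> closed A"
    and tri: "\<And>s t u. D s u \<le> D s t + D t u"
    and refl: "\<And>s. D s s \<le> 0"
    and lip: "\<And>A s t. A \<in> F \<Longrightarrow> s \<in> A \<Longrightarrow> t \<in> A \<Longrightarrow> s \<le> t \<Longrightarrow> D s t \<le> L * (t - s)"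
    and "a \<le> b" and cov: "{a..b} \<subseteq> \<Union>F"
  shows "D a b \<le> L * (b - a)"
  using fin cl lip \<open>a \<le> b\<close> cov
proof (induction "card F" arbitrary: F a)
  case 0
  then show ?case by (simp add: subset_iff) 
next
  case (Suc n)
  from Suc.prems have "a \<in> \<Union>F" by auto
  then obtain A where A: "A \<in> F" "a \<in> A" by auto
  let ?S = "A \<inter> {a..b}"
  have cS: "compact ?S" using Suc.prems(2)[OF A(1)] by (simp add: closed_Int_compact)
  have neS: "?S \<noteq> {}" using A Suc.prems by auto
  obtain c where c: "c \<in> ?S" and cmax: "\<And>t. t \<in> ?S \<Longrightarrow> t \<le> c"
    using compact_attains_sup[OF cS neS] by blast
  have ac: "D a c \<le> L * (c - a)" using Suc.prems(3)[OF A(1) A(2), of c] c by auto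
  show ?case
  proof (cases "c = b")
    case True then show ?thesis using ac by simp
  next
    case False
    with c have cb: "c < b" by auto
    let ?G = "F - {A}"
    have fG: "finite ?G" using Suc.prems by auto
    have cG: "closed (\<Union>?G)" using fG Suc.prems(2) by (intro closed_Union) auto
    \<comment> \<open>beyond \<open>c\<close> the member \<open>A\<close> does not occur any more; closedness of the others includes \<open>c\<close> itself\<close>
    have sub: "{c<..b} \<subseteq> \<Union>?G"
    proof
      fix t assume t: "t \<in> {c<..b}"
      then have "t \<in> {a..b}" using c by auto
      then obtain B where "B \<in> F" "t \<in> B" using Suc.prems(5) by auto
      moreover have "t \<notin> A" using cmax[of t] t c by auto
      ultimately show "t \<in> \<Union>?G" by auto
    qed
    have "closure {c<..b} \<subseteq> \<Union>?G" using sub cG by (rule closure_minimal)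
    moreover have "closure {c<..b} = {c..b}" using cb by simp
    ultimately have cov': "{c..b} \<subseteq> \<Union>?G" by simp
    have "D c b \<le> L * (b - c)"
    proof (rule Suc.hyps(1)[of ?G])
      show "n = card ?G" using Suc.hyps(2) A Suc.prems(1) by simp
    qed (use Suc.prems fG cov' cb in auto)
    with ac tri[of a b c] show ?thesis by (simp add: algebra_simps)
  qed
qed

text \<open>Input sequences are functions on all of \<open>nat\<close> of which only finitely many values enter the
  cost. The cost is therefore only a semi-inner product, and Cauchy-Schwarz and the triangle
  inequality are derived in this generality.\<close>

locale semi_inner =
  fixes form :: "'v::real_vector \<Rightarrow> 'v \<Rightarrow> real"
  assumes form_linear: "linear (form u)"
    and form_sym: "form u v = form v u"
    and form_nonneg: "0 \<le> form v v"
begin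

lemma form_add: "form u (v + w) = form u v + form u w" "form (v + w) u = form v u + form w u"
  and form_scale: "form u (c *\<^sub>R v) = c * form u v" "form (c *\<^sub>R v) u = c * form v u"
  and form_diff: "form u (v - w) = form u v - form u w" "form (v - w) u = form v u - form w u"
  and form_minus: "form u (- v) = - form u v" "form (- v) u = - form v u"
  using form_linear[of u] form_sym
  by (auto simp: linear_add linear_scale linear_diff linear_neg)

lemma form_diff_sq: "form (u - v) (u - v) = form u u - 2 * form u v + form v v"
  using form_sym[of v u] by (simp add: form_diff)

definition nrm :: "'v \<Rightarrow> real" where "nrm v = sqrt (form v v)"

lemma nrm_sq: "(nrm v)\<^sup>2 = form v v"
  unfolding nrm_def using form_nonneg by simp

lemma nrm_nonneg: "0 \<le> nrm v"
  unfolding nrm_def using form_nonneg by simp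

lemma nrm_le_iff: "nrm v \<le> nrm w \<longleftrightarrow> form v v \<le> form w w"
  unfolding nrm_def by simp

lemma nrm_zero_scale: "nrm 0 = 0" "nrm (c *\<^sub>R v) = \<bar>c\<bar> * nrm v"
proof -
  show "nrm (c *\<^sub>R v) = \<bar>c\<bar> * nrm v" for c
    unfolding nrm_def by (simp add: form_scale real_sqrt_mult mult.assoc[symmetric])
  from this[of 0] show "nrm 0 = 0" by simp
qed

lemma form_Cauchy_Schwarz: "\<bar>form u v\<bar> \<le> nrm u * nrm v"
proof -
  let ?a = "form u u" and ?b = "form u v" and ?c = "form v v"
  have q: "0 \<le> ?a + 2 * t * ?b + t\<^sup>2 * ?c" for t
    using form_nonneg[of "u + t *\<^sub>R v"] form_sym[of v u]
    by (simp add: form_add form_scale algebra_simps power2_eq_square)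
  have "?b\<^sup>2 \<le> ?a * ?c"
  proof (cases "?c = 0")
    case True
    have "?b = 0"
    proof (rule ccontr)
      assume b: "?b \<noteq> 0"
      show False using q[of "- (?a + 1) / (2 * ?b)"] b True by (simp add: field_simps)
    qed
    then show ?thesis using True by simp
  next
    case False
    then have c: "?c > 0" using form_nonneg[of v] by simp
    have "0 \<le> ?a - ?b\<^sup>2 / ?c"
      using q[of "- ?b / ?c"] c by (simp add: field_simps power2_eq_square)
    then show ?thesis using c by (simp add: field_simps)
  qed
  then have "sqrt (?b\<^sup>2) \<le> sqrt (?a * ?c)" by (rule real_sqrt_le_mono)
  then show ?thesis unfolding nrm_def by (simp add: real_sqrt_mult)
qed

lemma nrm_triangle: "nrm (u + v) \<le> nrm u + nrm v"
proof -
  have "(nrm (u + v))\<^sup>2 = form u u + 2 * form u v + form v v"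
    unfolding nrm_sq using form_sym[of v u] by (simp add: form_add)
  also have "\<dots> \<le> (nrm u + nrm v)\<^sup>2"
    using form_Cauchy_Schwarz[of u v] nrm_sq[of u] nrm_sq[of v] by (simp add: power2_sum)
  finally show ?thesis using nrm_nonneg[of u] nrm_nonneg[of v] by (meson add_nonneg_nonneg power2_le_imp_le)
qed

lemma nrm_triangle_diff: "nrm (u - w) \<le> nrm (u - v) + nrm (v - w)"
  using nrm_triangle[of "u - v" "v - w"] by simp

text \<open>Finitely many functionals have a bounded right inverse on their joint range: values attained
  by some \<open>d\<close> are attained by an \<open>e\<close> whose norm is controlled by the values. Induction on
  the set of functionals: a new functional either is determined by the old ones, or is
  nonzero on a vector \<open>k\<close> in their common kernel, along which \<open>e\<close> can be corrected.\<close>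

lemma bounded_right_inverse:
  fixes g :: "'i \<Rightarrow> 'v \<Rightarrow> real"
  assumes "finite J" and "\<And>i. linear (g i)" and "\<And>i v. i \<in> J \<Longrightarrow> \<bar>g i v\<bar> \<le> c * nrm v" and "0 \<le> c"
  shows "\<exists>C\<ge>0. \<forall>d \<eta>. (\<forall>i\<in>J. \<bar>g i d\<bar> \<le> \<eta>) \<longrightarrow> 0 \<le> \<eta> \<longrightarrow> (\<exists>e. (\<forall>i\<in>J. g i e = g i d) \<and> nrm e \<le> C * \<eta>)"
  using assms(1) assms(3)
proof (induction J rule: finite_induct)
  case empty
  have "nrm 0 \<le> 0 * \<eta>" for \<eta> :: real by (simp add: nrm_zero_scale)
  then show ?case by (intro exI[of _ 0]) auto
next
  case (insert j J)
  then obtain C where C: "C \<ge> 0" and CJ: "\<And>d \<eta>. (\<forall>i\<in>J. \<bar>g i d\<bar> \<le> \<eta>) \<Longrightarrow> 0 \<le> \<eta> \<Longrightarrow>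
      (\<exists>e. (\<forall>i\<in>J. g i e = g i d) \<and> nrm e \<le> C * \<eta>)"
    using insert.IH insert.prems by auto
  have gj: "\<bar>g j v\<bar> \<le> c * nrm v" for v using insert.prems by auto
  show ?case
  proof (cases "\<exists>k. (\<forall>i\<in>J. g i k = 0) \<and> g j k \<noteq> 0")
    case True
    then obtain k0 where k0: "\<forall>i\<in>J. g i k0 = 0" "g j k0 \<noteq> 0" by auto
    define k where "k = (1 / g j k0) *\<^sub>R k0"
    have k: "\<forall>i\<in>J. g i k = 0" "g j k = 1"
      using k0 assms(2) by (auto simp: k_def linear_scale)
    let ?C = "C + (1 + c * C) * nrm k"
    have "\<exists>e. (\<forall>i\<in>insert j J. g i e = g i d) \<and> nrm e \<le> ?C * \<eta>"
      if d: "\<forall>i\<in>insert j J. \<bar>g i d\<bar> \<le> \<eta>" and \<eta>: "0 \<le> \<eta>" for d \<eta>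
    proof -
      obtain e where e: "\<forall>i\<in>J. g i e = g i d" "nrm e \<le> C * \<eta>" using CJ[of d \<eta>] d \<eta> by auto
      let ?e = "e + (g j d - g j e) *\<^sub>R k"
      have 1: "\<forall>i\<in>insert j J. g i ?e = g i d"
        using e k assms(2) by (auto simp: linear_add linear_scale)
      have "\<bar>g j d - g j e\<bar> \<le> \<eta> + c * (C * \<eta>)"
      proof -
        have "\<bar>g j d\<bar> \<le> \<eta>" using d by auto
        moreover have "\<bar>g j e\<bar> \<le> c * (C * \<eta>)"
          using gj[of e] e(2) assms(4) by (meson mult_left_mono order_trans)
        ultimately show ?thesis by linarith
      qed
      then have "\<bar>g j d - g j e\<bar> * nrm k \<le> (\<eta> + c * (C * \<eta>)) * nrm k"
        by (rule mult_right_mono) (rule nrm_nonneg)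
      then have "nrm ?e \<le> C * \<eta> + (\<eta> + c * (C * \<eta>)) * nrm k"
        using nrm_triangle[of e "(g j d - g j e) *\<^sub>R k"] e(2) by (simp add: nrm_zero_scale)
      also have "\<dots> = ?C * \<eta>" by (simp add: algebra_simps)
      finally show ?thesis using 1 by blast
    qed
    moreover have "0 \<le> ?C" using C assms(4) nrm_nonneg[of k] by simp
    ultimately show ?thesis by blast
  next
    case False
    have "\<exists>e. (\<forall>i\<in>insert j J. g i e = g i d) \<and> nrm e \<le> C * \<eta>"
      if d: "\<forall>i\<in>insert j J. \<bar>g i d\<bar> \<le> \<eta>" and \<eta>: "0 \<le> \<eta>" for d \<eta>
    proof -
      obtain e where e: "\<forall>i\<in>J. g i e = g i d" "nrm e \<le> C * \<eta>" using CJ[of d \<eta>] d \<eta> by auto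
      have "\<forall>i\<in>J. g i (e - d) = 0" using e assms(2) by (auto simp: linear_diff)
      then have "g j (e - d) = 0" using False by auto
      then have "g j e = g j d" using assms(2) by (auto simp: linear_diff)
      with e show ?thesis by blast
    qed
    with C show ?thesis by blast
  qed
qed

end

text \<open>The polyhedron \<open>{v. \<forall>i\<in>I. g i v + h i x \<le> b i}\<close> moves with the parameter \<open>x\<close>. Completeness
  of the seminorm is what closes the pieces of \<open>opt_lipschitz\<close>.\<close>

locale parametric_min_norm = semi_inner form
  for form :: "'v::real_vector \<Rightarrow> 'v \<Rightarrow> real" +
  fixes I :: "'i set" and g :: "'i \<Rightarrow> 'v \<Rightarrow> real" and h :: "'i \<Rightarrow> 'x::real_normed_vector \<Rightarrow> real"
    and cg ch :: real
  assumes finite_I: "finite I"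
    and g_linear: "linear (g i)" and h_linear: "linear (h i)"
    and g_bounded: "i \<in> I \<Longrightarrow> \<bar>g i v\<bar> \<le> cg * nrm v"
    and h_bounded: "i \<in> I \<Longrightarrow> \<bar>h i x\<bar> \<le> ch * norm x"
    and cg_nonneg: "0 \<le> cg" and ch_nonneg: "0 \<le> ch"
    and complete: "(\<And>e. 0 < e \<Longrightarrow> \<exists>n. \<forall>p\<ge>n. \<forall>q\<ge>n. nrm (X p - X q) < e)
          \<Longrightarrow> \<exists>l. (\<lambda>p. nrm (X p - l)) \<longlonglongrightarrow> 0"
begin

definition feas :: "('i \<Rightarrow> real) \<Rightarrow> 'x \<Rightarrow> 'v \<Rightarrow> bool" where
  "feas b x v \<longleftrightarrow> (\<forall>i\<in>I. g i v + h i x \<le> b i)"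

definition opt :: "('i \<Rightarrow> real) \<Rightarrow> 'x \<Rightarrow> 'v \<Rightarrow> bool" where
  "opt b x v \<longleftrightarrow> feas b x v \<and> (\<forall>w. feas b x w \<longrightarrow> nrm v \<le> nrm w)"

text \<open>The first-order conditions on the face where the inequalities in \<open>J\<close> are equalities. Unlike
  optimality with active set exactly \<open>J\<close>, this condition is closed in \<open>(x, v)\<close>.\<close>

definition face_opt :: "'i set \<Rightarrow> ('i \<Rightarrow> real) \<Rightarrow> 'x \<Rightarrow> 'v \<Rightarrow> bool" where
  "face_opt J b x v \<longleftrightarrow> feas b x v \<and> (\<forall>i\<in>J. g i v + h i x = b i) \<and>
     (\<forall>d. (\<forall>i\<in>J. g i d \<le> 0) \<longrightarrow> 0 \<le> form v d)"

text \<open>With \<open>J\<close> the set of active inequalities, a direction that does not increase any active one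
  can be followed for a short time, and the norm must not decrease along it.\<close>

lemma opt_imp_face_opt:
  assumes "opt b x v"
  shows "\<exists>J\<in>Pow I. face_opt J b x v"
proof -
  define J where "J = {i\<in>I. g i v + h i x = b i}"
  have fv: "feas b x v" using assms by (simp add: opt_def)
  have "0 \<le> form v d" if d: "\<forall>i\<in>J. g i d \<le> 0" for d
  proof -
    have "\<forall>\<^sub>F t in at_right 0. feas b x (v + t *\<^sub>R d)"
      unfolding feas_def
    proof (rule eventually_ball_finite[OF finite_I], rule ballI)
      fix i assume i: "i \<in> I"
      show "\<forall>\<^sub>F t in at_right 0. g i (v + t *\<^sub>R d) + h i x \<le> b i"
      proof (cases "i \<in> J")
        case True
        have "g i (v + t *\<^sub>R d) + h i x \<le> b i" if "t > 0" for t
        proof -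
          have "t * g i d \<le> 0" using True d that by (auto intro!: mult_nonneg_nonpos)
          then show ?thesis using True g_linear[of i] by (simp add: J_def linear_add linear_scale)
        qed
        then show ?thesis by (auto simp: eventually_at_filter)
      next
        case False
        then have "g i v + h i x < b i" using fv i by (auto simp: feas_def J_def less_le)
        moreover have "((\<lambda>t. g i v + t * g i d + h i x) \<longlongrightarrow> g i v + 0 * g i d + h i x) (at_right 0)"
          by (intro tendsto_intros)
        ultimately have "\<forall>\<^sub>F t in at_right 0. g i v + t * g i d + h i x < b i"
          by (auto dest: order_tendstoD(2))
        then show ?thesis
          by eventually_elim (use g_linear[of i] in \<open>auto simp: linear_add linear_scale\<close>)
      qed
    qed
    then have ev: "\<forall>\<^sub>F t in at_right 0. 0 \<le> 2 * form v d + t * form d d"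
    proof (rule eventually_elim2)
      show "\<forall>\<^sub>F t in at_right (0::real). 0 < t" by (simp add: eventually_at_filter)
      fix t :: real assume "feas b x (v + t *\<^sub>R d)" and t: "0 < t"
      then have "form v v \<le> form (v + t *\<^sub>R d) (v + t *\<^sub>R d)"
        using assms by (simp add: opt_def nrm_le_iff)
      then have "0 \<le> t * (2 * form v d + t * form d d)"
        using form_sym[of d v] by (simp add: form_add form_scale algebra_simps)
      then show "0 \<le> 2 * form v d + t * form d d" using t by (simp add: zero_le_mult_iff)
    qed
    have "((\<lambda>t. 2 * form v d + t * form d d) \<longlongrightarrow> 2 * form v d + 0 * form d d) (at_right 0)"
      by (intro tendsto_intros)
    from tendsto_lowerbound[OF this ev] show ?thesis by simp
  qed
  then have "face_opt J b x v" using fv by (auto simp: face_opt_def J_def)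
  then show ?thesis by (auto simp: J_def)
qed

lemma face_opt_imp_opt: "face_opt J b x v \<Longrightarrow> J \<subseteq> I \<Longrightarrow> opt b x v"
  unfolding opt_def
proof (intro conjI allI impI)
  assume f: "face_opt J b x v" and J: "J \<subseteq> I"
  show "feas b x v" using f by (simp add: face_opt_def)
  fix w assume w: "feas b x w"
  have "\<forall>i\<in>J. g i (w - v) \<le> 0"
  proof
    fix i assume "i \<in> J"
    then have "g i v + h i x = b i" "g i w + h i x \<le> b i" using f w J by (auto simp: face_opt_def feas_def)
    then show "g i (w - v) \<le> 0" using g_linear[of i] by (simp add: linear_diff)
  qed
  then have "0 \<le> form v (w - v)" using f by (simp add: face_opt_def)
  moreover have "form w w = form v v + 2 * form v (w - v) + form (w - v) (w - v)"
    using form_sym[of w v] by (simp add: form_diff)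
  ultimately show "nrm v \<le> nrm w" using form_nonneg[of "w - v"] by (simp add: nrm_le_iff)
qed

text \<open>The midpoint of two optimal points would have smaller norm otherwise.\<close>

lemma opt_unique:
  assumes "opt b x v" "opt b x w"
  shows "nrm (v - w) = 0"
proof -
  let ?m = "(1/2) *\<^sub>R (v + w)"
  have "feas b x ?m"
    using assms g_linear unfolding opt_def feas_def
    by (force simp: linear_add linear_scale)
  then have m: "form v v \<le> form ?m ?m" using assms(1) by (simp add: opt_def nrm_le_iff)
  have vw: "form v v = form w w" using assms by (meson antisym nrm_le_iff opt_def)
  have "form (v - w) (v - w) \<le> 0"
    using m vw form_sym[of v w] by (simp add: form_add form_scale form_diff algebra_simps)
  then have "form (v - w) (v - w) = 0" using form_nonneg antisym by blast
  then show ?thesis by (simp add: nrm_def)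
qed

lemma face_opt_nrm_cong:
  assumes "face_opt J b x v" "nrm (v - w) = 0" "J \<subseteq> I"
  shows "face_opt J b x w"
proof -
  have "g i v = g i w" if "i \<in> I" for i
    using g_bounded[OF that, of "v - w"] assms(2) g_linear[of i] by (simp add: linear_diff)
  moreover have "form v d = form w d" for d
    using form_Cauchy_Schwarz[of "v - w" d] assms(2) by (simp add: form_diff)
  ultimately show ?thesis using assms(1,3) unfolding face_opt_def feas_def by (metis subsetD)
qed

text \<open>For a fixed face, the difference \<open>d = v - w\<close> has prescribed values \<open>- h i (x - y)\<close> under the
  functionals of the face. Let \<open>e\<close> be a short vector with the same values. Both \<open>v\<close> and \<open>w\<close>
  are orthogonal to the kernel of the functionals, which contains \<open>d - e\<close>; so \<open>d\<close> is the
  orthogonal projection of \<open>e\<close> and not longer. The right-hand sides \<open>b\<close> cancel in the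
  difference.\<close>

lemma face_opt_lipschitz:
  assumes "J \<subseteq> I"
  shows "\<exists>L\<ge>0. \<forall>b x y v w. face_opt J b x v \<longrightarrow> face_opt J b y w \<longrightarrow> nrm (v - w) \<le> L * norm (x - y)"
proof -
  have bd: "\<And>i v. i \<in> J \<Longrightarrow> \<bar>g i v\<bar> \<le> cg * nrm v" using g_bounded assms by auto
  obtain C where C: "C \<ge> 0" and CJ: "\<And>d \<eta>. (\<forall>i\<in>J. \<bar>g i d\<bar> \<le> \<eta>) \<Longrightarrow> 0 \<le> \<eta> \<Longrightarrow>
      (\<exists>e. (\<forall>i\<in>J. g i e = g i d) \<and> nrm e \<le> C * \<eta>)"
    using bounded_right_inverse[of J g cg, OF finite_subset[OF assms finite_I] g_linear bd cg_nonneg]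
    by blast
  have "nrm (v - w) \<le> (C * ch) * norm (x - y)" if v: "face_opt J b x v" and w: "face_opt J b y w" for b x y v w
  proof -
    let ?d = "v - w"
    have "\<forall>i\<in>J. \<bar>g i ?d\<bar> \<le> ch * norm (x - y)"
    proof
      fix i assume i: "i \<in> J"
      have "g i v + h i x = b i" "g i w + h i y = b i" using v w i by (auto simp: face_opt_def)
      then have "g i ?d = - h i (x - y)" using g_linear[of i] h_linear[of i] by (simp add: linear_diff)
      then show "\<bar>g i ?d\<bar> \<le> ch * norm (x - y)" using h_bounded[of i "x - y"] i assms by auto
    qed
    from CJ[OF this] obtain e where e: "\<forall>i\<in>J. g i e = g i ?d" "nrm e \<le> C * (ch * norm (x - y))"
      using ch_nonneg by auto
    let ?k = "?d - e"
    have k: "\<forall>i\<in>J. g i ?k = 0" using e g_linear by (auto simp: linear_diff)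
    have orth: "form u ?k = 0" if u: "face_opt J b z u" for z u
    proof -
      have "0 \<le> form u ?k" using u k by (simp add: face_opt_def)
      moreover have "\<forall>i\<in>J. g i (- ?k) \<le> 0" using k linear_neg[OF g_linear, of _ ?k] by simp
      then have "0 \<le> form u (- ?k)" using u by (simp add: face_opt_def)
      ultimately show ?thesis unfolding form_minus by linarith
    qed
    have dk: "form ?d ?k = 0" using orth[OF v] orth[OF w] by (simp add: form_diff(2))
    have "form e e = form ?d ?d + form ?k ?k"
      using form_diff_sq[of ?d ?k] dk by simp
    then have "nrm ?d \<le> nrm e" unfolding nrm_le_iff using form_nonneg[of ?k] by linarith
    with e(2) show ?thesis by (simp add: mult.assoc)
  qed
  moreover have "0 \<le> C * ch" using C ch_nonneg by simp
  ultimately show ?thesis by blast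
qed

lemma face_opt_limit:
  assumes J: "J \<subseteq> I" and f: "\<And>p. face_opt J b (X p) (V p)" and X: "X \<longlonglongrightarrow> x"
  shows "\<exists>l. face_opt J b x l"
proof -
  obtain L where L: "L \<ge> 0" and lip: "\<And>b x y v w. face_opt J b x v \<Longrightarrow> face_opt J b y w \<Longrightarrow>
      nrm (v - w) \<le> L * norm (x - y)"
    using face_opt_lipschitz[OF J] by blast
  have "\<exists>n. \<forall>p\<ge>n. \<forall>q\<ge>n. nrm (V p - V q) < e" if e: "0 < e" for e
  proof -
    have "Cauchy X" using X by (rule LIMSEQ_imp_Cauchy)
    then obtain n where n: "\<And>p q. p \<ge> n \<Longrightarrow> q \<ge> n \<Longrightarrow> norm (X p - X q) < e / (L + 1)"
      using e L unfolding Cauchy_iff by (metis add_nonneg_pos divide_pos_pos zero_less_one)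
    have "nrm (V p - V q) < e" if "p \<ge> n" "q \<ge> n" for p q
    proof -
      have "nrm (V p - V q) \<le> L * norm (X p - X q)" using lip f by blast
      also have "\<dots> \<le> L * (e / (L + 1))" using n[OF that] L by (intro mult_left_mono) auto
      also have "\<dots> < e" using e L by (simp add: field_simps)
      finally show ?thesis .
    qed
    then show ?thesis by blast
  qed
  from complete[OF this] obtain l where l: "(\<lambda>p. nrm (V p - l)) \<longlonglongrightarrow> 0" by blast
  have gl: "(\<lambda>p. g i (V p)) \<longlonglongrightarrow> g i l" if i: "i \<in> I" for i
  proof (rule LIM_zero_cancel, rule Lim_null_comparison)
    show "\<forall>\<^sub>F p in sequentially. norm (g i (V p) - g i l) \<le> cg * nrm (V p - l)"
      using g_bounded[OF i] g_linear[of i] by (auto simp: linear_diff[symmetric])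
    show "(\<lambda>p. cg * nrm (V p - l)) \<longlonglongrightarrow> 0" using tendsto_mult_left[OF l, of cg] by simp
  qed
  have hl: "(\<lambda>p. h i (X p)) \<longlonglongrightarrow> h i x" if i: "i \<in> I" for i
  proof (rule LIM_zero_cancel, rule Lim_null_comparison)
    show "\<forall>\<^sub>F p in sequentially. norm (h i (X p) - h i x) \<le> ch * norm (X p - x)"
      using h_bounded[OF i] h_linear[of i] by (auto simp: linear_diff[symmetric])
    show "(\<lambda>p. ch * norm (X p - x)) \<longlonglongrightarrow> 0"
      using tendsto_mult_left[OF tendsto_norm_zero[OF LIM_zero[OF X]], of ch] by simp
  qed
  have fl: "(\<lambda>p. form (V p) d) \<longlonglongrightarrow> form l d" for d
  proof (rule LIM_zero_cancel, rule Lim_null_comparison)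
    show "\<forall>\<^sub>F p in sequentially. norm (form (V p) d - form l d) \<le> nrm (V p - l) * nrm d"
      using form_Cauchy_Schwarz by (auto simp: form_diff[symmetric])
    show "(\<lambda>p. nrm (V p - l) * nrm d) \<longlonglongrightarrow> 0" using tendsto_mult_right[OF l, of "nrm d"] by simp
  qed
  have sum: "(\<lambda>p. g i (V p) + h i (X p)) \<longlonglongrightarrow> g i l + h i x" if "i \<in> I" for i
    using gl[OF that] hl[OF that] by (rule tendsto_add)
  have "feas b x l" unfolding feas_def
  proof
    fix i assume i: "i \<in> I"
    show "g i l + h i x \<le> b i"
      by (rule LIMSEQ_le_const2[OF sum[OF i]]) (use f i in \<open>auto simp: face_opt_def feas_def\<close>)
  qed
  moreover have "g i l + h i x = b i" if i: "i \<in> J" for i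
  proof (rule LIMSEQ_unique)
    show "(\<lambda>p. g i (V p) + h i (X p)) \<longlonglongrightarrow> g i l + h i x" using sum i J by blast
    have "(\<lambda>p. g i (V p) + h i (X p)) = (\<lambda>p. b i)" using f i by (auto simp: face_opt_def)
    then show "(\<lambda>p. g i (V p) + h i (X p)) \<longlonglongrightarrow> b i" by simp
  qed
  moreover have "0 \<le> form l d" if "\<forall>i\<in>J. g i d \<le> 0" for d
    by (rule LIMSEQ_le_const[OF fl]) (use f that in \<open>auto simp: face_opt_def\<close>)
  ultimately show ?thesis unfolding face_opt_def by blast
qed

text \<open>Along a segment of parameters, the optimal point satisfies the first-order conditions of one
  of finitely many faces at each parameter. The set of parameters belonging to a face is
  closed, and the optimal point is Lipschitz on it, so the pieces glue.\<close>

theorem opt_lipschitz: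
  "\<exists>L\<ge>0. \<forall>b x y v w. opt b x v \<longrightarrow> opt b y w \<longrightarrow>
     (\<forall>z\<in>closed_segment x y. \<exists>u. opt b z u) \<longrightarrow> nrm (v - w) \<le> L * norm (x - y)"
proof -
  have "\<forall>J\<in>Pow I. \<exists>L. 0 \<le> L \<and>
      (\<forall>b x y v w. face_opt J b x v \<longrightarrow> face_opt J b y w \<longrightarrow> nrm (v - w) \<le> L * norm (x - y))"
    using face_opt_lipschitz by simp
  from bchoice[OF this] obtain LJ where "\<forall>J\<in>Pow I. 0 \<le> LJ J \<and>
      (\<forall>b x y v w. face_opt J b x v \<longrightarrow> face_opt J b y w \<longrightarrow> nrm (v - w) \<le> LJ J * norm (x - y))" ..
  then have LJ: "\<And>J. J \<in> Pow I \<Longrightarrow> LJ J \<ge> 0"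
    and lip: "\<And>J b x y v w. J \<in> Pow I \<Longrightarrow> face_opt J b x v \<Longrightarrow> face_opt J b y w \<Longrightarrow>
        nrm (v - w) \<le> LJ J * norm (x - y)"
    by simp_all
  define L where "L = (\<Sum>J\<in>Pow I. LJ J)"
  have L0: "L \<ge> 0" unfolding L_def using LJ by (intro sum_nonneg) auto
  have LJL: "LJ J \<le> L" if "J \<in> Pow I" for J
    unfolding L_def using that LJ finite_I by (intro member_le_sum) auto
  have "nrm (v - w) \<le> L * norm (x - y)"
    if v: "opt b x v" and w: "opt b y w" and seg: "\<forall>z\<in>closed_segment x y. \<exists>u. opt b z u" for b x y v w
  proof -
    define z where "z s = x + s *\<^sub>R (y - x)" for s :: real
    have zseg: "z s \<in> closed_segment x y" if "s \<in> {0..1}" for s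
      using that unfolding z_def in_segment by (auto simp: algebra_simps intro!: exI[of _ s])
    have "\<forall>s\<in>{0..1}. \<exists>u. opt b (z s) u" using seg zseg by blast
    then have "\<exists>f. \<forall>s\<in>{0..1}. opt b (z s) (f s)" by (rule bchoice)
    then obtain f where "\<forall>s\<in>{0..1}. opt b (z s) (f s)" ..
    then have f: "\<And>s. s \<in> {0..1} \<Longrightarrow> opt b (z s) (f s)" by simp
    \<comment> \<open>the part of the segment on which the face \<open>J\<close> is optimal\<close>
    define A where "A J = {s\<in>{0..1}. face_opt J b (z s) (f s)}" for J
    have zdist: "norm (z s - z t) = \<bar>t - s\<bar> * norm (x - y)" for s t
    proof -
      have "z s - z t = (t - s) *\<^sub>R (x - y)" unfolding z_def by (simp add: algebra_simps)
      then show ?thesis by simp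
    qed
    have z_lim: "(\<lambda>p. z (S p)) \<longlonglongrightarrow> z s" if "S \<longlonglongrightarrow> s" for S s
      unfolding z_def using that by (intro tendsto_intros)
    have closedA: "closed (A J)" if J: "J \<in> Pow I" for J
      unfolding closed_sequential_limits
    proof (intro allI impI)
      fix S s assume as: "(\<forall>n. S n \<in> A J) \<and> S \<longlonglongrightarrow> s"
      then have "\<forall>n. S n \<in> {0..1}" by (simp add: A_def)
      then have s01: "s \<in> {0..1}" using as closed_sequentially[of "{0..1::real}" S s] by simp
      have "\<exists>l. face_opt J b (z s) l"
        by (rule face_opt_limit[where X = "\<lambda>p. z (S p)" and V = "\<lambda>p. f (S p)"])
          (use J as z_lim in \<open>auto simp: A_def\<close>)
      then obtain l where l: "face_opt J b (z s) l" by blast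
      have "opt b (z s) l" using face_opt_imp_opt[OF l] J by simp
      then have "nrm (l - f s) = 0" using f[OF s01] by (rule opt_unique)
      then have "face_opt J b (z s) (f s)" using face_opt_nrm_cong[OF l] J by blast
      then show "s \<in> A J" using s01 by (simp add: A_def)
    qed
    have "nrm (f 0 - f 1) \<le> (L * norm (x - y)) * (1 - 0)"
    proof (rule lipschitz_glue[where F = "A ` Pow I" and D = "\<lambda>s t. nrm (f s - f t)"])
      show "finite (A ` Pow I)" using finite_I by simp
      show "closed B" if "B \<in> A ` Pow I" for B using that closedA by blast
      show "nrm (f s - f u) \<le> nrm (f s - f t) + nrm (f t - f u)" for s t u by (rule nrm_triangle_diff)
      show "nrm (f s - f s) \<le> 0" for s by (simp add: nrm_zero_scale)
      show "nrm (f s - f t) \<le> (L * norm (x - y)) * (t - s)"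
        if "B \<in> A ` Pow I" "s \<in> B" "t \<in> B" "s \<le> t" for B s t
      proof -
        from that(1) obtain J where "J \<in> Pow I" "B = A J" by (rule imageE)
        with that have J: "J \<in> Pow I" "s \<in> A J" "t \<in> A J" by simp_all
        have "face_opt J b (z s) (f s)" "face_opt J b (z t) (f t)" using J(2,3) by (simp_all add: A_def)
        then have "nrm (f s - f t) \<le> LJ J * norm (z s - z t)" by (rule lip[OF J(1)])
        also have "\<dots> \<le> L * norm (z s - z t)" using LJL[OF J(1)] by (intro mult_right_mono) auto
        finally show ?thesis using that(4) by (simp add: zdist algebra_simps)
      qed
      show "{0..1} \<subseteq> \<Union> (A ` Pow I)"
      proof
        fix s :: real assume s: "s \<in> {0..1}"
        obtain J where "J \<in> Pow I" "face_opt J b (z s) (f s)" using opt_imp_face_opt[OF f[OF s]]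
          by (rule bexE)
        with s show "s \<in> \<Union> (A ` Pow I)" unfolding A_def by auto
      qed
    qed simp
    moreover have "nrm (v - f 0) = 0" using opt_unique[OF v] f[of 0] by (simp add: z_def)
    moreover have "nrm (f 1 - w) = 0" using opt_unique[OF _ w] f[of 1] by (simp add: z_def)
    ultimately show ?thesis
      using nrm_triangle_diff[of v w "f 0"] nrm_triangle_diff[of "f 0" w "f 1"] by simp
  qed
  then show ?thesis using L0 by (intro exI[of _ L]) simp
qed

end

section \<open>Completing the square\<close>

text \<open>Input sequences form a vector space under pointwise operations, to which the results on
  polyhedra are applied.\<close>

instantiation "fun" :: (type, real_vector) real_vector
begin

definition scaleR_fun :: "real \<Rightarrow> ('a \<Rightarrow> 'b) \<Rightarrow> 'a \<Rightarrow> 'b" where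
  "scaleR_fun c f = (\<lambda>x. c *\<^sub>R f x)"

instance
  by standard (simp_all add: scaleR_fun_def fun_eq_iff scaleR_add_right scaleR_add_left)

end

lemma dot_matrix_vector: "x \<bullet> (transpose M *v y) = (M *v x) \<bullet> (y :: real ^ 'n)"
  by (metis dot_lmul_matrix inner_commute transpose_matrix_vector)

lemma neg_matrix_vector_mult: "(- M) *v x = - (M *v (x :: real ^ 'n))"
  using matrix_vector_mult_diff_rdistrib[of 0 M x] by simp

lemma pos_def_inverse:
  fixes M :: "real ^ 'n ^ 'n"
  assumes "pos_def M"
  shows "M *v (matrix_inv M *v x) = x"
proof -
  have "\<forall>x. M *v x = 0 \<longrightarrow> x = 0"
    using assms unfolding pos_def_def by (metis inner_zero_right less_irrefl)
  then have "\<exists>M'. M' ** M = mat 1" by (simp add: matrix_left_invertible_ker)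
  then have "invertible M" by (simp add: invertible_left_inverse)
  then have "M ** matrix_inv M = mat 1"
    unfolding invertible_def matrix_inv_def by (rule someI2_ex) simp
  then show ?thesis by (simp add: matrix_vector_mul_assoc)
qed

text \<open>The form attains a positive minimum on the compact unit sphere.\<close>

lemma pos_def_lower_bound:
  fixes M :: "real ^ 'n ^ 'n"
  assumes "pos_def M"
  shows "\<exists>c>0. \<forall>x. c * (norm x)\<^sup>2 \<le> x \<bullet> (M *v x)"
proof -
  have cont: "continuous_on (sphere 0 1) (\<lambda>x. x \<bullet> (M *v x))"
    by (intro continuous_intros matrix_vector_mult_linear_continuous_on)
  obtain y where y: "y \<in> sphere (0::real^'n) 1"
      "\<And>x. x \<in> sphere 0 1 \<Longrightarrow> y \<bullet> (M *v y) \<le> x \<bullet> (M *v x)"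
    using continuous_attains_inf[OF _ _ cont] by auto
  have "(y \<bullet> (M *v y)) * (norm x)\<^sup>2 \<le> x \<bullet> (M *v x)" for x
  proof (cases "x = 0")
    case False
    let ?u = "(1 / norm x) *\<^sub>R x"
    have "y \<bullet> (M *v y) \<le> ?u \<bullet> (M *v ?u)" using y(2)[of ?u] False by simp
    also have "\<dots> = (x \<bullet> (M *v x)) / (norm x)\<^sup>2"
      by (simp add: matrix_vector_mult_scaleR power2_eq_square)
    finally show ?thesis using False by (simp add: field_simps)
  qed simp
  moreover have "y \<noteq> 0" using y(1) by auto
  then have "0 < y \<bullet> (M *v y)" using assms by (simp add: pos_def_def)
  ultimately show ?thesis by blast
qed

lemma closed_set_erosion: "closed X \<Longrightarrow> closed (X \<ominus>\<^sub>s Y)" for X :: "'a::real_normed_vector set"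
proof -
  assume X: "closed X"
  have eq: "X \<ominus>\<^sub>s Y = X \<inter> (\<Inter>y\<in>Y. (\<lambda>x. x + y) -` X)" unfolding set_erosion_def by auto
  have "closed ((\<lambda>x. x + y) -` X)" for y
    by (rule closed_vimage[OF X]) (intro continuous_intros)
  then show ?thesis unfolding eq using X by auto
qed

lemma convex_set_erosion: "convex X \<Longrightarrow> convex (X \<ominus>\<^sub>s Y)"
proof (rule convexI)
  fix x y and u v :: real
  assume X: "convex X" and x: "x \<in> X \<ominus>\<^sub>s Y" and y: "y \<in> X \<ominus>\<^sub>s Y" and uv: "0 \<le> u" "0 \<le> v" "u + v = 1"
  have "u *\<^sub>R x + v *\<^sub>R y + z \<in> X" if z: "z \<in> Y" for z
  proof -
    have "u *\<^sub>R (x + z) + v *\<^sub>R (y + z) \<in> X"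
      using x y z uv by (intro convexD[OF X]) (auto simp: set_erosion_def)
    moreover have "u *\<^sub>R (x + z) + v *\<^sub>R (y + z) = u *\<^sub>R x + v *\<^sub>R y + (u + v) *\<^sub>R z"
      by (simp only: scaleR_add_left scaleR_add_right ac_simps)
    ultimately show ?thesis using uv by simp
  qed
  moreover have "u *\<^sub>R x + v *\<^sub>R y \<in> X"
    using x y uv by (intro convexD[OF X]) (auto simp: set_erosion_def)
  ultimately show "u *\<^sub>R x + v *\<^sub>R y \<in> X \<ominus>\<^sub>s Y" by (simp add: set_erosion_def)
qed

locale mpc =
  fixes sys :: "('n::finite, 'm::finite) mpc_system"
  assumes data: "mpc_data sys"
begin

abbreviation "A \<equiv> Amat sys"
abbreviation "B \<equiv> Bmat sys"
abbreviation "K \<equiv> Kgain sys"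
abbreviation "F \<equiv> AK sys"
abbreviation "P \<equiv> Plqr sys"
abbreviation "N \<equiv> horizon sys"

text \<open>The matrix \<open>R + B\<^sup>T P B\<close> of the Riccati equation; it weighs deviations from the LQR input.\<close>

definition weight :: "real ^ 'm ^ 'm" where
  "weight = Rmat sys + transpose B ** P ** B"

lemma pos_def_P: "pos_def P" and riccati_P: "riccati sys P"
proof -
  have "\<exists>!P. pos_def P \<and> riccati sys P" using data by (simp add: mpc_data_def)
  from theI'[OF this] show "pos_def P" "riccati sys P" by (simp_all add: Plqr_def)
qed

lemma N_pos: "0 < N" using data by (simp add: mpc_data_def)

lemma P_sym: "x \<bullet> (P *v y) = y \<bullet> (P *v x)"
  using pos_def_P unfolding pos_def_def by (metis dot_matrix_vector inner_commute)

lemma P_nonneg: "0 \<le> x \<bullet> (P *v x)"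
  using pos_def_P unfolding pos_def_def by (cases "x = 0") (auto intro: less_imp_le)

lemma R_sym: "x \<bullet> (Rmat sys *v y) = y \<bullet> (Rmat sys *v x)"
  using data unfolding mpc_data_def pos_def_def by (metis dot_matrix_vector inner_commute)

lemma weight_form: "u \<bullet> (weight *v w) = u \<bullet> (Rmat sys *v w) + (B *v u) \<bullet> (P *v (B *v w))"
  unfolding weight_def matrix_vector_mult_add_rdistrib inner_add_right
    matrix_vector_mul_assoc[symmetric] dot_matrix_vector ..

lemma weight_sym: "u \<bullet> (weight *v w) = w \<bullet> (weight *v u)"
  unfolding weight_form using P_sym R_sym by metis

lemma pos_def_weight: "pos_def weight"
proof -
  have "transpose weight = weight"
    using weight_sym by (metis dot_matrix_vector inner_commute matrix_eq vector_eq_rdot)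
  moreover have "0 < u \<bullet> (weight *v u)" if "u \<noteq> 0" for u
    using data that P_nonneg[of "B *v u"] unfolding weight_form mpc_data_def pos_def_def
    by (simp add: add_pos_nonneg)
  ultimately show ?thesis by (simp add: pos_def_def)
qed

lemma weight_nonneg: "0 \<le> u \<bullet> (weight *v u)"
  using pos_def_weight unfolding pos_def_def by (cases "u = 0") (auto intro: less_imp_le)

lemma K_apply: "K *v x = - (matrix_inv weight *v (transpose B *v (P *v (A *v x))))"
  unfolding Kgain_def Let_def weight_def[symmetric] neg_matrix_vector_mult
    matrix_vector_mul_assoc[symmetric] ..

lemma weight_K: "weight *v (K *v x) = - (transpose B *v (P *v (A *v x)))"
  unfolding K_apply vec.neg pos_def_inverse[OF pos_def_weight] ..

lemma F_apply: "F *v x = A *v x + B *v (K *v x)"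
  by (simp add: AK_def matrix_vector_mult_add_rdistrib matrix_vector_mul_assoc)

lemma riccati_form: "x \<bullet> (P *v x) = (A *v x) \<bullet> (P *v (F *v x)) + x \<bullet> (Qmat sys *v x)"
proof -
  have "P *v x = (transpose A ** P ** A
          - transpose A ** P ** B ** matrix_inv weight ** transpose B ** P ** A + Qmat sys) *v x"
    using riccati_P unfolding riccati_def Let_def weight_def[symmetric] by metis
  also have "\<dots> = transpose A *v (P *v (A *v x)) +
      transpose A *v (P *v (B *v (- (matrix_inv weight *v (transpose B *v (P *v (A *v x))))))) + Qmat sys *v x"
    by (simp add: matrix_vector_mult_add_rdistrib matrix_vector_mult_diff_rdistrib
        matrix_vector_mul_assoc[symmetric] vec.neg del: transpose_matrix_vector)
  also have "- (matrix_inv weight *v (transpose B *v (P *v (A *v x)))) = K *v x"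
    by (rule K_apply[symmetric])
  finally show ?thesis
    unfolding F_apply by (simp add: inner_add_right dot_matrix_vector vec.add del: transpose_matrix_vector)
qed

text \<open>The Bellman identity of the LQR: the excess of any input over the optimal one is a square.
  Its cross term vanishes because \<open>weight K = - B\<^sup>T P A\<close>.\<close>

lemma complete_square:
  "stage_cost sys x u + (A *v x + B *v u) \<bullet> (P *v (A *v x + B *v u))
    = x \<bullet> (P *v x) + (u - K *v x) \<bullet> (weight *v (u - K *v x))"
proof -
  let ?y = "A *v x"
  have s: "u' \<bullet> (weight *v (K *v x)) = - ((B *v u') \<bullet> (P *v ?y))" for u'
    unfolding weight_K by (simp add: dot_matrix_vector del: transpose_matrix_vector)
  have "(u - K *v x) \<bullet> (weight *v (u - K *v x))
      = u \<bullet> (weight *v u) + 2 * ((B *v u) \<bullet> (P *v ?y)) - (B *v (K *v x)) \<bullet> (P *v ?y)"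
    using s[of u] s[of "K *v x"] weight_sym[of "K *v x" u]
    by (simp add: vec.diff inner_diff_left inner_diff_right)
  then show ?thesis
    using riccati_form[of x] P_sym[of ?y "B *v u"] P_sym[of ?y "B *v (K *v x)"]
    unfolding stage_cost_def F_apply weight_form
    by (simp add: vec.add inner_add_left inner_add_right)
qed

lemma lqr_cost_step: "stage_cost sys x (K *v x) = x \<bullet> (P *v x) - (F *v x) \<bullet> (P *v (F *v x))"
  using complete_square[of x "K *v x"] by (simp add: F_apply)

lemma stage_cost_nonneg: "0 \<le> stage_cost sys x u"
proof -
  have "0 \<le> x \<bullet> (Qmat sys *v x)" using data by (simp add: mpc_data_def pos_semidef_def)
  moreover have "0 \<le> u \<bullet> (Rmat sys *v u)"
    using data by (cases "u = 0") (simp_all add: mpc_data_def pos_def_def less_imp_le)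
  ultimately show ?thesis by (simp add: stage_cost_def)
qed

section \<open>Trajectories in terms of deviations from the LQR\<close>

definition cut :: "(nat \<Rightarrow> real ^ 'm) \<Rightarrow> nat \<Rightarrow> real ^ 'm" where
  "cut v k = (if k < N then v k else 0)"

text \<open>From time \<open>N\<close> on the deviation is zero, so the terminal constraint of MPC becomes the state
  and input constraints at all later times.\<close>

primrec pre_loop :: "real ^ 'n \<Rightarrow> (nat \<Rightarrow> real ^ 'm) \<Rightarrow> nat \<Rightarrow> real ^ 'n" where
  "pre_loop x v 0 = x"
| "pre_loop x v (Suc k) = F *v pre_loop x v k + B *v cut v k"

definition pre_input :: "real ^ 'n \<Rightarrow> (nat \<Rightarrow> real ^ 'm) \<Rightarrow> nat \<Rightarrow> real ^ 'm" where
  "pre_input x v k = K *v pre_loop x v k + cut v k"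

text \<open>The horizon has disappeared from the constraints: they hold at all times.\<close>

definition pre_feasible :: "(real ^ 'n) set \<Rightarrow> real ^ 'n \<Rightarrow> (nat \<Rightarrow> real ^ 'm) \<Rightarrow> bool" where
  "pre_feasible \<Delta> x v \<longleftrightarrow> (\<forall>k. pre_loop x v k \<in> Xbar sys \<Delta> \<and> pre_input x v k \<in> Ubar sys \<Delta>)"

definition excess :: "(nat \<Rightarrow> real ^ 'm) \<Rightarrow> real" where
  "excess v = (\<Sum>k<N. v k \<bullet> (weight *v v k))"

definition deviation :: "real ^ 'n \<Rightarrow> (nat \<Rightarrow> real ^ 'm) \<Rightarrow> nat \<Rightarrow> real ^ 'm" where
  "deviation x u k = u k - K *v open_loop sys x u k"

definition pre_opt :: "(real ^ 'n) set \<Rightarrow> real ^ 'n \<Rightarrow> (nat \<Rightarrow> real ^ 'm) \<Rightarrow> bool" where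
  "pre_opt \<Delta> x v \<longleftrightarrow> pre_feasible \<Delta> x v \<and> (\<forall>w. pre_feasible \<Delta> x w \<longrightarrow> excess v \<le> excess w)"

lemma excess_nonneg: "0 \<le> excess v"
  unfolding excess_def by (intro sum_nonneg weight_nonneg)

lemma pre_loop_step: "pre_loop x v (Suc k) = A *v pre_loop x v k + B *v pre_input x v k"
  by (simp add: pre_input_def F_apply vec.add)

lemma open_loop_pre_loop:
  assumes "\<And>k. k < N \<Longrightarrow> u k = pre_input x v k" and "k \<le> N"
  shows "open_loop sys x u k = pre_loop x v k"
  using assms(2)
proof (induction k)
  case (Suc k)
  then show ?case using assms(1)[of k] by (simp add: pre_loop_step del: pre_loop.simps(2))
qed simp

lemma pre_loop_deviation:
  "k \<le> N \<Longrightarrow> pre_loop x (deviation x u) k = open_loop sys x u k"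
proof (induction k)
  case (Suc k)
  then show ?case by (simp add: cut_def deviation_def F_apply vec.diff)
qed simp

lemma pre_input_deviation: "k < N \<Longrightarrow> pre_input x (deviation x u) k = u k"
  using pre_loop_deviation[of k x u] by (simp add: pre_input_def cut_def deviation_def)

lemma pre_loop_after: "pre_loop x v (N + t) = ((*v) F ^^ t) (pre_loop x v N)"
  by (induction t) (simp_all add: cut_def)

lemma pre_input_after: "pre_input x v (N + t) = K *v ((*v) F ^^ t) (pre_loop x v N)"
  by (simp add: pre_input_def pre_loop_after cut_def)

text \<open>The states whose LQR trajectory satisfies the tightened constraints form an admissible set,
  hence the largest one.\<close>

lemma Obar_iff:
  "x \<in> Obar sys \<Delta> \<longleftrightarrow> (\<forall>t. ((*v) F ^^ t) x \<in> Xbar sys \<Delta> \<and> K *v ((*v) F ^^ t) x \<in> Ubar sys \<Delta>)"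
    (is "_ \<longleftrightarrow> ?Q x")
proof
  assume "x \<in> Obar sys \<Delta>"
  then obtain Z where Z: "lqr_admissible sys \<Delta> Z" "x \<in> Z" by (auto simp: Obar_def)
  then show "?Q x" unfolding lqr_admissible_def by blast
next
  assume "?Q x"
  have "lqr_admissible sys \<Delta> {x. ?Q x}"
    unfolding lqr_admissible_def
  proof (intro conjI ballI allI subsetI)
    fix x assume "x \<in> {x. ?Q x}"
    then have "((*v) F ^^ 0) x \<in> Xbar sys \<Delta>" by blast
    then show "x \<in> Xbar sys \<Delta>" by simp
  next
    fix x t assume x: "x \<in> {x. ?Q x}"
    have "((*v) F ^^ s) (((*v) F ^^ t) x) = ((*v) F ^^ (s + t)) x" for s by (simp add: funpow_add)
    then show "((*v) F ^^ t) x \<in> {x. ?Q x}" using x by simp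
    show "K *v ((*v) F ^^ t) x \<in> Ubar sys \<Delta>" using x by simp
  qed
  with \<open>?Q x\<close> show "x \<in> Obar sys \<Delta>" unfolding Obar_def by blast
qed

lemma Obar_step: "x \<in> Obar sys \<Delta> \<Longrightarrow> F *v x \<in> Obar sys \<Delta>"
proof -
  assume x: "x \<in> Obar sys \<Delta>"
  have "((*v) F ^^ t) (F *v x) = ((*v) F ^^ Suc t) x" for t by (simp add: funpow_swap1)
  then show ?thesis using x unfolding Obar_iff by metis
qed

text \<open>After time \<open>N\<close> the deviations vanish, so feasibility from then on is membership in the
  terminal set.\<close>

lemma pre_feasible_iff:
  "pre_feasible \<Delta> x v \<longleftrightarrow>
     (\<forall>k<N. pre_loop x v k \<in> Xbar sys \<Delta> \<and> pre_input x v k \<in> Ubar sys \<Delta>) \<and> pre_loop x v N \<in> Obar sys \<Delta>"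
proof -
  have "(\<forall>k. Q k) \<longleftrightarrow> (\<forall>k<N. Q k) \<and> (\<forall>t. Q (N + t))" for Q
    by (metis le_add_diff_inverse not_less)
  from this[of "\<lambda>k. pre_loop x v k \<in> Xbar sys \<Delta> \<and> pre_input x v k \<in> Ubar sys \<Delta>"]
  show ?thesis unfolding pre_feasible_def Obar_iff pre_loop_after pre_input_after .
qed

lemma mpc_feasible_pre_input: "mpc_feasible sys \<Delta> x (pre_input x v) \<longleftrightarrow> pre_feasible \<Delta> x v"
  unfolding mpc_feasible_def pre_feasible_iff
  using open_loop_pre_loop[of "pre_input x v" x v] by (metis less_imp_le order_refl)

lemma mpc_feasible_deviation: "mpc_feasible sys \<Delta> x u \<longleftrightarrow> pre_feasible \<Delta> x (deviation x u)"
  unfolding mpc_feasible_def pre_feasible_iff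
  using pre_loop_deviation[of _ x u] pre_input_deviation[of _ x u] by (metis less_imp_le order_refl)

lemma Xbar0_iff: "x \<in> Xbar0 sys \<Delta> \<longleftrightarrow> (\<exists>v. pre_feasible \<Delta> x v)"
  unfolding Xbar0_def using mpc_feasible_pre_input mpc_feasible_deviation by blast

lemma cost_telescope:
  "(\<Sum>k<n. stage_cost sys (open_loop sys x u k) (u k)) + open_loop sys x u n \<bullet> (P *v open_loop sys x u n)
    = x \<bullet> (P *v x) + (\<Sum>k<n. deviation x u k \<bullet> (weight *v deviation x u k))"
proof (induction n)
  case (Suc n)
  show ?case
    using Suc complete_square[of "open_loop sys x u n" "u n"] by (simp add: deviation_def)
qed simp

text \<open>Since the first summand depends on the initial state only, MPC minimises \<open>excess\<close>.\<close>

lemma mpc_value_deviation: "mpc_value sys x u = x \<bullet> (P *v x) + excess (deviation x u)"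
  unfolding mpc_value_def Let_def excess_def by (rule cost_telescope)

lemma deviation_pre_input: "k < N \<Longrightarrow> deviation x (pre_input x v) k = v k"
  using open_loop_pre_loop[of "pre_input x v" x v k]
  by (simp add: deviation_def pre_input_def cut_def)

lemma mpc_value_pre_input: "mpc_value sys x (pre_input x v) = x \<bullet> (P *v x) + excess v"
  unfolding mpc_value_deviation excess_def by (simp add: deviation_pre_input)

text \<open>Dropping the first deviation and appending a zero: the candidate for the next step in the
  standard argument for recursive feasibility.\<close>

definition shift :: "(nat \<Rightarrow> real ^ 'm) \<Rightarrow> nat \<Rightarrow> real ^ 'm" where
  "shift v k = cut v (Suc k)"

lemma cut_shift: "cut (shift v) k = cut v (Suc k)"
  by (simp add: cut_def shift_def)

lemma pre_loop_shift: "pre_loop (pre_loop x v 1) (shift v) k = pre_loop x v (Suc k)"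
  by (induction k) (simp_all add: cut_shift)

lemma pre_feasible_shift: "pre_feasible \<Delta> x v \<Longrightarrow> pre_feasible \<Delta> (pre_loop x v 1) (shift v)"
  unfolding pre_feasible_def pre_input_def pre_loop_shift cut_shift by blast

lemma excess_shift: "excess (shift v) = excess v - v 0 \<bullet> (weight *v v 0)"
proof -
  let ?f = "\<lambda>k. cut v k \<bullet> (weight *v cut v k)"
  have "excess (shift v) + ?f 0 = (\<Sum>k<Suc N. ?f k)"
    unfolding sum.lessThan_Suc_shift excess_def shift_def by simp
  also have "\<dots> = excess v" by (simp add: excess_def cut_def)
  finally show ?thesis using N_pos by (simp add: cut_def)
qed

lemma pre_feasible_Obar: "x \<in> Obar sys \<Delta> \<Longrightarrow> pre_feasible \<Delta> x (\<lambda>_. 0)"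
proof -
  assume x: "x \<in> Obar sys \<Delta>"
  have "pre_loop x (\<lambda>_. 0) k = ((*v) F ^^ k) x" for k by (induction k) (simp_all add: cut_def)
  then show ?thesis using x by (simp add: pre_feasible_def pre_input_def Obar_iff cut_def)
qed

lemma Obar_subset_Xbar0: "Obar sys \<Delta> \<subseteq> Xbar0 sys \<Delta>"
  using pre_feasible_Obar Xbar0_iff by blast

text \<open>In the terminal set the zero deviation is feasible and has excess zero, so MPC coincides
  with the LQR there.\<close>

lemma pre_opt_Obar:
  assumes "x \<in> Obar sys \<Delta>" "pre_opt \<Delta> x v"
  shows "v 0 = 0"
proof -
  have "excess v \<le> 0"
    using assms pre_feasible_Obar[OF assms(1)] by (auto simp: pre_opt_def excess_def)
  then have "excess v = 0" using excess_nonneg antisym by blast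
  then have "v 0 \<bullet> (weight *v v 0) = 0"
    using N_pos unfolding excess_def by (subst (asm) sum_nonneg_eq_0_iff) (auto simp: weight_nonneg)
  then show ?thesis using pos_def_weight unfolding pos_def_def by (metis less_irrefl)
qed

section \<open>Closedness and convexity of the constraint sets\<close>

lemma closed_X: "closed (Xset sys)" and closed_U: "closed (Uset sys)"
  and convex_X: "convex (Xset sys)" and convex_U: "convex (Uset sys)"
  and zero_U: "0 \<in> Uset sys"
  using data unfolding mpc_data_def by (auto intro: polyhedron_imp_closed polyhedron_imp_convex)

lemma closed_Xbar: "closed (Xbar sys \<Delta>)" and closed_Ubar: "closed (Ubar sys \<Delta>)"
  unfolding Xbar_def Ubar_def by (simp_all add: closed_set_erosion closed_X closed_U)

lemma convex_Xbar: "convex (Xbar sys \<Delta>)" and convex_Ubar: "convex (Ubar sys \<Delta>)"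
  unfolding Xbar_def Ubar_def by (simp_all add: convex_set_erosion convex_X convex_U)

lemma Ubar_subset: "Ubar sys \<Delta> \<subseteq> Uset sys" and Xbar_subset: "Xbar sys \<Delta> \<subseteq> Xset sys"
  unfolding Ubar_def Xbar_def set_erosion_def by auto

lemma cut_linear: "cut (v + w) k = cut v k + cut w k" "cut (c *\<^sub>R v) k = c *\<^sub>R cut v k"
  by (simp_all add: cut_def scaleR_fun_def)

lemma pre_loop_linear:
  "pre_loop (x + y) (v + w) k = pre_loop x v k + pre_loop y w k"
  "pre_loop (c *\<^sub>R x) (c *\<^sub>R v) k = c *\<^sub>R pre_loop x v k"
  by (induction k)
    (simp_all add: cut_linear matrix_vector_right_distrib
        matrix_vector_mult_scaleR scaleR_add_right del: plus_fun_apply)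

lemma pre_input_linear:
  "pre_input (x + y) (v + w) k = pre_input x v k + pre_input y w k"
  "pre_input (c *\<^sub>R x) (c *\<^sub>R v) k = c *\<^sub>R pre_input x v k"
  by (simp_all add: pre_input_def pre_loop_linear cut_linear matrix_vector_right_distrib
      matrix_vector_mult_scaleR scaleR_add_right del: plus_fun_apply)

lemma convex_Xbar0: "convex (Xbar0 sys \<Delta>)"
proof (rule convexI)
  fix x y and s t :: real
  assume "x \<in> Xbar0 sys \<Delta>" "y \<in> Xbar0 sys \<Delta>" and st: "0 \<le> s" "0 \<le> t" "s + t = 1"
  then obtain v w where vw: "pre_feasible \<Delta> x v" "pre_feasible \<Delta> y w" unfolding Xbar0_iff by blast
  have "pre_feasible \<Delta> (s *\<^sub>R x + t *\<^sub>R y) (s *\<^sub>R v + t *\<^sub>R w)"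
    using vw st convexD[OF convex_Xbar] convexD[OF convex_Ubar]
    unfolding pre_feasible_def pre_loop_linear pre_input_linear by blast
  then show "s *\<^sub>R x + t *\<^sub>R y \<in> Xbar0 sys \<Delta>" unfolding Xbar0_iff by blast
qed

end

section \<open>Stability and disturbance invariant sets\<close>

lemma polyhedron_rows:
  assumes "polyhedron X"
  shows "\<exists>rs :: ('a::euclidean_space \<times> real) set. finite rs \<and> X = {x. \<forall>(a, b)\<in>rs. a \<bullet> x \<le> b} \<and>
    (\<forall>(a, b)\<in>rs. a \<noteq> 0)"
proof -
  obtain H where H: "finite H" "X = \<Inter>H" "\<forall>h\<in>H. \<exists>a b. a \<noteq> 0 \<and> h = {x. a \<bullet> x \<le> b}"
    using assms unfolding polyhedron_def by blast
  then have "\<forall>h\<in>H. \<exists>p. fst p \<noteq> 0 \<and> h = {x. fst p \<bullet> x \<le> snd p}" by fastforce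
  then obtain f where f: "\<forall>h\<in>H. fst (f h) \<noteq> 0 \<and> h = {x. fst (f h) \<bullet> x \<le> snd (f h)}"
    by (rule bchoice[THEN exE])
  have "x \<in> X \<longleftrightarrow> (\<forall>h\<in>H. fst (f h) \<bullet> x \<le> snd (f h))" for x
    unfolding H(2) using f by auto
  then have "X = {x. \<forall>(a, b)\<in>f ` H. a \<bullet> x \<le> b}" by (auto simp: case_prod_unfold)
  moreover have "\<forall>(a, b)\<in>f ` H. a \<noteq> 0" using f by (simp add: case_prod_unfold)
  ultimately show ?thesis using H(1) by (intro exI[of _ "f ` H"]) simp
qed

text \<open>Eroding a polyhedron keeps the normals of its faces and only lowers the right-hand sides.
  This is why the Lipschitz constant of the MPC law can be independent of \<open>\<Delta>\<close>.\<close>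

lemma set_erosion_rows:
  fixes Y :: "'a::euclidean_space set"
  assumes "bounded Y" "0 \<in> Y"
  shows "x \<in> {x. \<forall>(a, b)\<in>rs. a \<bullet> x \<le> b} \<ominus>\<^sub>s Y \<longleftrightarrow>
    (\<forall>(a, b)\<in>rs. a \<bullet> x \<le> b - (SUP y\<in>Y. a \<bullet> y))"
proof -
  have bdd: "bdd_above ((\<lambda>y. a \<bullet> y) ` Y)" for a
  proof -
    obtain c where c: "\<And>y. y \<in> Y \<Longrightarrow> norm y \<le> c" using assms(1) by (auto simp: bounded_iff)
    have "a \<bullet> y \<le> norm a * c" if "y \<in> Y" for y
      using norm_cauchy_schwarz[of a y] mult_left_mono[OF c[OF that] norm_ge_zero[of a]] by linarith
    then show ?thesis by (auto intro!: bdd_aboveI2)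
  qed
  have sup: "a \<bullet> x \<le> b - (SUP y\<in>Y. a \<bullet> y) \<longleftrightarrow> (\<forall>y\<in>Y. a \<bullet> (x + y) \<le> b)" for a b
  proof -
    have "(SUP y\<in>Y. a \<bullet> y) \<le> b - a \<bullet> x \<longleftrightarrow> (\<forall>y\<in>Y. a \<bullet> y \<le> b - a \<bullet> x)"
      using assms(2) by (intro cSUP_le_iff bdd) auto
    then show ?thesis by (auto simp: inner_add_right algebra_simps)
  qed
  have "x \<in> {x. \<forall>(a, b)\<in>rs. a \<bullet> x \<le> b} \<ominus>\<^sub>s Y \<longleftrightarrow>
      (\<forall>y\<in>Y. x + y \<in> {x. \<forall>(a, b)\<in>rs. a \<bullet> x \<le> b})"
    using assms(2) unfolding set_erosion_def by force
  also have "\<dots> \<longleftrightarrow> (\<forall>(a, b)\<in>rs. a \<bullet> x \<le> b - (SUP y\<in>Y. a \<bullet> y))"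
    unfolding sup by auto
  finally show ?thesis .
qed

lemma uniform_bound:
  fixes g :: "'i \<Rightarrow> 'a \<Rightarrow> real" and n :: "'a \<Rightarrow> real"
  assumes "finite I" "\<And>i. i \<in> I \<Longrightarrow> \<exists>c\<ge>0. \<forall>v. \<bar>g i v\<bar> \<le> c * n v" "\<And>v. 0 \<le> n v"
  shows "\<exists>c\<ge>0. \<forall>i\<in>I. \<forall>v. \<bar>g i v\<bar> \<le> c * n v"
  using assms(1,2)
proof (induction I rule: finite_induct)
  case (insert j I)
  obtain c where c: "c \<ge> 0" "\<forall>i\<in>I. \<forall>v. \<bar>g i v\<bar> \<le> c * n v" using insert by auto
  obtain d where d: "d \<ge> 0" "\<forall>v. \<bar>g j v\<bar> \<le> d * n v" using insert.prems[of j] by auto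
  have "c * n v \<le> (c + d) * n v" "d * n v \<le> (c + d) * n v" for v
    using c(1) d(1) assms(3)[of v] by (simp_all add: mult_right_mono)
  then have "\<forall>i\<in>insert j I. \<forall>v. \<bar>g i v\<bar> \<le> (c + d) * n v"
    using order_trans[OF c(2)[rule_format]] order_trans[OF d(2)[rule_format]] by simp
  then show ?case using c(1) d(1) by (intro exI[of _ "c + d"]) simp
qed auto

lemma norm_matrix_vector_le: "norm (M *v x) \<le> onorm ((*v) M) * norm (x :: real ^ 'n)"
  by (rule onorm) (rule matrix_vector_mul_bounded_linear)

lemma onorm_matrix_nonneg: "0 \<le> onorm ((*v) (M :: real ^ 'n ^ 'm))"
  by (rule onorm_pos_le) (rule matrix_vector_mul_bounded_linear)

text \<open>The hypotheses of the theorem on the system. They yield \<open>0 \<le> \<rho>\<close> and \<open>1 \<le> \<tau>\<close>, by looking at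
  the first and the zeroth power.\<close>

locale mpc_bounded = mpc sys for sys :: "('n::finite, 'm::finite) mpc_system" +
  fixes \<rho> \<tau> :: real
  assumes bounded_U: "bounded (Uset sys)" and B_nonzero: "B \<noteq> 0"
    and rho_less_1: "\<rho> < 1" and tau_pos: "0 < \<tau>"
    and power_bound: "onorm ((*v) F ^^ k) \<le> \<tau> * \<rho> ^ k"
begin

definition \<kappa> :: real where "\<kappa> = \<tau> / (1 - \<rho>)"

lemma kappa_pos: "0 < \<kappa>" using tau_pos rho_less_1 by (simp add: \<kappa>_def)

lemma rho_nonneg: "0 \<le> \<rho>"
proof -
  have "0 \<le> onorm ((*v) F)" by (rule onorm_matrix_nonneg)
  also have "\<dots> \<le> \<tau> * \<rho>" using power_bound[of 1] by simp
  finally show ?thesis using tau_pos by (simp add: zero_le_mult_iff)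
qed

lemma norm_F_power: "norm (((*v) F ^^ k) x) \<le> \<tau> * \<rho> ^ k * norm x"
proof -
  have "bounded_linear ((*v) F ^^ k)"
  proof (induction k)
    case 0 show ?case by (simp add: id_def bounded_linear_ident)
  next
    case (Suc k)
    show ?case using bounded_linear_compose[OF matrix_vector_mul_bounded_linear Suc] by (simp add: o_def)
  qed
  then have "norm (((*v) F ^^ k) x) \<le> onorm ((*v) F ^^ k) * norm x" by (rule onorm)
  also have "\<dots> \<le> \<tau> * \<rho> ^ k * norm x" using power_bound by (rule mult_right_mono) simp
  finally show ?thesis .
qed

lemma tau_ge_1: "1 \<le> \<tau>"
  using norm_F_power[of 0 "axis undefined 1"] by (simp add: norm_axis_1)

lemma F_power_diff: "((*v) F ^^ k) (x - y) = ((*v) F ^^ k) x - ((*v) F ^^ k) y"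
  by (induction k) (simp_all add: vec.diff)

lemma F_power_tendsto_0: "(\<lambda>k. ((*v) F ^^ k) x) \<longlonglongrightarrow> 0"
proof (rule Lim_null_comparison)
  show "\<forall>\<^sub>F k in sequentially. norm (((*v) F ^^ k) x) \<le> \<tau> * \<rho> ^ k * norm x"
    by (simp add: norm_F_power)
  have "(\<lambda>k. \<tau> * \<rho> ^ k * norm x) \<longlonglongrightarrow> \<tau> * 0 * norm x"
    using rho_nonneg rho_less_1 by (intro tendsto_intros LIMSEQ_power_zero) auto
  then show "(\<lambda>k. \<tau> * \<rho> ^ k * norm x) \<longlonglongrightarrow> 0" by simp
qed

text \<open>The hypotheses of the theorem on the pair \<open>\<epsilon>\<close>, \<open>\<Delta>\<close>. Such a set contains the ball of radius
  \<open>\<epsilon>\<close> (\<open>tube_ball\<close>).\<close>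

definition tube :: "real \<Rightarrow> (real ^ 'n) set \<Rightarrow> bool" where
  "tube \<epsilon> \<Delta> \<longleftrightarrow> 0 < \<epsilon> \<and> disturbance_invariant sys (cball 0 \<epsilon>) \<Delta> \<and> closed \<Delta> \<and> \<Delta> \<subseteq> cball 0 (\<kappa> * \<epsilon>)"

lemma tube_0: "tube \<epsilon> \<Delta> \<Longrightarrow> 0 \<in> \<Delta>"
  unfolding tube_def disturbance_invariant_def using interior_subset by auto

lemma tube_step: "tube \<epsilon> \<Delta> \<Longrightarrow> d \<in> \<Delta> \<Longrightarrow> norm w \<le> \<epsilon> \<Longrightarrow> F *v d + w \<in> \<Delta>"
  unfolding tube_def disturbance_invariant_def by auto

lemma tube_norm: "tube \<epsilon> \<Delta> \<Longrightarrow> d \<in> \<Delta> \<Longrightarrow> norm d \<le> \<kappa> * \<epsilon>"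
  unfolding tube_def by auto

lemma tube_ball: "tube \<epsilon> \<Delta> \<Longrightarrow> norm w \<le> \<epsilon> \<Longrightarrow> w \<in> \<Delta>"
  using tube_step[of \<epsilon> \<Delta> 0 w] tube_0 by simp

lemma tube_compact: "tube \<epsilon> \<Delta> \<Longrightarrow> compact \<Delta>"
  unfolding tube_def using bounded_subset compact_eq_bounded_closed bounded_cball by blast

section \<open>Existence of minimisers\<close>

lemma closed_Obar: "closed (Obar sys \<Delta>)"
proof -
  have cont: "continuous_on UNIV ((*v) F ^^ t)" for t
  proof (induction t)
    case 0 show ?case by (simp add: id_def)
  next
    case (Suc t)
    have "continuous_on UNIV (\<lambda>x. F *v ((*v) F ^^ t) x)"
      using Suc by (intro continuous_on_compose2[OF matrix_vector_mult_linear_continuous_on[of UNIV]]) auto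
    then show ?case by (simp add: o_def)
  qed
  have "Obar sys \<Delta> = (\<Inter>t. ((*v) F ^^ t) -` Xbar sys \<Delta> \<inter> (\<lambda>x. K *v ((*v) F ^^ t) x) -` Ubar sys \<Delta>)"
    using Obar_iff by auto
  moreover have "closed (((*v) F ^^ t) -` Xbar sys \<Delta>)" for t
    by (rule closed_vimage[OF closed_Xbar cont])
  moreover have "closed ((\<lambda>x. K *v ((*v) F ^^ t) x) -` Ubar sys \<Delta>)" for t
    by (rule closed_vimage[OF closed_Ubar])
      (intro continuous_on_compose2[OF matrix_vector_mult_linear_continuous_on[of UNIV] cont], auto)
  ultimately show ?thesis by (simp add: closed_INT closed_Int)
qed

text \<open>Input sequences carry the product topology, so a fixed time step involves finitely many
  continuous coordinates.\<close>

lemma continuous_open_loop: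
  "continuous_on UNIV (\<lambda>p. open_loop sys (fst p) (snd p) k)"
proof (induction k)
  case (Suc k)
  have c: "continuous_on UNIV (\<lambda>p::(real^'n) \<times> (nat \<Rightarrow> real^'m). snd p k)"
    by (rule continuous_on_product_then_coordinatewise) (intro continuous_intros)
  show ?case
    by (simp, intro continuous_on_add continuous_on_compose2[OF
        matrix_vector_mult_linear_continuous_on[of UNIV]] Suc c) auto
qed (simp add: continuous_on_fst)

lemma continuous_coordinate: "continuous_on UNIV (\<lambda>p::'z::topological_space \<times> (nat \<Rightarrow> real^'m). snd p k)"
  by (rule continuous_on_product_then_coordinatewise) (intro continuous_intros)

text \<open>Sequences of inputs, normalised to zero after the horizon. This makes the feasible set
  compact, by Tychonoff, without changing any feasibility or cost.\<close>

definition inputs :: "(nat \<Rightarrow> real ^ 'm) set" where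
  "inputs = (\<Pi>\<^sub>E k\<in>UNIV. if k < N then Uset sys else {0})"

lemma compact_inputs: "compact inputs"
proof -
  have cU: "compact (Uset sys)" using bounded_U closed_U by (simp add: compact_eq_bounded_closed)
  have "compactin (product_topology (\<lambda>_. euclidean) UNIV) inputs"
    unfolding inputs_def compactin_PiE using cU by auto
  then show ?thesis by (simp add: euclidean_product_topology compactin_euclidean_iff)
qed

lemma mpc_feasible_cong: "(\<And>k. k < N \<Longrightarrow> u k = w k) \<Longrightarrow> mpc_feasible sys \<Delta> x u \<longleftrightarrow> mpc_feasible sys \<Delta> x w"
  and mpc_value_cong: "(\<And>k. k < N \<Longrightarrow> u k = w k) \<Longrightarrow> mpc_value sys x u = mpc_value sys x w"
proof -
  assume a: "\<And>k. k < N \<Longrightarrow> u k = w k"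
  have o: "k \<le> N \<Longrightarrow> open_loop sys x u k = open_loop sys x w k" for k
    by (induction k) (use a in auto)
  show "mpc_feasible sys \<Delta> x u \<longleftrightarrow> mpc_feasible sys \<Delta> x w"
    unfolding mpc_feasible_def using o a by auto
  show "mpc_value sys x u = mpc_value sys x w"
    unfolding mpc_value_def Let_def using o a by (auto intro!: sum.cong)
qed

lemma cut_inputs: "mpc_feasible sys \<Delta> z u \<Longrightarrow> cut u \<in> inputs"
proof -
  assume "mpc_feasible sys \<Delta> z u"
  then have "u k \<in> Uset sys" if "k < N" for k
    using that Ubar_subset[of \<Delta>] by (auto simp: mpc_feasible_def)
  then show ?thesis by (auto simp: inputs_def cut_def)
qed

lemma compact_feasible:
  assumes "compact Z"
  shows "compact {p. fst p \<in> Z \<and> snd p \<in> inputs \<and> mpc_feasible sys \<Delta> (fst p) (snd p)}"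
proof -
  let ?x = "\<lambda>k p. open_loop sys (fst p) (snd p) k"
  have "closed ((\<Inter>k<N. ?x k -` Xbar sys \<Delta> \<inter> (\<lambda>p. snd p k) -` Ubar sys \<Delta>) \<inter> ?x N -` Obar sys \<Delta>)"
    by (intro closed_Int closed_INT ballI closed_vimage closed_Xbar closed_Ubar closed_Obar
        continuous_open_loop continuous_coordinate)
  then have "compact ((Z \<times> inputs) \<inter>
      ((\<Inter>k<N. ?x k -` Xbar sys \<Delta> \<inter> (\<lambda>p. snd p k) -` Ubar sys \<Delta>) \<inter> ?x N -` Obar sys \<Delta>))"
    by (intro compact_Int_closed compact_Times assms compact_inputs)
  moreover have "{p. fst p \<in> Z \<and> snd p \<in> inputs \<and> mpc_feasible sys \<Delta> (fst p) (snd p)} = (Z \<times> inputs) \<inter>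
      ((\<Inter>k<N. ?x k -` Xbar sys \<Delta> \<inter> (\<lambda>p. snd p k) -` Ubar sys \<Delta>) \<inter> ?x N -` Obar sys \<Delta>)"
    unfolding mpc_feasible_def by auto
  ultimately show ?thesis by simp
qed

text \<open>The initial state ranges over a compact set \<open>Z\<close>: a single point for nominal MPC, and \<open>x - \<Delta>\<close>
  for robust MPC.\<close>

lemma minimiser_exists:
  assumes Z: "compact Z" and z: "z \<in> Z" "mpc_feasible sys \<Delta> z u"
  obtains y w where "y \<in> Z" "mpc_feasible sys \<Delta> y w"
    "\<And>y' w'. y' \<in> Z \<Longrightarrow> mpc_feasible sys \<Delta> y' w' \<Longrightarrow> mpc_value sys y w \<le> mpc_value sys y' w'"
proof -
  let ?C = "{p. fst p \<in> Z \<and> snd p \<in> inputs \<and> mpc_feasible sys \<Delta> (fst p) (snd p)}"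
  have cutC: "(y, cut w) \<in> ?C" if "y \<in> Z" "mpc_feasible sys \<Delta> y w" for y w
    using that cut_inputs[OF that(2)] mpc_feasible_cong[of "cut w" w] by (simp add: cut_def)
  have cM: "continuous_on UNIV (\<lambda>x. M *v f x)" if "continuous_on UNIV f"
    for M :: "real^'a^'b" and f :: "_ \<Rightarrow> real^'a"
    by (rule continuous_on_compose2[OF matrix_vector_mult_linear_continuous_on[of UNIV] that]) auto
  have cont: "continuous_on ?C (\<lambda>p. mpc_value sys (fst p) (snd p))"
    unfolding mpc_value_def Let_def stage_cost_def
    by (rule continuous_on_subset[OF _ subset_UNIV])
      (intro continuous_on_add continuous_on_sum continuous_on_inner
          cM continuous_open_loop continuous_coordinate subset_UNIV)
  have ne: "?C \<noteq> {}" using cutC[OF z] by blast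
  from continuous_attains_inf[OF compact_feasible[OF Z] ne cont]
  obtain p where p: "p \<in> ?C" "\<forall>q\<in>?C. mpc_value sys (fst p) (snd p) \<le> mpc_value sys (fst q) (snd q)"
    by blast
  show thesis
  proof
    show "fst p \<in> Z" "mpc_feasible sys \<Delta> (fst p) (snd p)" using p(1) by auto
    fix y' w' assume "y' \<in> Z" "mpc_feasible sys \<Delta> y' w'"
    from p(2)[rule_format, OF cutC[OF this]] mpc_value_cong[of "cut w'" w' y']
    show "mpc_value sys (fst p) (snd p) \<le> mpc_value sys y' w'" by (simp add: cut_def)
  qed
qed

text \<open>Locally, the feasible states are the projection of a compact set of pairs of states and
  inputs.\<close>

lemma closed_Xbar0: "closed (Xbar0 sys \<Delta>)"
  unfolding closed_sequential_limits
proof (intro allI impI)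
  fix X x assume a: "(\<forall>n. X n \<in> Xbar0 sys \<Delta>) \<and> X \<longlonglongrightarrow> x"
  let ?C = "{p. fst p \<in> cball x 1 \<and> snd p \<in> inputs \<and> mpc_feasible sys \<Delta> (fst p) (snd p)}"
  have "compact (fst ` ?C)"
    by (intro compact_continuous_image compact_feasible continuous_intros compact_cball)
  then have cl: "closed (fst ` ?C)" by (rule compact_imp_closed)
  have "\<forall>\<^sub>F n in sequentially. X n \<in> cball x 1"
  proof -
    have "\<forall>\<^sub>F n in sequentially. dist (X n) x < 1" using a unfolding tendsto_iff by simp
    then show ?thesis by (rule eventually_mono) (simp add: dist_commute)
  qed
  then have "\<forall>\<^sub>F n in sequentially. X n \<in> fst ` ?C"
  proof (rule eventually_mono)
    fix n assume n: "X n \<in> cball x 1"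
    obtain u where u: "mpc_feasible sys \<Delta> (X n) u" using a unfolding Xbar0_def by blast
    have "(X n, cut u) \<in> ?C"
      using n u cut_inputs[OF u] mpc_feasible_cong[of "cut u" u] by (simp add: cut_def)
    then show "X n \<in> fst ` ?C" by (rule image_eqI[rotated]) simp
  qed
  with cl have "x \<in> fst ` ?C" using a by (intro Lim_in_closed_set[of _ X sequentially]) auto
  then show "x \<in> Xbar0 sys \<Delta>" unfolding Xbar0_def by auto
qed

section \<open>The nominal and the robust controller\<close>

lemma pre_optI:
  assumes "mpc_feasible sys \<Delta> x u"
    and "\<And>w. mpc_feasible sys \<Delta> x w \<Longrightarrow> mpc_value sys x u \<le> mpc_value sys x w"
  shows "pre_opt \<Delta> x (deviation x u)"
  unfolding pre_opt_def
proof (intro conjI allI impI)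
  show "pre_feasible \<Delta> x (deviation x u)" using assms(1) by (simp add: mpc_feasible_deviation)
  fix w assume "pre_feasible \<Delta> x w"
  then have "mpc_value sys x u \<le> mpc_value sys x (pre_input x w)"
    by (intro assms(2)) (simp add: mpc_feasible_pre_input)
  then show "excess (deviation x u) \<le> excess w"
    by (simp add: mpc_value_pre_input) (simp add: mpc_value_deviation)
qed

lemma mpc_control_spec:
  assumes "x \<in> Xbar0 sys \<Delta>"
  shows "\<exists>v. pre_opt \<Delta> x v \<and> mpc_control sys \<Delta> x = K *v x + v 0"
proof -
  obtain u0 where u0: "mpc_feasible sys \<Delta> x u0" using assms unfolding Xbar0_def by blast
  obtain y w where y: "y \<in> {x}" "mpc_feasible sys \<Delta> y w"
    and min: "\<And>y' w'. y' \<in> {x} \<Longrightarrow> mpc_feasible sys \<Delta> y' w' \<Longrightarrow> mpc_value sys y w \<le> mpc_value sys y' w'"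
    by (rule minimiser_exists[of "{x}" x \<Delta> u0]) (use u0 in simp_all)
  have "is_arg_min (mpc_value sys x) (mpc_feasible sys \<Delta> x) w"
    using y min[of x] by (simp add: is_arg_min_def not_less)
  then have am: "is_arg_min (mpc_value sys x) (mpc_feasible sys \<Delta> x)
      (arg_min (mpc_value sys x) (mpc_feasible sys \<Delta> x))"
    unfolding arg_min_def by (rule someI[of "is_arg_min _ _"])
  let ?u = "arg_min (mpc_value sys x) (mpc_feasible sys \<Delta> x)"
  have "pre_opt \<Delta> x (deviation x ?u)"
    by (rule pre_optI) (use am in \<open>auto simp: is_arg_min_def not_less\<close>)
  moreover have "mpc_control sys \<Delta> x = K *v x + deviation x ?u 0"
    by (simp add: mpc_control_def deviation_def)
  ultimately show ?thesis by blast
qed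

text \<open>The minimiser of the joint problem is in particular an optimal input sequence for its own
  nominal state. The tube correction \<open>K (x - xbar0)\<close> makes the expert input \<open>K x + v 0\<close>, of
  the same form as the nominal one.\<close>

lemma expert_spec:
  assumes tube: "tube \<epsilon> \<Delta>" and x: "x \<in> rmpc_domain sys \<Delta>"
  shows "\<exists>v. pre_opt \<Delta> (xbar0 sys \<Delta> x) v \<and> x - xbar0 sys \<Delta> x \<in> \<Delta> \<and>
     expert sys \<Delta> x = K *v x + v 0 \<and>
     (\<forall>z w. x - z \<in> \<Delta> \<longrightarrow> pre_feasible \<Delta> z w \<longrightarrow>
        xbar0 sys \<Delta> x \<bullet> (P *v xbar0 sys \<Delta> x) + excess v \<le> z \<bullet> (P *v z) + excess w)"
proof -
  obtain z0 d0 where z0: "z0 \<in> Xbar0 sys \<Delta>" "d0 \<in> \<Delta>" "x = z0 + d0"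
    using x unfolding rmpc_domain_def by auto
  obtain u0 where u0: "mpc_feasible sys \<Delta> z0 u0" using z0 unfolding Xbar0_def by blast
  let ?Z = "{z. x - z \<in> \<Delta>}"
  have Zeq: "?Z = (\<lambda>d. x - d) ` \<Delta>" by (force simp: image_iff)
  have Z: "compact ?Z"
    unfolding Zeq by (intro compact_continuous_image tube_compact[OF tube] continuous_intros)
  have mem: "x \<in> {z + d | d. d \<in> \<Delta>} \<longleftrightarrow> x - z \<in> \<Delta>" for z
  proof -
    have "x = z + d \<longleftrightarrow> d = x - z" for d by auto
    then show ?thesis by simp
  qed
  let ?Q = "\<lambda>(z, u). mpc_feasible sys \<Delta> z u \<and> x \<in> {z + d | d. d \<in> \<Delta>}"
  let ?f = "\<lambda>(z, u). mpc_value sys z u"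
  have "z0 \<in> ?Z" using z0 by simp
  then obtain y w where y: "y \<in> ?Z" "mpc_feasible sys \<Delta> y w"
    and min: "\<And>y' w'. y' \<in> ?Z \<Longrightarrow> mpc_feasible sys \<Delta> y' w' \<Longrightarrow> mpc_value sys y w \<le> mpc_value sys y' w'"
    by (rule minimiser_exists[OF Z _ u0]) simp
  then have "is_arg_min ?f ?Q (y, w)"
    unfolding is_arg_min_def mem by (auto simp: not_less)
  then have am: "is_arg_min ?f ?Q (rmpc_solution sys \<Delta> x)"
    unfolding rmpc_solution_def arg_min_def by (rule someI[of "is_arg_min _ _"])
  obtain z u where zu: "rmpc_solution sys \<Delta> x = (z, u)" by (cases "rmpc_solution sys \<Delta> x")
  have f: "mpc_feasible sys \<Delta> z u" "x - z \<in> \<Delta>"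
    and opt: "\<And>z' u'. mpc_feasible sys \<Delta> z' u' \<Longrightarrow> x - z' \<in> \<Delta> \<Longrightarrow> mpc_value sys z u \<le> mpc_value sys z' u'"
    using am unfolding zu is_arg_min_def mem by (auto simp: not_less)
  have xb: "xbar0 sys \<Delta> x = z" by (simp add: xbar0_def zu)
  have "closest_point (rmpc_domain sys \<Delta>) x = x" using x by (rule closest_point_self)
  then have "expert sys \<Delta> x = u 0 + K *v (x - z)"
    by (simp add: expert_def rmpc_control_def ubar0_def zu xb)
  then have "expert sys \<Delta> x = K *v x + deviation z u 0"
    by (simp add: deviation_def vec.diff)
  moreover have "pre_opt \<Delta> z (deviation z u)" using f opt by (intro pre_optI) auto
  moreover have "z \<bullet> (P *v z) + excess (deviation z u) \<le> z' \<bullet> (P *v z') + excess w"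
    if "x - z' \<in> \<Delta>" "pre_feasible \<Delta> z' w" for z' w
    using opt[of z' "pre_input z' w"] that
    by (simp add: mpc_feasible_pre_input mpc_value_pre_input) (simp add: mpc_value_deviation)
  ultimately show ?thesis using f unfolding xb by blast
qed

lemma pre_loop_1: "pre_loop x v 1 = F *v x + B *v v 0"
  using N_pos by (simp add: cut_def)

lemma closed_loop_input: "A *v x + B *v u = F *v x + B *v (u - K *v x)"
  by (simp add: F_apply vec.diff)

lemma pre_feasible_Xbar0_step: "pre_feasible \<Delta> x v \<Longrightarrow> pre_loop x v 1 \<in> Xbar0 sys \<Delta>"
  using pre_feasible_shift Xbar0_iff by blast

lemma Xbar0_subset_Xbar: "Xbar0 sys \<Delta> \<subseteq> Xbar sys \<Delta>"
proof
  fix x assume "x \<in> Xbar0 sys \<Delta>"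
  then obtain v where "pre_feasible \<Delta> x v" by (auto simp: Xbar0_iff)
  then have "pre_loop x v 0 \<in> Xbar sys \<Delta>" unfolding pre_feasible_def by blast
  then show "x \<in> Xbar sys \<Delta>" by simp
qed

lemma rmpc_domainI: "z \<in> Xbar0 sys \<Delta> \<Longrightarrow> d \<in> \<Delta> \<Longrightarrow> z + d \<in> rmpc_domain sys \<Delta>"
  using Xbar0_subset_Xbar unfolding rmpc_domain_def Xbar_def set_erosion_def by auto

text \<open>The error between the state and the nominal prediction evolves by \<open>F\<close> plus the disturbance
  and so stays in \<open>\<Delta>\<close>; thus the predicted nominal state with shifted deviations is feasible
  at the next step.\<close>

lemma robust_step:
  assumes tube: "tube \<epsilon> \<Delta>" and v: "pre_opt \<Delta> z v" "x - z \<in> \<Delta>" "expert sys \<Delta> x = K *v x + v 0"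
    and w: "norm w \<le> \<epsilon>"
  shows "A *v x + B *v expert sys \<Delta> x + w - pre_loop z v 1 \<in> \<Delta>"
    and "A *v x + B *v expert sys \<Delta> x + w \<in> rmpc_domain sys \<Delta>"
proof -
  have "A *v x + B *v expert sys \<Delta> x + w - pre_loop z v 1 = F *v (x - z) + w"
    unfolding closed_loop_input v(3) pre_loop_1 by (simp add: vec.diff)
  then show 1: "A *v x + B *v expert sys \<Delta> x + w - pre_loop z v 1 \<in> \<Delta>"
    using tube_step[OF tube v(2) w] by (simp only:)
  have "pre_loop z v 1 \<in> Xbar0 sys \<Delta>" using v(1) pre_feasible_Xbar0_step by (simp add: pre_opt_def)
  from rmpc_domainI[OF this 1] show "A *v x + B *v expert sys \<Delta> x + w \<in> rmpc_domain sys \<Delta>"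
    by (simp add: algebra_simps)
qed

section \<open>Finitely many constraints suffice\<close>

text \<open>LQR trajectories starting in the terminal set converge to the origin inside closed sets.\<close>

lemma zero_admissible:
  assumes "Xbar0 sys \<Delta> \<noteq> {}"
  shows "0 \<in> Xbar sys \<Delta>" "0 \<in> Ubar sys \<Delta>"
proof -
  obtain x where x: "x \<in> Obar sys \<Delta>" using assms unfolding Xbar0_def mpc_feasible_def by blast
  have X: "\<forall>t. ((*v) F ^^ t) x \<in> Xbar sys \<Delta>" and U: "\<forall>t. K *v ((*v) F ^^ t) x \<in> Ubar sys \<Delta>"
    using x unfolding Obar_iff by blast+
  show "0 \<in> Xbar sys \<Delta>"
    by (rule closed_sequentially[OF closed_Xbar _ F_power_tendsto_0]) (use X in blast)
  have "(\<lambda>t. K *v ((*v) F ^^ t) x) \<longlonglongrightarrow> K *v 0"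
    by (rule bounded_linear.tendsto[OF matrix_vector_mul_bounded_linear F_power_tendsto_0])
  then have "(\<lambda>t. K *v ((*v) F ^^ t) x) \<longlonglongrightarrow> 0" by simp
  then show "0 \<in> Ubar sys \<Delta>" by (rule closed_sequentially[OF closed_Ubar, rotated]) (use U in blast)
qed

text \<open>A linear constraint that is relevant for the LQR has positive slack at the origin: it holds
  on \<open>\<Delta>\<close>, which contains a ball. These slacks are finitely many positive numbers of the
  system, so \<open>\<beta>\<close> bounds them from below independently of \<open>\<Delta>\<close>. One half of \<open>\<beta>\<close> absorbs the
  tightening by a set of radius \<open>\<kappa> \<epsilon>\<close>, the other half the LQR trajectory starting in a small
  ball.\<close>

lemma cball_subset_Obar:
  "\<exists>r>0. \<exists>\<epsilon>0>0. \<forall>\<epsilon> \<Delta>. tube \<epsilon> \<Delta> \<longrightarrow> \<epsilon> \<le> \<epsilon>0 \<longrightarrow> Xbar0 sys \<Delta> \<noteq> {} \<longrightarrow> cball 0 r \<subseteq> Obar sys \<Delta>"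
proof -
  have pX: "polyhedron (Xset sys)" and pU: "polyhedron (Uset sys)" using data by (simp_all add: mpc_data_def)
  obtain rX where rX: "finite rX" "Xset sys = {x. \<forall>(a, b)\<in>rX. a \<bullet> x \<le> b}" "\<forall>(a, b)\<in>rX. a \<noteq> 0"
    using polyhedron_rows[OF pX] by (elim exE conjE)
  obtain rU where rU: "finite rU" "Uset sys = {x. \<forall>(a, b)\<in>rU. a \<bullet> x \<le> b}"
    using polyhedron_rows[OF pU] by (elim exE conjE)
  \<comment> \<open>state and input constraints as rows on the state; an input row \<open>(c, d)\<close> acts through \<open>c \<bullet> K x\<close>\<close>
  define T where "T = {(a, b) \<in> rX \<union> (\<lambda>(c, d). (transpose K *v c, d)) ` rU. a \<noteq> 0}"
  have finT: "finite T" unfolding T_def using rX(1) rU(1) by (auto intro: finite_subset)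
  define \<beta> where "\<beta> = Min (insert 1 {b \<in> snd ` T. 0 < b})"
  have fin\<beta>: "finite (insert (1::real) {b \<in> snd ` T. 0 < b})" using finT by simp
  have \<beta>_pos: "0 < \<beta>" unfolding \<beta>_def using fin\<beta> by (subst Min_gr_iff) auto
  have \<beta>_le: "\<beta> \<le> b" if "(a, b) \<in> T" "0 < b" for a b
    unfolding \<beta>_def using that by (intro Min_le[OF fin\<beta>]) force
  define m where "m = 1 + (\<Sum>p\<in>T. norm (fst p))"
  have m_pos: "0 < m" unfolding m_def by (intro add_pos_nonneg sum_nonneg) auto
  have m_ge: "norm a \<le> m" if "(a, b) \<in> T" for a b
  proof -
    have "norm (fst (a, b)) \<le> (\<Sum>p\<in>T. norm (fst p))"
      by (rule member_le_sum) (use that finT in auto)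
    then show ?thesis by (simp add: m_def)
  qed
  define r where "r = \<beta> / (2 * m * \<tau>)"
  define \<epsilon>0 where "\<epsilon>0 = \<beta> / (2 * m * \<kappa>)"
  have r_pos: "0 < r" and \<epsilon>0_pos: "0 < \<epsilon>0"
    using \<beta>_pos m_pos tau_pos kappa_pos by (simp_all add: r_def \<epsilon>0_def)
  have "x \<in> Obar sys \<Delta>"
    if tube: "tube \<epsilon> \<Delta>" and \<epsilon>: "\<epsilon> \<le> \<epsilon>0" and ne: "Xbar0 sys \<Delta> \<noteq> {}" and x: "norm x \<le> r" for x \<epsilon> \<Delta>
  proof -
    have X0: "y \<in> Xset sys" if "y \<in> \<Delta>" for y
      using zero_admissible(1)[OF ne] that by (auto simp: Xbar_def set_erosion_def)
    have U0: "K *v y \<in> Uset sys" if "y \<in> \<Delta>" for y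
      using zero_admissible(2)[OF ne] that by (auto simp: Ubar_def set_erosion_def)
    have T0: "a \<bullet> y \<le> b" if "(a, b) \<in> T" "y \<in> \<Delta>" for a b y
      using that X0[OF that(2)] U0[OF that(2)] unfolding T_def rX(2) rU(2)
      by (auto simp: dot_lmul_matrix)
    have T_pos: "0 < b" if ab: "(a, b) \<in> T" for a b
    proof -
      have a: "a \<noteq> 0" using ab by (simp add: T_def)
      have "(\<epsilon> / norm a) *\<^sub>R a \<in> \<Delta>" by (rule tube_ball[OF tube]) (use a tube in \<open>simp add: tube_def\<close>)
      from T0[OF ab this] have "\<epsilon> * norm a \<le> b" using a by (simp add: dot_square_norm power2_eq_square)
      moreover have "0 < \<epsilon> * norm a" using a tube by (simp add: tube_def)
      ultimately show ?thesis by linarith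
    qed
    have T_ok: "a \<bullet> (((*v) F ^^ t) x + y) \<le> b" if ab: "(a, b) \<in> T" and y: "y \<in> \<Delta>" for a b t y
    proof -
      have "\<tau> * \<rho> ^ t * norm x \<le> \<tau> * 1 * r"
        using rho_nonneg rho_less_1 tau_pos x by (intro mult_mono) (auto intro: power_le_one)
      then have "norm (((*v) F ^^ t) x) \<le> \<tau> * r" using norm_F_power[of t x] by linarith
      moreover have "norm y \<le> \<kappa> * \<epsilon>0"
        using tube_norm[OF tube y] mult_left_mono[OF \<epsilon>, of \<kappa>] kappa_pos by linarith
      ultimately have "norm (((*v) F ^^ t) x + y) \<le> \<tau> * r + \<kappa> * \<epsilon>0"
        using norm_triangle_ineq[of "((*v) F ^^ t) x" y] by linarith
      also have "\<dots> = \<beta> / m"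
        using m_pos tau_pos kappa_pos unfolding r_def \<epsilon>0_def by (simp add: field_simps)
      finally have "norm (((*v) F ^^ t) x + y) \<le> \<beta> / m" .
      then have "norm a * norm (((*v) F ^^ t) x + y) \<le> m * (\<beta> / m)"
        using m_ge[OF ab] m_pos by (intro mult_mono) auto
      then have "a \<bullet> (((*v) F ^^ t) x + y) \<le> \<beta>"
        using norm_cauchy_schwarz[of a "((*v) F ^^ t) x + y"] m_pos by simp
      then show ?thesis using \<beta>_le[OF ab T_pos[OF ab]] by linarith
    qed
    have inX: "((*v) F ^^ t) x + y \<in> Xset sys" if "y \<in> \<Delta>" for t y
      unfolding rX(2) using T_ok[OF _ that] rX(3) by (auto simp: T_def)
    have inU: "K *v (((*v) F ^^ t) x + y) \<in> Uset sys" if "y \<in> \<Delta>" for t y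
      unfolding rU(2)
    proof (clarify)
      fix c d assume cd: "(c, d) \<in> rU"
      have eq: "c \<bullet> (K *v z) = (transpose K *v c) \<bullet> z" for z
        by (simp add: dot_lmul_matrix)
      show "c \<bullet> (K *v (((*v) F ^^ t) x + y)) \<le> d"
      \<comment> \<open>an input row that \<open>K\<close> annihilates reads \<open>0 \<le> d\<close>, which holds as \<open>0\<close> is an admissible input\<close>
      proof (cases "transpose K *v c = 0")
        case True
        then have "c \<bullet> (K *v (((*v) F ^^ t) x + y)) = 0" unfolding eq by simp
        moreover have "0 \<le> d" using zero_U cd unfolding rU(2) by auto
        ultimately show ?thesis by simp
      next
        case False
        then have "(transpose K *v c, d) \<in> T" unfolding T_def using cd by force
        from T_ok[OF this that] show ?thesis unfolding eq .
      qed
    qed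
    show ?thesis
      unfolding Obar_iff Xbar_def Ubar_def set_erosion_def
      using inX inX[OF tube_0[OF tube]] inU inU[OF tube_0[OF tube]] by (auto simp: vec.add)
  qed
  then have "cball 0 r \<subseteq> Obar sys \<Delta>" if "tube \<epsilon> \<Delta>" "\<epsilon> \<le> \<epsilon>0" "Xbar0 sys \<Delta> \<noteq> {}" for \<epsilon> \<Delta>
    using that by (simp add: subset_iff)
  with r_pos \<epsilon>0_pos show ?thesis by blast
qed

lemma rho_power_small: "0 < e \<Longrightarrow> \<exists>t. \<tau> * \<rho> ^ t * c \<le> e"
proof -
  assume e: "0 < e"
  have "(\<lambda>t. \<tau> * \<rho> ^ t * c) \<longlonglongrightarrow> \<tau> * 0 * c"
    using rho_nonneg rho_less_1 by (intro tendsto_intros LIMSEQ_power_zero) auto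
  then have "\<forall>\<^sub>F t in sequentially. \<tau> * \<rho> ^ t * c < e" by (rule order_tendstoD(2)) (use e in simp)
  then obtain t where "\<tau> * \<rho> ^ t * c < e" unfolding eventually_sequentially by blast
  then show ?thesis by (intro exI[of _ t]) simp
qed

lemma U_norm_bound: obtains b where "0 \<le> b" "\<And>u. u \<in> Uset sys \<Longrightarrow> norm u \<le> b"
proof -
  obtain b where "0 < b" "\<forall>u\<in>Uset sys. norm u \<le> b" using bounded_U unfolding bounded_pos by blast
  then show thesis by (intro that[of b]) auto
qed

lemma pre_loop_bound:
  "\<exists>c. \<forall>x v. norm x \<le> R \<longrightarrow> (\<forall>j<k. pre_input x v j \<in> Uset sys) \<longrightarrow> norm (pre_loop x v k) \<le> c"
proof (induction k)
  case 0 then show ?case by auto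
next
  case (Suc k)
  obtain c where c: "\<And>x v. norm x \<le> R \<Longrightarrow> (\<forall>j<k. pre_input x v j \<in> Uset sys) \<Longrightarrow> norm (pre_loop x v k) \<le> c"
    using Suc by blast
  obtain b where b: "0 \<le> b" "\<And>u. u \<in> Uset sys \<Longrightarrow> norm u \<le> b" using U_norm_bound by blast
  have "norm (pre_loop x v (Suc k)) \<le> onorm ((*v) A) * c + onorm ((*v) B) * b"
    if "norm x \<le> R" "\<forall>j<Suc k. pre_input x v j \<in> Uset sys" for x v
  proof -
    have "norm (A *v pre_loop x v k) \<le> onorm ((*v) A) * c"
      using c[OF that(1)] that(2) onorm_matrix_nonneg[of A]
      by (intro order_trans[OF norm_matrix_vector_le] mult_left_mono) auto
    moreover have "norm (B *v pre_input x v k) \<le> onorm ((*v) B) * b"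
      using b(2) that(2) onorm_matrix_nonneg[of B]
      by (intro order_trans[OF norm_matrix_vector_le] mult_left_mono) auto
    ultimately show ?thesis
      unfolding pre_loop_step using norm_triangle_ineq[of "A *v pre_loop x v k" "B *v pre_input x v k"] by linarith
  qed
  then show ?case by blast
qed

lemma pre_loop_in_Obar:
  assumes "pre_loop x v (N + t) \<in> Obar sys \<Delta>"
  shows "pre_loop x v (N + t + s) \<in> Xbar sys \<Delta> \<and> pre_input x v (N + t + s) \<in> Ubar sys \<Delta>"
proof -
  have "pre_loop x v (N + t + s) = ((*v) F ^^ s) (pre_loop x v (N + t))"
    unfolding add.assoc pre_loop_after by (simp add: funpow_add add.commute[of t])
  moreover have "pre_input x v (N + t + s) = K *v pre_loop x v (N + t + s)"
    by (simp add: pre_input_def cut_def)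
  ultimately show ?thesis using assms by (simp add: Obar_iff)
qed

text \<open>Feasible inputs are bounded, hence so is the state at time \<open>N\<close>. After a number of further
  steps depending on \<open>R\<close> only, the LQR has brought it into the ball of \<open>cball_subset_Obar\<close>,
  where all later constraints hold automatically.\<close>

lemma truncation:
  "\<exists>\<epsilon>0>0. \<forall>R. \<exists>H. \<forall>\<epsilon> \<Delta> x v. tube \<epsilon> \<Delta> \<longrightarrow> \<epsilon> \<le> \<epsilon>0 \<longrightarrow> Xbar0 sys \<Delta> \<noteq> {} \<longrightarrow> norm x \<le> R \<longrightarrow>
     (pre_feasible \<Delta> x v \<longleftrightarrow> (\<forall>k<H. pre_loop x v k \<in> Xbar sys \<Delta> \<and> pre_input x v k \<in> Ubar sys \<Delta>))"
proof -
  obtain r \<epsilon>0 where r: "0 < r" and \<epsilon>0: "0 < \<epsilon>0"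
    and ball: "\<And>\<epsilon> \<Delta>. tube \<epsilon> \<Delta> \<Longrightarrow> \<epsilon> \<le> \<epsilon>0 \<Longrightarrow> Xbar0 sys \<Delta> \<noteq> {} \<Longrightarrow> cball 0 r \<subseteq> Obar sys \<Delta>"
    using cball_subset_Obar by blast
  have "\<exists>H. \<forall>\<epsilon> \<Delta> x v. tube \<epsilon> \<Delta> \<longrightarrow> \<epsilon> \<le> \<epsilon>0 \<longrightarrow> Xbar0 sys \<Delta> \<noteq> {} \<longrightarrow> norm x \<le> R \<longrightarrow>
     (pre_feasible \<Delta> x v \<longleftrightarrow> (\<forall>k<H. pre_loop x v k \<in> Xbar sys \<Delta> \<and> pre_input x v k \<in> Ubar sys \<Delta>))" for R
  proof -
    obtain c where c: "\<And>x v. norm x \<le> R \<Longrightarrow> (\<forall>j<N. pre_input x v j \<in> Uset sys) \<Longrightarrow> norm (pre_loop x v N) \<le> c"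
      using pre_loop_bound[of R N] by blast
    obtain t where t: "\<tau> * \<rho> ^ t * c \<le> r" using rho_power_small[OF r] by blast
    have suff: "pre_feasible \<Delta> x v"
      if tube: "tube \<epsilon> \<Delta>" "\<epsilon> \<le> \<epsilon>0" "Xbar0 sys \<Delta> \<noteq> {}" and x: "norm x \<le> R"
        and feas: "\<forall>k<N + t. pre_loop x v k \<in> Xbar sys \<Delta> \<and> pre_input x v k \<in> Ubar sys \<Delta>" for \<epsilon> \<Delta> x v
    proof -
      have "\<forall>j<N. pre_input x v j \<in> Uset sys" using feas Ubar_subset[of \<Delta>] by auto
      then have cN: "norm (pre_loop x v N) \<le> c" using c[OF x] by blast
      have "norm (pre_loop x v (N + t)) \<le> \<tau> * \<rho> ^ t * norm (pre_loop x v N)"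
        unfolding pre_loop_after by (rule norm_F_power)
      also have "\<dots> \<le> \<tau> * \<rho> ^ t * c"
        using cN tau_pos rho_nonneg by (intro mult_left_mono) auto
      finally have "pre_loop x v (N + t) \<in> cball 0 r" using t by simp
      then have O: "pre_loop x v (N + t) \<in> Obar sys \<Delta>" using ball[OF tube] by blast
      show ?thesis
        unfolding pre_feasible_def
      proof
        fix k
        show "pre_loop x v k \<in> Xbar sys \<Delta> \<and> pre_input x v k \<in> Ubar sys \<Delta>"
        proof (cases "k < N + t")
          case True then show ?thesis using feas by blast
        next
          case False
          then have "k = N + t + (k - (N + t))" by simp
          with pre_loop_in_Obar[OF O, of "k - (N + t)"] show ?thesis by simp
        qed
      qed
    qed
    show ?thesis
    proof (intro exI[of _ "N + t"] allI impI)
      fix \<epsilon> \<Delta> v and x :: "real ^ 'n"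
      assume a: "tube \<epsilon> \<Delta>" "\<epsilon> \<le> \<epsilon>0" "Xbar0 sys \<Delta> \<noteq> {}" "norm x \<le> R"
      show "pre_feasible \<Delta> x v \<longleftrightarrow> (\<forall>k<N + t. pre_loop x v k \<in> Xbar sys \<Delta> \<and> pre_input x v k \<in> Ubar sys \<Delta>)"
      proof
        assume "pre_feasible \<Delta> x v"
        then show "\<forall>k<N + t. pre_loop x v k \<in> Xbar sys \<Delta> \<and> pre_input x v k \<in> Ubar sys \<Delta>"
          unfolding pre_feasible_def by simp
      qed (rule suff[OF a])
    qed
  qed
  with \<epsilon>0 show ?thesis by (intro exI[of _ \<epsilon>0] conjI allI)
qed

section \<open>Lipschitz continuity of the MPC law\<close>

definition wform :: "(nat \<Rightarrow> real ^ 'm) \<Rightarrow> (nat \<Rightarrow> real ^ 'm) \<Rightarrow> real" where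
  "wform v w = (\<Sum>k<N. v k \<bullet> (weight *v w k))"

lemma semi_inner_wform: "semi_inner wform"
  unfolding semi_inner_def
proof (intro conjI allI)
  fix u v :: "nat \<Rightarrow> real ^ 'm"
  show "linear (wform u)"
    by (rule linearI)
      (simp_all add: wform_def scaleR_fun_def matrix_vector_right_distrib
          matrix_vector_mult_scaleR inner_add_right sum.distrib sum_distrib_left)
  show "wform u v = wform v u" unfolding wform_def using weight_sym by (intro sum.cong) auto
  show "0 \<le> wform v v" unfolding wform_def by (intro sum_nonneg weight_nonneg)
qed

sublocale W: semi_inner wform by (rule semi_inner_wform)

lemma excess_wform: "excess v = wform v v"
  by (simp add: excess_def wform_def)

lemma cut_norm_bound: "\<exists>c\<ge>0. \<forall>v k. norm (cut v k) \<le> c * W.nrm v"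
proof -
  obtain c where c: "0 < c" "\<And>u. c * (norm u)\<^sup>2 \<le> u \<bullet> (weight *v u)"
    using pos_def_lower_bound[OF pos_def_weight] by blast
  have "norm (cut v k) \<le> (1 / sqrt c) * W.nrm v" for v k
  proof (cases "k < N")
    case True
    have "c * (norm (v k))\<^sup>2 \<le> v k \<bullet> (weight *v v k)" by (rule c(2))
    also have "\<dots> \<le> wform v v"
      unfolding wform_def using True by (intro member_le_sum weight_nonneg) auto
    finally have "sqrt (c * (norm (v k))\<^sup>2) \<le> W.nrm v" unfolding W.nrm_def by (rule real_sqrt_le_mono)
    then show ?thesis using True c(1) by (simp add: cut_def real_sqrt_mult field_simps)
  next
    case False then show ?thesis using W.nrm_nonneg[of v] c(1) by (simp add: cut_def)
  qed
  then show ?thesis using c(1) by (intro exI[of _ "1 / sqrt c"]) simp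
qed

text \<open>A Cauchy sequence in the seminorm converges in each of the first \<open>N\<close> coordinates.\<close>

lemma wform_complete:
  assumes X: "\<And>e. 0 < e \<Longrightarrow> \<exists>n. \<forall>p\<ge>n. \<forall>q\<ge>n. W.nrm (X p - X q) < e"
  shows "\<exists>l. (\<lambda>p. W.nrm (X p - l)) \<longlonglongrightarrow> 0"
proof -
  obtain c where c: "0 \<le> c" "\<And>v k. norm (cut v k) \<le> c * W.nrm v" using cut_norm_bound by blast
  have "Cauchy (\<lambda>p. cut (X p) k)" for k
    unfolding Cauchy_iff
  proof (intro allI impI)
    fix e :: real assume e: "0 < e"
    obtain n where n: "\<And>p q. p \<ge> n \<Longrightarrow> q \<ge> n \<Longrightarrow> W.nrm (X p - X q) < e / (c + 1)"
      using X[of "e / (c + 1)"] e c(1) by auto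
    have "norm (cut (X p) k - cut (X q) k) < e" if "p \<ge> n" "q \<ge> n" for p q
    proof -
      have "norm (cut (X p) k - cut (X q) k) = norm (cut (X p - X q) k)" by (simp add: cut_def)
      also have "\<dots> \<le> c * W.nrm (X p - X q)" by (rule c(2))
      also have "\<dots> \<le> c * (e / (c + 1))" using n[OF that] c(1) by (intro mult_left_mono) auto
      also have "\<dots> < e" using e c(1) by (simp add: field_simps)
      finally show ?thesis .
    qed
    then show "\<exists>M. \<forall>p\<ge>M. \<forall>q\<ge>M. norm (cut (X p) k - cut (X q) k) < e" by blast
  qed
  then have "\<forall>k. \<exists>l. (\<lambda>p. cut (X p) k) \<longlonglongrightarrow> l" using Cauchy_convergent convergent_def by blast
  then obtain l where l: "\<And>k. (\<lambda>p. cut (X p) k) \<longlonglongrightarrow> l k" by metis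
  have "(\<lambda>p. wform (X p - l) (X p - l)) \<longlonglongrightarrow> (\<Sum>k<N. 0 \<bullet> (weight *v 0))"
    unfolding wform_def
  proof (rule tendsto_sum)
    fix k assume k: "k \<in> {..<N}"
    have "(\<lambda>p. (X p - l) k) \<longlonglongrightarrow> 0" using l[of k] k by (simp add: cut_def LIM_zero)
    then show "(\<lambda>p. (X p - l) k \<bullet> (weight *v (X p - l) k)) \<longlonglongrightarrow> 0 \<bullet> (weight *v 0)"
      by (intro tendsto_inner bounded_linear.tendsto[OF matrix_vector_mul_bounded_linear])
  qed
  then have "(\<lambda>p. sqrt (wform (X p - l) (X p - l))) \<longlonglongrightarrow> sqrt 0" by (intro tendsto_real_sqrt) simp
  then show ?thesis unfolding W.nrm_def by auto
qed

lemma pre_loop_split: "pre_loop x v k = pre_loop 0 v k + pre_loop x 0 k"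
  and pre_input_split: "pre_input x v k = pre_input 0 v k + pre_input x 0 k"
  using pre_loop_linear(1)[of 0 x v 0 k] pre_input_linear(1)[of 0 x v 0 k] by simp_all

lemma linear_pre_loop: "linear (\<lambda>v. pre_loop 0 v k)" "linear (\<lambda>x. pre_loop x 0 k)"
  and linear_pre_input: "linear (\<lambda>v. pre_input 0 v k)" "linear (\<lambda>x. pre_input x 0 k)"
  using pre_loop_linear(1)[of 0 0 _ _ k] pre_loop_linear(2)[of _ 0 _ k]
    pre_loop_linear(1)[of _ _ 0 0 k] pre_loop_linear(2)[of _ _ 0 k]
    pre_input_linear(1)[of 0 0 _ _ k] pre_input_linear(2)[of _ 0 _ k]
    pre_input_linear(1)[of _ _ 0 0 k] pre_input_linear(2)[of _ _ 0 k]
  by (auto intro!: linearI simp del: plus_fun_apply)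

lemma norm_two_matrices_le:
  fixes M :: "real ^ 'a ^ 'c" and M' :: "real ^ 'b ^ 'c"
  assumes "norm a \<le> c * s" "norm b \<le> d * s"
  shows "norm (M *v a + M' *v b) \<le> (onorm ((*v) M) * c + onorm ((*v) M') * d) * s"
proof -
  have "norm (M *v a) \<le> onorm ((*v) M) * (c * s)"
    using assms(1) onorm_matrix_nonneg[of M]
      by (intro order_trans[OF norm_matrix_vector_le] mult_left_mono) auto
  moreover have "norm (M' *v b) \<le> onorm ((*v) M') * (d * s)"
    using assms(2) onorm_matrix_nonneg[of M']
      by (intro order_trans[OF norm_matrix_vector_le] mult_left_mono) auto
  ultimately show ?thesis using norm_triangle_ineq[of "M *v a" "M' *v b"] by (simp add: algebra_simps)
qed

lemma pre_loop_bounded_v: "\<exists>c\<ge>0. \<forall>v. norm (pre_loop 0 v k) \<le> c * W.nrm v"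
proof (induction k)
  case 0 then show ?case by (intro exI[of _ 0]) simp
next
  case (Suc k)
  obtain c where c: "0 \<le> c" "\<And>v. norm (pre_loop 0 v k) \<le> c * W.nrm v" using Suc by blast
  obtain d where d: "0 \<le> d" "\<And>v k. norm (cut v k) \<le> d * W.nrm v" using cut_norm_bound by blast
  have "norm (pre_loop 0 v (Suc k)) \<le> (onorm ((*v) F) * c + onorm ((*v) B) * d) * W.nrm v" for v
    unfolding pre_loop.simps by (rule norm_two_matrices_le[OF c(2) d(2)])
  moreover have "0 \<le> onorm ((*v) F) * c + onorm ((*v) B) * d"
    using c(1) d(1) onorm_matrix_nonneg[of F] onorm_matrix_nonneg[of B] by simp
  ultimately show ?case by blast
qed

lemma pre_input_bounded_v: "\<exists>c\<ge>0. \<forall>v. norm (pre_input 0 v k) \<le> c * W.nrm v"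
proof -
  obtain c where c: "0 \<le> c" "\<And>v. norm (pre_loop 0 v k) \<le> c * W.nrm v" using pre_loop_bounded_v by blast
  obtain d where d: "0 \<le> d" "\<And>v k. norm (cut v k) \<le> d * W.nrm v" using cut_norm_bound by blast
  have "norm (pre_input 0 v k) \<le> (onorm ((*v) K) * c + onorm ((*v) (mat 1 :: real^'m^'m)) * d) * W.nrm v" for v
    using norm_two_matrices_le[OF c(2)[of v] d(2)[of v k], of K "mat 1"] by (simp add: pre_input_def)
  moreover have "0 \<le> onorm ((*v) K) * c + onorm ((*v) (mat 1 :: real^'m^'m)) * d"
    using c(1) d(1) onorm_matrix_nonneg[of K] onorm_matrix_nonneg[of "mat 1 :: real^'m^'m"] by simp
  ultimately show ?thesis by blast
qed

text \<open>By \<open>truncation\<close> and \<open>set_erosion_rows\<close>, on a ball of states MPC is the least-norm problem of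
  \<open>parametric_min_norm\<close> with finitely many rows depending on the system and on \<open>R\<close>, while
  \<open>\<Delta>\<close> enters through \<open>rhs\<close> alone.\<close>

lemma first_input_lipschitz:
  "\<exists>\<epsilon>0>0. \<forall>R. \<exists>L\<ge>0. \<forall>\<epsilon> \<Delta> x y v w. tube \<epsilon> \<Delta> \<longrightarrow> \<epsilon> \<le> \<epsilon>0 \<longrightarrow> norm x \<le> R \<longrightarrow> norm y \<le> R \<longrightarrow>
     pre_opt \<Delta> x v \<longrightarrow> pre_opt \<Delta> y w \<longrightarrow> norm (v 0 - w 0) \<le> L * norm (x - y)"
proof -
  obtain \<epsilon>0 where \<epsilon>0: "0 < \<epsilon>0" and trunc0: "\<forall>R. \<exists>H. \<forall>\<epsilon> \<Delta> x v. tube \<epsilon> \<Delta> \<longrightarrow> \<epsilon> \<le> \<epsilon>0 \<longrightarrow> Xbar0 sys \<Delta> \<noteq> {} \<longrightarrow>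
      norm x \<le> R \<longrightarrow>
     (pre_feasible \<Delta> x v \<longleftrightarrow> (\<forall>k<H. pre_loop x v k \<in> Xbar sys \<Delta> \<and> pre_input x v k \<in> Ubar sys \<Delta>))"
    using truncation by (elim exE conjE)
  have pX: "polyhedron (Xset sys)" and pU: "polyhedron (Uset sys)" using data by (simp_all add: mpc_data_def)
  obtain rX where rX: "finite rX" "Xset sys = {x. \<forall>(a, b)\<in>rX. a \<bullet> x \<le> b}" 
    using polyhedron_rows[OF pX] by (elim exE conjE)
  obtain rU where rU: "finite rU" "Uset sys = {x. \<forall>(a, b)\<in>rU. a \<bullet> x \<le> b}"
    using polyhedron_rows[OF pU] by (elim exE conjE)
  have "\<exists>L\<ge>0. \<forall>\<epsilon> \<Delta> x y v w. tube \<epsilon> \<Delta> \<longrightarrow> \<epsilon> \<le> \<epsilon>0 \<longrightarrow> norm x \<le> R \<longrightarrow> norm y \<le> R \<longrightarrow>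
     pre_opt \<Delta> x v \<longrightarrow> pre_opt \<Delta> y w \<longrightarrow> norm (v 0 - w 0) \<le> L * norm (x - y)" for R
  proof -
    obtain H where trunc: "\<And>\<epsilon> \<Delta> x v. tube \<epsilon> \<Delta> \<Longrightarrow> \<epsilon> \<le> \<epsilon>0 \<Longrightarrow> Xbar0 sys \<Delta> \<noteq> {} \<Longrightarrow> norm x \<le> R \<Longrightarrow>
     (pre_feasible \<Delta> x v \<longleftrightarrow> (\<forall>k<H. pre_loop x v k \<in> Xbar sys \<Delta> \<and> pre_input x v k \<in> Ubar sys \<Delta>))"
      using trunc0[rule_format, of R] by (elim exE) simp
    \<comment> \<open>a time step together with a row of the state constraints (\<open>Inl\<close>) or the input constraints (\<open>Inr\<close>)\<close>
    define I where "I = {..<H} \<times> (Inl ` rX \<union> Inr ` rU)"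
    define row where "row i x u = (case snd i of Inl p \<Rightarrow> fst p \<bullet> x | Inr p \<Rightarrow> fst p \<bullet> u)"
      for i :: "nat \<times> ((real ^ 'n) \<times> real + (real ^ 'm) \<times> real)" and x u
    define g where "g i v = row i (pre_loop 0 v (fst i)) (pre_input 0 v (fst i))" for i v
    define h where "h i x = row i (pre_loop x 0 (fst i)) (pre_input x 0 (fst i))" for i x
    define rhs where "rhs \<Delta> i = (case snd i of Inl p \<Rightarrow> snd p - (SUP y\<in>\<Delta>. fst p \<bullet> y)
        | Inr p \<Rightarrow> snd p - (SUP y\<in>(*v) K ` \<Delta>. fst p \<bullet> y))"
      for \<Delta> and i :: "nat \<times> ((real ^ 'n) \<times> real + (real ^ 'm) \<times> real)"
    have row_add: "row i (x + y) (u + w) = row i x u + row i y w"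
      and row_scale: "row i (c *\<^sub>R x) (c *\<^sub>R u) = c * row i x u" for i x y u w c
      unfolding row_def by (simp_all add: inner_add_right split: sum.split)
    have gh: "g i v + h i x = row i (pre_loop x v (fst i)) (pre_input x v (fst i))" for i v x
      unfolding g_def h_def row_add[symmetric] by (simp add: pre_loop_split[of x v] pre_input_split[of x v])
    have Iall: "(\<forall>i\<in>{..<H} \<times> (Inl ` rX \<union> Inr ` rU). Q i) \<longleftrightarrow>
        (\<forall>k<H. (\<forall>p\<in>rX. Q (k, Inl p)) \<and> (\<forall>p\<in>rU. Q (k, Inr p)))" for Q
      by blast
    have finI: "finite I" unfolding I_def using rX(1) rU(1) by simp
    have linear_row: "linear (\<lambda>z. row i (p z) (q z))" if "linear p" "linear q" for p q :: "'z::real_vector \<Rightarrow> _" and i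
      using that by (auto intro!: linearI simp: linear_add linear_scale row_add row_scale)
    have lg: "linear (g i)" and lh: "linear (h i)" for i
      unfolding g_def[abs_def] h_def[abs_def]
      by (intro linear_row linear_pre_loop linear_pre_input)+
    have row_bound: "\<bar>row i x u\<bar> \<le> (case snd i of Inl p \<Rightarrow> norm (fst p) | Inr p \<Rightarrow>
        norm (fst p)) * (norm x + norm u)" for i x u
    proof (cases "snd i")
      case (Inl p)
      have "norm (fst p) * norm x \<le> norm (fst p) * (norm x + norm u)" by (rule mult_left_mono) auto
      then show ?thesis using Inl Cauchy_Schwarz_ineq2[of "fst p" x] by (simp add: row_def)
    next
      case (Inr p)
      have "norm (fst p) * norm u \<le> norm (fst p) * (norm x + norm u)" by (rule mult_left_mono) auto
      then show ?thesis using Inr Cauchy_Schwarz_ineq2[of "fst p" u] by (simp add: row_def)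
    qed
    have gb: "\<exists>c\<ge>0. \<forall>v. \<bar>g i v\<bar> \<le> c * W.nrm v" for i
    proof -
      obtain c where c: "0 \<le> c" "\<And>v. norm (pre_loop 0 v (fst i)) \<le>
          c * W.nrm v" using pre_loop_bounded_v by blast
      obtain d where d: "0 \<le> d" "\<And>v. norm (pre_input 0 v (fst i)) \<le>
          d * W.nrm v" using pre_input_bounded_v by blast
      let ?n = "(case snd i of Inl p \<Rightarrow> norm (fst p) | Inr p \<Rightarrow> norm (fst p))"
      have n: "0 \<le> ?n" by (simp split: sum.split)
      have "\<bar>g i v\<bar> \<le> (?n * (c + d)) * W.nrm v" for v
      proof -
        have "\<bar>g i v\<bar> \<le> ?n * (norm (pre_loop 0 v (fst i)) + norm (pre_input 0 v (fst i)))"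
          unfolding g_def by (rule row_bound)
        also have "\<dots> \<le> ?n * (c * W.nrm v + d * W.nrm v)"
          using n c(2)[of v] d(2)[of v] by (intro mult_left_mono add_mono)
        finally show ?thesis by (simp add: algebra_simps)
      qed
      then show ?thesis using n c(1) d(1) by (intro exI[of _ "?n * (c + d)"]) simp
    qed
    obtain cg where cg: "0 \<le> cg" "\<forall>i\<in>I. \<forall>v. \<bar>g i v\<bar> \<le> cg * W.nrm v"
      using uniform_bound[of I g W.nrm, OF finI gb W.nrm_nonneg] by (elim exE conjE)
    have hb: "\<exists>c\<ge>0. \<forall>x. \<bar>h i x\<bar> \<le> c * norm x" for i
    proof -
      have "bounded_linear (h i)" using lh by (simp add: linear_conv_bounded_linear)
      then obtain c where "\<forall>x. norm (h i x) \<le> norm x * c" "0 < c"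
        using bounded_linear.pos_bounded by blast
      then show ?thesis by (intro exI[of _ c]) (simp add: mult.commute)
    qed
    obtain ch where ch: "0 \<le> ch" "\<forall>i\<in>I. \<forall>x. \<bar>h i x\<bar> \<le> ch * norm x"
      using uniform_bound[of I h norm, OF finI hb norm_ge_zero] by (elim exE conjE)
    interpret Q: parametric_min_norm wform I g h cg ch
    proof (unfold_locales)
      show "\<exists>l. (\<lambda>p. W.nrm (X p - l)) \<longlonglongrightarrow> 0"
        if "\<And>e. 0 < e \<Longrightarrow> \<exists>n. \<forall>p\<ge>n. \<forall>q\<ge>n. W.nrm (X p - X q) < e" for X
        using that by (rule wform_complete)
    qed (use finI lg lh cg ch in \<open>auto simp: linear_add linear_scale\<close>)
    obtain L where L: "0 \<le> L" and lip: "\<And>b x y v w. Q.opt b x v \<Longrightarrow> Q.opt b y w \<Longrightarrow>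
        (\<forall>z\<in>closed_segment x y. \<exists>u. Q.opt b z u) \<Longrightarrow> W.nrm (v - w) \<le> L * norm (x - y)"
      using Q.opt_lipschitz by (elim exE conjE) simp
    obtain c where c: "0 \<le> c" "\<And>v k. norm (cut v k) \<le> c * W.nrm v" using cut_norm_bound by blast
    have "norm (v 0 - w 0) \<le> (c * L) * norm (x - y)"
      if tube: "tube \<epsilon> \<Delta>" and \<epsilon>: "\<epsilon> \<le> \<epsilon>0" and x: "norm x \<le> R" and y: "norm y \<le> R"
        and v: "pre_opt \<Delta> x v" and w: "pre_opt \<Delta> y w" for \<epsilon> \<Delta> x y v w
    proof -
      have x0: "x \<in> Xbar0 sys \<Delta>" and y0: "y \<in> Xbar0 sys \<Delta>"
        using v w by (auto simp: Xbar0_iff pre_opt_def)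
      then have ne: "Xbar0 sys \<Delta> \<noteq> {}" by blast
      have bd: "bounded \<Delta>" using tube_compact[OF tube] by (rule compact_imp_bounded)
      have bdK: "bounded ((*v) K ` \<Delta>)"
        using bd by (rule bounded_linear_image) (rule matrix_vector_mul_bounded_linear)
      have 0: "0 \<in> \<Delta>" by (rule tube_0[OF tube])
      then have 0: "0 \<in> \<Delta>" "0 \<in> (*v) K ` \<Delta>" by (auto intro!: image_eqI[of _ _ 0])
      have XU: "z \<in> Xbar sys \<Delta> \<longleftrightarrow> (\<forall>(a, b)\<in>rX. a \<bullet> z \<le> b - (SUP y\<in>\<Delta>. a \<bullet> y))"
          "u \<in> Ubar sys \<Delta> \<longleftrightarrow> (\<forall>(a, b)\<in>rU. a \<bullet> u \<le> b - (SUP y\<in>(*v) K ` \<Delta>. a \<bullet> y))" for z u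
        unfolding Xbar_def Ubar_def rX(2) rU(2)
        by (rule set_erosion_rows[OF bd 0(1)], rule set_erosion_rows[OF bdK 0(2)])
      have feas: "Q.feas (rhs \<Delta>) z u \<longleftrightarrow> pre_feasible \<Delta> z u" if "norm z \<le> R" for z u
      proof -
        have "Q.feas (rhs \<Delta>) z u \<longleftrightarrow>
            (\<forall>i\<in>I. row i (pre_loop z u (fst i)) (pre_input z u (fst i)) \<le> rhs \<Delta> i)"
          unfolding Q.feas_def gh ..
        also have "\<dots> \<longleftrightarrow> (\<forall>k<H. pre_loop z u k \<in> Xbar sys \<Delta> \<and> pre_input z u k \<in> Ubar sys \<Delta>)"
          unfolding XU I_def Iall row_def rhs_def by (simp add: case_prod_unfold)
        also have "\<dots> \<longleftrightarrow> pre_feasible \<Delta> z u" using trunc[OF tube \<epsilon> ne that] by simp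
        finally show ?thesis .
      qed
      have opt: "Q.opt (rhs \<Delta>) z u \<longleftrightarrow> pre_opt \<Delta> z u" if "norm z \<le> R" for z u
        unfolding Q.opt_def pre_opt_def feas[OF that] excess_wform W.nrm_le_iff ..
      \<comment> \<open>feasible states form a convex set, so the problem is solvable along the whole segment\<close>
      have "\<exists>u. Q.opt (rhs \<Delta>) z u" if z: "z \<in> closed_segment x y" for z
      proof -
        have "z \<in> Xbar0 sys \<Delta>"
          using z closed_segment_subset[OF x0 y0 convex_Xbar0] by blast
        moreover have "closed_segment x y \<subseteq> cball 0 R"
          using x y by (intro closed_segment_subset convex_cball) auto
        then have "norm z \<le> R" using z by auto
        ultimately show ?thesis using mpc_control_spec[of z \<Delta>] opt[of z] by blast
      qed
      then have "W.nrm (v - w) \<le> L * norm (x - y)"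
        using v w opt[OF x] opt[OF y] by (intro lip[of "rhs \<Delta>"]) simp_all
      then have "c * W.nrm (v - w) \<le> c * (L * norm (x - y))" using c(1) by (rule mult_left_mono)
      then show ?thesis using c(2)[of "v - w" 0] N_pos by (simp add: cut_def mult.assoc)
    qed
    note claim = this
    show ?thesis
    proof (intro exI[of _ "c * L"] conjI allI impI)
      show "0 \<le> c * L" using c(1) L by simp
    qed (rule claim)
  qed
  then show ?thesis by (intro exI[of _ \<epsilon>0] conjI \<epsilon>0) (rule allI)
qed

section \<open>Convergence of the reference closed loop\<close>

lemma geometric_sum_le: "(\<Sum>j<n. \<rho> ^ j) \<le> 1 / (1 - \<rho>)"
proof -
  have "(\<Sum>j<n. \<rho> ^ j) = (1 - \<rho> ^ n) / (1 - \<rho>)"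
    using rho_less_1 by (subst sum_gp_strict) simp
  also have "\<dots> \<le> 1 / (1 - \<rho>)" using rho_less_1 rho_nonneg by (intro divide_right_mono) auto
  finally show ?thesis .
qed

text \<open>Variation of constants for \<open>d (Suc t) = F d t + disturbance\<close>: the disturbances contribute a
  geometric series.\<close>

lemma stable_recursion:
  assumes "\<And>t. s \<le> t \<Longrightarrow> t < s + n \<Longrightarrow> norm (d (Suc t) - F *v d t) \<le> \<eta>" and "0 \<le> \<eta>"
  shows "norm (d (s + n)) \<le> \<tau> * \<rho> ^ n * norm (d s) + \<kappa> * \<eta>"
proof -
  have "norm (d (s + n) - ((*v) F ^^ n) (d s)) \<le> (\<Sum>j<n. \<tau> * \<rho> ^ j * \<eta>)"
    using assms(1)
  proof (induction n arbitrary: s)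
    case (Suc n)
    have 1: "norm (d (Suc s + n) - ((*v) F ^^ n) (d (Suc s))) \<le> (\<Sum>j<n. \<tau> * \<rho> ^ j * \<eta>)"
      by (rule Suc.IH) (use Suc.prems in auto)
    have "norm (((*v) F ^^ n) (d (Suc s) - F *v d s)) \<le> \<tau> * \<rho> ^ n * norm (d (Suc s) - F *v d s)"
      by (rule norm_F_power)
    also have "\<dots> \<le> \<tau> * \<rho> ^ n * \<eta>"
      using Suc.prems[of s] tau_pos rho_nonneg by (intro mult_left_mono) auto
    finally have 2: "norm (((*v) F ^^ n) (d (Suc s) - F *v d s)) \<le> \<tau> * \<rho> ^ n * \<eta>" .
    have "d (s + Suc n) - ((*v) F ^^ Suc n) (d s)
        = (d (Suc s + n) - ((*v) F ^^ n) (d (Suc s))) + ((*v) F ^^ n) (d (Suc s) - F *v d s)"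
      by (simp add: F_power_diff funpow_swap1)
    then show ?case using 1 2 norm_triangle_ineq by (smt (verit) sum.lessThan_Suc)
  qed simp
  also have "\<dots> = (\<Sum>j<n. \<rho> ^ j) * (\<tau> * \<eta>)" by (simp add: sum_distrib_left mult_ac)
  also have "\<dots> \<le> (1 / (1 - \<rho>)) * (\<tau> * \<eta>)"
    using geometric_sum_le tau_pos assms(2) by (intro mult_right_mono) auto
  also have "\<dots> = \<kappa> * \<eta>" by (simp add: \<kappa>_def)
  finally have "norm (d (s + n) - ((*v) F ^^ n) (d s)) \<le> \<kappa> * \<eta>" .
  then show ?thesis
    using norm_F_power[of n "d s"] norm_triangle_sub[of "d (s + n)" "((*v) F ^^ n) (d s)"] by linarith
qed

lemma form_le_onorm: "x \<bullet> (M *v y) \<le> onorm ((*v) M) * (norm x * norm y)" for M :: "real ^ 'a ^ 'a"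
proof -
  have "x \<bullet> (M *v y) \<le> norm x * norm (M *v y)" by (rule norm_cauchy_schwarz)
  also have "\<dots> \<le> norm x * (onorm ((*v) M) * norm y)" by (intro mult_left_mono norm_matrix_vector_le) simp
  finally show ?thesis by (simp add: mult_ac)
qed

lemma form_sq_le: "norm x \<le> c \<Longrightarrow> x \<bullet> (M *v x) \<le> onorm ((*v) M) * c\<^sup>2" for M :: "real ^ 'a ^ 'a"
proof -
  assume "norm x \<le> c"
  then have "norm x * norm x \<le> c\<^sup>2" unfolding power2_eq_square
    by (intro mult_mono) (auto intro: order_trans[OF norm_ge_zero])
  then have "onorm ((*v) M) * (norm x * norm x) \<le> onorm ((*v) M) * c\<^sup>2"
    by (rule mult_left_mono) (rule onorm_matrix_nonneg)
  then show ?thesis using form_le_onorm[of x M x] by linarith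
qed

text \<open>Feasible inputs and the states they lead to are bounded, hence so are the deviations.\<close>

lemma excess_bound: "\<exists>E\<ge>0. \<forall>\<Delta> x v. norm x \<le> R \<longrightarrow> pre_feasible \<Delta> x v \<longrightarrow> excess v \<le> E"
proof -
  have "\<exists>E\<ge>0. \<forall>\<Delta> x v. norm x \<le> R \<longrightarrow> pre_feasible \<Delta> x v \<longrightarrow> (\<Sum>k<n. v k \<bullet> (weight *v v k)) \<le> E"
    if "n \<le> N" for n
    using that
  proof (induction n)
    case 0 then show ?case by (intro exI[of _ 0]) simp
  next
    case (Suc n)
    obtain E where E: "0 \<le> E"
      "\<And>\<Delta> x v. norm x \<le> R \<Longrightarrow> pre_feasible \<Delta> x v \<Longrightarrow> (\<Sum>k<n. v k \<bullet> (weight *v v k)) \<le> E"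
      using Suc.IH[OF Suc_leD[OF Suc.prems]] by (elim exE conjE) simp
    obtain c where c: "\<forall>x v. norm x \<le> R \<longrightarrow> (\<forall>j<n. pre_input x v j \<in> Uset sys) \<longrightarrow> norm (pre_loop x v n) \<le> c"
      using pre_loop_bound[of R n] by (elim exE)
    obtain b where b: "0 \<le> b" "\<And>u. u \<in> Uset sys \<Longrightarrow> norm u \<le> b" using U_norm_bound by blast
    define e where "e = b + onorm ((*v) K) * c"
    have "(\<Sum>k<Suc n. v k \<bullet> (weight *v v k)) \<le> E + onorm ((*v) weight) * e\<^sup>2"
      if x: "norm x \<le> R" and f: "pre_feasible \<Delta> x v" for \<Delta> x v
    proof -
      have u: "pre_input x v k \<in> Uset sys" for k
        using f Ubar_subset[of \<Delta>] by (auto simp: pre_feasible_def)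
      have "norm (K *v pre_loop x v n) \<le> onorm ((*v) K) * c"
        using c x u onorm_matrix_nonneg[of K]
        by (intro order_trans[OF norm_matrix_vector_le] mult_left_mono) auto
      moreover have "v n = pre_input x v n - K *v pre_loop x v n"
        using Suc.prems by (simp add: pre_input_def cut_def)
      ultimately have "norm (v n) \<le> e"
        using b(2)[OF u[of n]] norm_triangle_ineq4[of "pre_input x v n" "K *v pre_loop x v n"]
        unfolding e_def by simp
      then have "v n \<bullet> (weight *v v n) \<le> onorm ((*v) weight) * e\<^sup>2" by (rule form_sq_le)
      then show ?thesis using E(2)[OF x f] by simp
    qed
    moreover have "0 \<le> E + onorm ((*v) weight) * e\<^sup>2" using E(1) onorm_matrix_nonneg[of weight] by simp
    ultimately show ?case by (intro exI conjI allI impI)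
  qed
  from this[of N] show ?thesis unfolding excess_def by simp
qed

text \<open>A nominal MPC closed loop, described by optimal deviations instead of the input that
  \<open>arg_min\<close> selects.\<close>

definition mpc_run :: "(real ^ 'n) set \<Rightarrow> (nat \<Rightarrow> real ^ 'n) \<Rightarrow> (nat \<Rightarrow> nat \<Rightarrow> real ^ 'm) \<Rightarrow> bool" where
  "mpc_run \<Delta> x v \<longleftrightarrow> (\<forall>t. pre_opt \<Delta> (x t) (v t) \<and> x (Suc t) = pre_loop (x t) (v t) 1)"

text \<open>The shifted deviations compete in the next problem, so the optimal excess drops by the
  weighted square of the applied deviation in each step.\<close>

lemma mpc_run_excess:
  assumes run: "mpc_run \<Delta> x v"
  shows "(\<Sum>t<n. v t 0 \<bullet> (weight *v v t 0)) + excess (v n) \<le> excess (v 0)"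
proof (induction n)
  case (Suc n)
  have "pre_feasible \<Delta> (x (Suc n)) (shift (v n))"
    using run pre_feasible_shift[of \<Delta> "x n" "v n"] unfolding mpc_run_def pre_opt_def by metis
  then have "excess (v (Suc n)) \<le> excess (shift (v n))"
    using run unfolding mpc_run_def pre_opt_def by blast
  then show ?case using Suc excess_shift[of "v n"] by simp
qed simp

lemma block_sum_lower:
  fixes f :: "nat \<Rightarrow> real"
  assumes "\<And>j. j < J \<Longrightarrow> \<exists>t. j * n \<le> t \<and> t < j * n + n \<and> a \<le> f t" and "\<And>t. 0 \<le> f t"
  shows "real J * a \<le> (\<Sum>t<J * n. f t)"
  using assms(1)
proof (induction J)
  case (Suc J)
  obtain t where t: "J * n \<le> t" "t < J * n + n" "a \<le> f t" using Suc.prems[of J] by auto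
  have "(\<Sum>t<Suc J * n. f t) = (\<Sum>t<J * n. f t) + (\<Sum>t=J * n..<J * n + n. f t)"
    using sum.atLeastLessThan_concat[of 0 "J * n" "J * n + n" f]
    by (simp add: lessThan_atLeast0 add.commute)
  moreover have "f t \<le> (\<Sum>t=J * n..<J * n + n. f t)" using t assms(2) by (intro member_le_sum) auto
  moreover have "real J * a \<le> (\<Sum>t<J * n. f t)" using Suc by simp
  ultimately show ?case using t(3) by (simp add: algebra_simps)
qed simp

text \<open>The applied deviations are square summable with a uniform bound, so among sufficiently many
  blocks of length \<open>n\<close> there is one with small deviations only. If \<open>n\<close> is large, stability
  of \<open>F\<close> makes the state small at the end of this block.\<close>

lemma mpc_run_converges:
  assumes r: "0 < r"
  shows "\<exists>t0 R'. \<forall>\<Delta> x v. mpc_run \<Delta> x v \<longrightarrow> norm (x 0) \<le> R0 \<longrightarrow>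
    (\<forall>t. norm (x t) \<le> R') \<and> (\<exists>s\<le>t0. norm (x s) \<le> r)"
proof -
  obtain E where E: "0 \<le> E" "\<And>\<Delta> x v. norm x \<le> R0 \<Longrightarrow> pre_feasible \<Delta> x v \<Longrightarrow> excess v \<le> E"
    using excess_bound[of R0] by (elim exE conjE) simp
  obtain c where c: "0 < c" "\<And>u. c * (norm u)\<^sup>2 \<le> u \<bullet> (weight *v u)"
    using pos_def_lower_bound[OF pos_def_weight] by (elim exE conjE) simp
  define b where "b = onorm ((*v) B)"
  have b: "0 \<le> b" unfolding b_def by (rule onorm_matrix_nonneg)
  define \<eta>0 where "\<eta>0 = sqrt (E / c)"
  have \<eta>0: "0 \<le> \<eta>0" unfolding \<eta>0_def using E c by simp
  define R' where "R' = \<tau> * \<bar>R0\<bar> + \<kappa> * (b * \<eta>0)"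
  obtain n where n: "\<tau> * \<rho> ^ n * R' \<le> r / 2" using rho_power_small[of "r / 2" R'] r by auto
  define \<eta> where "\<eta> = r / (2 * \<kappa> * (b + 1))"
  have \<eta>: "0 < \<eta>" unfolding \<eta>_def using r kappa_pos b by simp
  have \<eta>r: "\<kappa> * (b * \<eta>) \<le> r / 2"
  proof -
    have "\<kappa> * (b * \<eta>) \<le> \<kappa> * ((b + 1) * \<eta>)" using kappa_pos \<eta> by (intro mult_left_mono mult_right_mono) auto
    also have "\<dots> = r / 2" using kappa_pos b unfolding \<eta>_def by (simp add: divide_simps)
    finally show ?thesis .
  qed
  obtain J where J: "E < real J * (c * \<eta>\<^sup>2)"
    using reals_Archimedean3[of "c * \<eta>\<^sup>2"] c \<eta> by auto
  have "(\<forall>t. norm (x t) \<le> R') \<and> (\<exists>s\<le>J * n. norm (x s) \<le> r)"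
    if run: "mpc_run \<Delta> x v" and x0: "norm (x 0) \<le> R0" for \<Delta> x v
  proof -
    have "excess (v 0) \<le> E" using run E(2)[OF x0] by (auto simp: mpc_run_def pre_opt_def)
    then have sumE: "(\<Sum>t<k. v t 0 \<bullet> (weight *v v t 0)) \<le> E" for k
      using mpc_run_excess[OF run, of k] excess_nonneg[of "v k"] by linarith
    have step: "norm (x (Suc t) - F *v x t) \<le> b * norm (v t 0)" for t
      using run norm_matrix_vector_le[of B "v t 0"] unfolding mpc_run_def pre_loop_1 b_def by simp
    have step': "norm (x (Suc t) - F *v x t) \<le> b * e" if "norm (v t 0) \<le> e" for t e
      using order_trans[OF step mult_left_mono[OF that b]] .
    have v\<eta>: "norm (v t 0) \<le> \<eta>0" for t
    proof -
      have "c * (norm (v t 0))\<^sup>2 \<le> E"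
        using c(2)[of "v t 0"] sumE[of "Suc t"]
            sum_nonneg[of "{..<t}" "\<lambda>t. v t 0 \<bullet> (weight *v v t 0)"] weight_nonneg
        by simp
      then have "(norm (v t 0))\<^sup>2 \<le> E / c" using c(1) by (simp add: field_simps)
      then show ?thesis unfolding \<eta>0_def by (rule real_le_rsqrt)
    qed
    have bd: "norm (x t) \<le> R'" for t
    proof -
      have "norm (x (0 + t)) \<le> \<tau> * \<rho> ^ t * norm (x 0) + \<kappa> * (b * \<eta>0)"
        by (rule stable_recursion) (use step' v\<eta> b \<eta>0 in auto)
      moreover have "\<tau> * \<rho> ^ t * norm (x 0) \<le> \<tau> * 1 * \<bar>R0\<bar>"
        using x0 tau_pos rho_nonneg rho_less_1 by (intro mult_mono) (auto intro: power_le_one)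
      ultimately show ?thesis unfolding R'_def by simp
    qed
    have "\<exists>j<J. \<forall>t. j * n \<le> t \<longrightarrow> t < j * n + n \<longrightarrow> norm (v t 0) \<le> \<eta>"
    proof (rule ccontr)
      assume neg: "\<not> ?thesis"
      have "\<exists>t. j * n \<le> t \<and> t < j * n + n \<and> c * \<eta>\<^sup>2 \<le> v t 0 \<bullet> (weight *v v t 0)" if j: "j < J" for j
      proof -
        obtain t where t: "j * n \<le> t" "t < j * n + n" "\<eta> < norm (v t 0)" using neg j by (auto simp: not_le)
        then have "c * \<eta>\<^sup>2 \<le> c * (norm (v t 0))\<^sup>2" using c(1) \<eta> by (intro mult_left_mono power_mono) auto
        then show ?thesis using t c(2)[of "v t 0"] by (intro exI[of _ t]) auto
      qed
      then have "real J * (c * \<eta>\<^sup>2) \<le> (\<Sum>t<J * n. v t 0 \<bullet> (weight *v v t 0))"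
        by (rule block_sum_lower) (simp_all add: weight_nonneg)
      then show False using sumE[of "J * n"] J by linarith
    qed
    then obtain j where j: "j < J" "\<And>t. j * n \<le> t \<Longrightarrow> t < j * n + n \<Longrightarrow> norm (v t 0) \<le> \<eta>" by blast
    have "norm (x (j * n + n)) \<le> \<tau> * \<rho> ^ n * norm (x (j * n)) + \<kappa> * (b * \<eta>)"
      by (rule stable_recursion) (use step' j(2) b \<eta> in auto)
    moreover have "\<tau> * \<rho> ^ n * norm (x (j * n)) \<le> \<tau> * \<rho> ^ n * R'"
      using bd tau_pos rho_nonneg by (intro mult_left_mono) auto
    ultimately have "norm (x (j * n + n)) \<le> r" using n \<eta>r by linarith
    moreover have "j * n + n \<le> J * n"
      using mult_le_mono1[of "Suc j" J n] j(1) by (simp add: add.commute)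
    ultimately show ?thesis using bd by blast
  qed
  note claim = this
  show ?thesis
    by (rule exI[of _ "J * n"], rule exI[of _ R']) (intro allI impI, rule claim)
qed

lemma mpc_run_in_Obar:
  assumes "mpc_run \<Delta> x v" "x s \<in> Obar sys \<Delta>"
  shows "x (s + k) \<in> Obar sys \<Delta> \<and> x (s + k) = ((*v) F ^^ k) (x s)"
proof (induction k)
  case (Suc k)
  have "v (s + k) 0 = 0" using Suc assms(1) pre_opt_Obar unfolding mpc_run_def by blast
  then have "x (s + Suc k) = F *v x (s + k)"
    using assms(1) pre_loop_1[of "x (s + k)" "v (s + k)"] by (simp add: mpc_run_def)
  moreover have "F *v x (s + k) \<in> Obar sys \<Delta>" using Suc Obar_step by blast
  ultimately show ?case using Suc by simp
qed (use assms(2) in simp)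

section \<open>Tracking the reference\<close>

lemma reference_bound:
  assumes r: "0 < r"
  shows "\<exists>t0 R'. \<forall>\<Delta> x v. cball 0 r \<subseteq> Obar sys \<Delta> \<longrightarrow> mpc_run \<Delta> x v \<longrightarrow> norm (x 0) \<le> R0 \<longrightarrow>
    (\<forall>t. norm (x t) \<le> R') \<and> (\<forall>t\<ge>t0. norm (x t) \<le> r / 2)"
proof -
  let ?r1 = "r / (2 * \<tau>)"
  have r1: "0 < ?r1" using r tau_pos by simp
  obtain t0 R' where conv: "\<forall>\<Delta> x v. mpc_run \<Delta> x v \<longrightarrow> norm (x 0) \<le> R0 \<longrightarrow>
    (\<forall>t. norm (x t) \<le> R') \<and> (\<exists>s\<le>t0. norm (x s) \<le> ?r1)"
    using mpc_run_converges[OF r1, of R0] by (elim exE)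
  have "(\<forall>t. norm (x t) \<le> R') \<and> (\<forall>t\<ge>t0. norm (x t) \<le> r / 2)"
    if ball: "cball 0 r \<subseteq> Obar sys \<Delta>" and run: "mpc_run \<Delta> x v" and x0: "norm (x 0) \<le> R0" for \<Delta> x v
  proof -
    have R': "\<forall>t. norm (x t) \<le> R'" and ex: "\<exists>s\<le>t0. norm (x s) \<le> ?r1"
      using conv[rule_format, OF run x0] by simp_all
    obtain s where s: "s \<le> t0" "norm (x s) \<le> ?r1" using ex by blast
    have "?r1 \<le> r" using r tau_ge_1 by (simp add: field_simps)
    then have "x s \<in> Obar sys \<Delta>" using s(2) ball by (auto simp: subset_iff)
    note O = mpc_run_in_Obar[OF run this]
    have "norm (x t) \<le> r / 2" if t: "t0 \<le> t" for t
    proof -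
      have "x t = ((*v) F ^^ (t - s)) (x s)" using O[of "t - s"] s t by simp
      then have "norm (x t) \<le> \<tau> * \<rho> ^ (t - s) * norm (x s)" using norm_F_power by metis
      also have "\<dots> \<le> \<tau> * 1 * ?r1"
        using s(2) tau_pos rho_nonneg rho_less_1 by (intro mult_mono) (auto intro: power_le_one)
      finally show ?thesis using tau_pos by simp
    qed
    then show ?thesis using R' by blast
  qed
  note claim = this
  show ?thesis
    by (rule exI[of _ t0], rule exI[of _ R']) (intro allI impI, rule claim)
qed

text \<open>The nominal states of the learner satisfy this relation: \<open>a\<close> accounts for the tube around
  the initial state, \<open>c\<close> for the tube and the disturbance in each step.\<close>

definition tracks ::
  "real \<Rightarrow> real \<Rightarrow> (real ^ 'n) set \<Rightarrow> (nat \<Rightarrow> real ^ 'n) \<Rightarrow> (nat \<Rightarrow> real ^ 'n) \<Rightarrow> (nat \<Rightarrow> nat \<Rightarrow> real ^ 'm) \<Rightarrow>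
      bool" where
  "tracks a c \<Delta> x y w \<longleftrightarrow> (\<forall>t. pre_opt \<Delta> (y t) (w t)) \<and> norm (y 0 - x 0) \<le> a \<and>
     (\<forall>t. norm (y (Suc t) - pre_loop (y t) (w t) 1) \<le> c)"

text \<open>Up to the time \<open>t0\<close> at which the reference is settled in the terminal set, the error is
  multiplied by at most \<open>G\<close> per step. From then on it obeys the stable linear recursion of
  \<open>F\<close>, because \<open>y\<close> is close enough to \<open>x\<close> to be in the terminal set as well. The restriction
  \<open>\<epsilon> \<le> \<epsilon>1\<close> keeps \<open>y\<close> in the domain of the Lipschitz bound during the first phase and in the
  terminal set during the second.\<close>

lemma tracking_error:
  assumes c: "0 \<le> c"
  shows "\<exists>C\<ge>0. \<exists>t0. \<exists>R. \<exists>\<epsilon>1. 0 < \<epsilon>1 \<and> (\<forall>\<epsilon> \<Delta> x v y w. tube \<epsilon> \<Delta> \<longrightarrow> \<epsilon> \<le> \<epsilon>1 \<longrightarrow> mpc_run \<Delta> x v \<longrightarrow>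
     norm (x 0) \<le> R0 \<longrightarrow> tracks (\<kappa> * \<epsilon>) (c * \<epsilon>) \<Delta> x y w \<longrightarrow>
     (\<forall>t. norm (x t) \<le> R \<and> norm (y t - x t) \<le> C * \<epsilon> \<and> norm (w t 0 - v t 0) \<le> C * \<epsilon>) \<and>
     (\<forall>t\<ge>t0. x t \<in> Obar sys \<Delta> \<and> y t \<in> Obar sys \<Delta>))"
proof -
  obtain r \<epsilon>a where r: "0 < r" and \<epsilon>a: "0 < \<epsilon>a"
    and ball: "\<forall>\<epsilon> \<Delta>. tube \<epsilon> \<Delta> \<longrightarrow> \<epsilon> \<le> \<epsilon>a \<longrightarrow> Xbar0 sys \<Delta> \<noteq> {} \<longrightarrow> cball 0 r \<subseteq> Obar sys \<Delta>"
    using cball_subset_Obar by (elim exE conjE)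
  obtain t0 R where ref: "\<forall>\<Delta> x v. cball 0 r \<subseteq> Obar sys \<Delta> \<longrightarrow> mpc_run \<Delta> x v \<longrightarrow> norm (x 0) \<le> R0 \<longrightarrow>
    (\<forall>t. norm (x t) \<le> R) \<and> (\<forall>t\<ge>t0. norm (x t) \<le> r / 2)"
    using reference_bound[OF r, of R0] by (elim exE)
  obtain \<epsilon>b where \<epsilon>b: "0 < \<epsilon>b" and lip0: "\<forall>R. \<exists>L\<ge>0. \<forall>\<epsilon> \<Delta> x y v w. tube \<epsilon> \<Delta> \<longrightarrow> \<epsilon> \<le> \<epsilon>b \<longrightarrow>
     norm x \<le> R \<longrightarrow> norm y \<le> R \<longrightarrow>
     pre_opt \<Delta> x v \<longrightarrow> pre_opt \<Delta> y w \<longrightarrow> norm (v 0 - w 0) \<le> L * norm (x - y)"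
    using first_input_lipschitz by (elim exE conjE)
  obtain L where L: "0 \<le> L" and lip: "\<forall>\<epsilon> \<Delta> x y v w. tube \<epsilon> \<Delta> \<longrightarrow> \<epsilon> \<le> \<epsilon>b \<longrightarrow>
     norm x \<le> R + 1 \<longrightarrow> norm y \<le> R + 1 \<longrightarrow>
     pre_opt \<Delta> x v \<longrightarrow> pre_opt \<Delta> y w \<longrightarrow> norm (v 0 - w 0) \<le> L * norm (x - y)"
    using spec[OF lip0, of "R + 1"] by (elim exE conjE)
  define G where "G = 1 + onorm ((*v) F) + onorm ((*v) B) * L"
  have G: "1 \<le> G" unfolding G_def using L onorm_matrix_nonneg[of F] onorm_matrix_nonneg[of B] by simp
  \<comment> \<open>a solution of \<open>a 0 = \<kappa>\<close>, \<open>G * a t + c \<le> a (Suc t)\<close>\<close>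
  define a where "a t = G ^ t * (\<kappa> + c * real t)" for t
  have a_nonneg: "0 \<le> a t" for t unfolding a_def using G kappa_pos c by simp
  have a_mono: "a s \<le> a t" if "s \<le> t" for s t
    unfolding a_def using that G kappa_pos c
    by (intro mult_mono power_increasing add_left_mono mult_left_mono) auto
  have a_step: "G * a t + c \<le> a (Suc t)" for t
  proof -
    have "c \<le> G ^ Suc t * c" using mult_right_mono[OF one_le_power[OF G, of "Suc t"] c] by simp
    then show ?thesis unfolding a_def by (simp add: algebra_simps)
  qed
  define C1 where "C1 = a t0"
  define C2 where "C2 = \<tau> * C1 + \<kappa> * c"
  have C1: "0 \<le> C1" unfolding C1_def by (rule a_nonneg)
  have C2: "0 \<le> C2" unfolding C2_def using C1 c tau_pos kappa_pos by simp
  define C where "C = (1 + L) * (C1 + C2)"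
  have C: "0 \<le> C" and CC: "C1 \<le> C" "C2 \<le> C" and CL: "L * C1 \<le> C" "L * C2 \<le> C"
    unfolding C_def using C1 C2 L mult_nonneg_nonneg[OF L C1] mult_nonneg_nonneg[OF L C2]
    by (simp_all add: algebra_simps)
  define \<epsilon>1 where "\<epsilon>1 = Min {\<epsilon>a, \<epsilon>b, 1 / (C1 + 1), 1 / (C2 + 1), r / 2 / (C2 + 1)}"
  have \<epsilon>1_pos: "0 < \<epsilon>1" unfolding \<epsilon>1_def using \<epsilon>a \<epsilon>b C1 C2 r by (subst Min_gr_iff) auto
  have \<epsilon>1_le: "\<epsilon>1 \<le> \<epsilon>a" "\<epsilon>1 \<le> \<epsilon>b" "\<epsilon>1 \<le> 1 / (C1 + 1)" "\<epsilon>1 \<le> 1 / (C2 + 1)" "\<epsilon>1 \<le> r / 2 / (C2 + 1)"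
    unfolding \<epsilon>1_def by (rule Min_le; simp)+
  have small: "D * \<epsilon> \<le> e" if "\<epsilon> \<le> e / (D + 1)" "0 \<le> D" "0 < e" "0 < \<epsilon>" for D \<epsilon> e :: real
  proof -
    have "D * \<epsilon> \<le> (D + 1) * \<epsilon>" using that by simp
    also have "\<dots> \<le> e" using that(1,2) by (simp add: field_simps)
    finally show ?thesis .
  qed
  have claim: "(\<forall>t. norm (x t) \<le> R \<and> norm (y t - x t) \<le> C * \<epsilon> \<and> norm (w t 0 - v t 0) \<le> C * \<epsilon>) \<and>
     (\<forall>t\<ge>t0. x t \<in> Obar sys \<Delta> \<and> y t \<in> Obar sys \<Delta>)"
    if tube: "tube \<epsilon> \<Delta>" and \<epsilon>: "\<epsilon> \<le> \<epsilon>1" and run: "mpc_run \<Delta> x v" and x0: "norm (x 0) \<le> R0"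
      and tr: "tracks (\<kappa> * \<epsilon>) (c * \<epsilon>) \<Delta> x y w" for \<epsilon> \<Delta> x v y w
  proof -
    have \<epsilon>pos: "0 < \<epsilon>" using tube by (simp add: tube_def)
    have optx: "pre_opt \<Delta> (x t) (v t)" and xS: "x (Suc t) = pre_loop (x t) (v t) 1" for t
      using run by (auto simp: mpc_run_def)
    have opty: "pre_opt \<Delta> (y t) (w t)" and yS: "norm (y (Suc t) - pre_loop (y t) (w t) 1) \<le> c * \<epsilon>"
      and y0: "norm (y 0 - x 0) \<le> \<kappa> * \<epsilon>" for t
      using tr by (auto simp: tracks_def)
    have "x 0 \<in> Xbar0 sys \<Delta>" using optx[of 0] by (auto simp: Xbar0_iff pre_opt_def)
    then have ne: "Xbar0 sys \<Delta> \<noteq> {}" by blast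
    have ballO: "cball 0 r \<subseteq> Obar sys \<Delta>" using ball tube \<epsilon> \<epsilon>1_le(1) ne by simp
    have xR: "norm (x t) \<le> R" and xr: "t0 \<le> t \<Longrightarrow> norm (x t) \<le> r / 2" for t
      using ref[rule_format, OF ballO run x0] by simp_all
    have lipxy: "norm (w t 0 - v t 0) \<le> L * norm (y t - x t)" if "norm (y t - x t) \<le> 1" for t
    proof -
      have "norm (y t) \<le> R + 1" using xR[of t] that norm_triangle_sub[of "y t" "x t"] by linarith
      moreover have "norm (x t) \<le> R + 1" using xR[of t] by linarith
      moreover have "\<epsilon> \<le> \<epsilon>b" using \<epsilon> \<epsilon>1_le(2) by linarith
      ultimately show ?thesis using lip[rule_format, OF tube _ _ _ opty optx] by blast
    qed
    have C1\<epsilon>: "C1 * \<epsilon> \<le> 1" by (rule small) (use \<epsilon> \<epsilon>1_le(3) C1 \<epsilon>pos in auto)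
    have C2\<epsilon>: "C2 * \<epsilon> \<le> 1" by (rule small) (use \<epsilon> \<epsilon>1_le(4) C2 \<epsilon>pos in auto)
    have C2r: "C2 * \<epsilon> \<le> r / 2" by (rule small) (use \<epsilon> \<epsilon>1_le(5) C2 \<epsilon>pos r in auto)
    have early: "norm (y t - x t) \<le> a t * \<epsilon>" if "t \<le> t0" for t
      using that
    proof (induction t)
      case 0 then show ?case using y0 by (simp add: a_def)
    next
      case (Suc t)
      then have d: "norm (y t - x t) \<le> a t * \<epsilon>" by simp
      also have "\<dots> \<le> C1 * \<epsilon>" unfolding C1_def using Suc.prems \<epsilon>pos by (intro mult_right_mono a_mono) auto
      finally have "norm (y t - x t) \<le> 1" using C1\<epsilon> by linarith
      from lipxy[OF this] have l: "norm (w t 0 - v t 0) \<le> L * norm (y t - x t)" .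
      have "y (Suc t) - x (Suc t) = (y (Suc t) - pre_loop (y t) (w t) 1)
          + (F *v (y t - x t) + B *v (w t 0 - v t 0))"
        unfolding xS pre_loop_1 by (simp add: vec.diff)
      then have 1: "norm (y (Suc t) - x (Suc t)) \<le> norm (y (Suc t) - pre_loop (y t) (w t) 1)
          + norm (F *v (y t - x t) + B *v (w t 0 - v t 0))"
        using norm_triangle_ineq by metis
      have 2: "norm (F *v (y t - x t) + B *v (w t 0 - v t 0))
          \<le> (onorm ((*v) F) * 1 + onorm ((*v) B) * L) * norm (y t - x t)"
        by (rule norm_two_matrices_le) (use l in auto)
      have 3: "(onorm ((*v) F) * 1 + onorm ((*v) B) * L) * norm (y t - x t) \<le> G * norm (y t - x t)"
        unfolding G_def by (simp add: algebra_simps)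
      have "norm (y (Suc t) - x (Suc t)) \<le> c * \<epsilon> + G * norm (y t - x t)"
        using 1 2 3 yS[of t] by linarith
      also have "\<dots> \<le> c * \<epsilon> + G * (a t * \<epsilon>)" using d G by (simp add: mult_left_mono)
      also have "\<dots> = (G * a t + c) * \<epsilon>" by (simp add: algebra_simps)
      also have "\<dots> \<le> a (Suc t) * \<epsilon>" using a_step \<epsilon>pos by (intro mult_right_mono) auto
      finally show ?case .
    qed
    have xO: "x t \<in> Obar sys \<Delta>" if "t0 \<le> t" for t
      using xr[OF that] ballO r by (auto simp: subset_iff)
    have yO: "y t \<in> Obar sys \<Delta>" if "t0 \<le> t" "norm (y t - x t) \<le> C2 * \<epsilon>" for t
      using xr[OF that(1)] that(2) C2r norm_triangle_sub[of "y t" "x t"] ballO by (auto simp: subset_iff)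
    have late: "norm (y (t0 + k) - x (t0 + k)) \<le> C2 * \<epsilon>" for k
    proof (induction k rule: less_induct)
      case (less k)
      have "norm ((y (t0 + k) - x (t0 + k))) \<le> \<tau> * \<rho> ^ k * norm (y t0 - x t0) + \<kappa> * (c * \<epsilon>)"
      proof (rule stable_recursion[where d = "\<lambda>t. y t - x t"])
        fix t assume t: "t0 \<le> t" "t < t0 + k"
        then have "norm (y t - x t) \<le> C2 * \<epsilon>" using less[of "t - t0"] by simp
        then have "w t 0 = 0" using yO[OF t(1)] opty pre_opt_Obar by blast
        moreover have "v t 0 = 0" using xO[OF t(1)] optx pre_opt_Obar by blast
        ultimately have "y (Suc t) - x (Suc t) - F *v (y t - x t) = y (Suc t) - pre_loop (y t) (w t) 1"
          unfolding xS pre_loop_1 by (simp add: vec.diff)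
        then show "norm (y (Suc t) - x (Suc t) - F *v (y t - x t)) \<le> c * \<epsilon>" using yS[of t] by (simp only:)
      qed (use c \<epsilon>pos in simp)
      also have "\<tau> * \<rho> ^ k * norm (y t0 - x t0) \<le> \<tau> * 1 * (C1 * \<epsilon>)"
        using early[of t0] tau_pos rho_nonneg rho_less_1 unfolding C1_def
        by (intro mult_mono) (auto intro: power_le_one)
      finally show ?case unfolding C2_def by (simp add: algebra_simps)
    qed
    have both: "norm (y t - x t) \<le> C1 * \<epsilon> \<or> norm (y t - x t) \<le> C2 * \<epsilon>" for t
    proof (cases "t \<le> t0")
      case True
      then have "a t * \<epsilon> \<le> C1 * \<epsilon>" unfolding C1_def using \<epsilon>pos by (intro mult_right_mono a_mono) auto
      then show ?thesis using early[OF True] by linarith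
    next
      case False then show ?thesis using late[of "t - t0"] by simp
    qed
    have one: "norm (y t - x t) \<le> 1" for t using both[of t] C1\<epsilon> C2\<epsilon> by linarith
    have "norm (y t - x t) \<le> C * \<epsilon>" for t
      using both[of t] mult_right_mono[OF CC(1), of \<epsilon>] mult_right_mono[OF CC(2), of \<epsilon>] \<epsilon>pos by linarith
    moreover have "norm (w t 0 - v t 0) \<le> C * \<epsilon>" for t
    proof -
      have "L * norm (y t - x t) \<le> L * C1 * \<epsilon> \<or> L * norm (y t - x t) \<le> L * C2 * \<epsilon>"
        using both[of t] mult_left_mono[OF _ L, of "norm (y t - x t)"] by (simp add: mult.assoc) blast
      then show ?thesis
        using lipxy[OF one[of t]] mult_right_mono[OF CL(1), of \<epsilon>] mult_right_mono[OF CL(2), of \<epsilon>] \<epsilon>pos by linarith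
    qed
    moreover have "y t \<in> Obar sys \<Delta>" if "t0 \<le> t" for t
      using yO[OF that] late[of "t - t0"] that by simp
    ultimately show ?thesis using xR xO by simp
  qed
  show ?thesis
    by (rule exI[of _ C], rule conjI[OF C], rule exI[of _ t0], rule exI[of _ R], rule exI[of _ \<epsilon>1],
        rule conjI[OF \<epsilon>1_pos]) (intro allI impI, rule claim)
qed

section \<open>Regret of the learner\<close>

definition \<beta> :: real where "\<beta> = onorm ((*v) B)"

lemma beta_pos: "0 < \<beta>"
proof -
  have "(*v) B \<noteq> (\<lambda>_. 0)" using B_nonzero by (metis matrix_eq matrix_vector_mult_0)
  then show ?thesis
    unfolding \<beta>_def by (subst onorm_pos_lt) (auto simp: fun_eq_iff matrix_vector_mul_bounded_linear)
qed

lemma norm_B_le: "norm u \<le> e / \<beta> \<Longrightarrow> norm (B *v u) \<le> e"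
proof -
  assume "norm u \<le> e / \<beta>"
  then have "\<beta> * norm u \<le> e" using beta_pos by (simp add: field_simps)
  then show ?thesis using norm_matrix_vector_le[of B u] by (simp add: \<beta>_def)
qed

definition close_to_expert :: "real \<Rightarrow> (real ^ 'n) set \<Rightarrow> (nat \<Rightarrow> real ^ 'n \<Rightarrow> real ^ 'm) \<Rightarrow> nat \<Rightarrow> real ^ 'n \<Rightarrow>
    bool" where
  "close_to_expert \<epsilon> \<Delta> pol th x0 \<longleftrightarrow> (\<forall>t<th. norm (expert sys \<Delta> (closed_loop sys pol x0 t)
      - pol t (closed_loop sys pol x0 t)) \<le> \<epsilon> / \<beta>)"

lemma Xbar0_subset_domain: "tube \<epsilon> \<Delta> \<Longrightarrow> Xbar0 sys \<Delta> \<subseteq> rmpc_domain sys \<Delta>"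
  using rmpc_domainI[of _ \<Delta> 0] tube_0 by auto

lemma expert_step_disturbance:
  assumes "close_to_expert \<epsilon> \<Delta> pol th x0" "t < th"
  shows "norm (B *v (pol t (closed_loop sys pol x0 t) - expert sys \<Delta> (closed_loop sys pol x0 t))) \<le> \<epsilon>"
  using assms unfolding close_to_expert_def by (intro norm_B_le) (simp add: norm_minus_commute)

lemma closed_loop_disturbed_step:
  "closed_loop sys pol x0 (Suc t) = A *v closed_loop sys pol x0 t + B *v expert sys \<Delta> (closed_loop sys pol x0 t)
     + B *v (pol t (closed_loop sys pol x0 t) - expert sys \<Delta> (closed_loop sys pol x0 t))"
  by (simp add: vec.diff)

text \<open>A controller close to the expert is the expert with a disturbance \<open>B (pol - expert)\<close> of norm
  at most \<open>\<epsilon>\<close>, so it stays in the domain of the robust controller.\<close>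

lemma robust_closed_loop:
  assumes tube: "tube \<epsilon> \<Delta>" and x0: "x0 \<in> Xbar0 sys \<Delta>" and close: "close_to_expert \<epsilon> \<Delta> pol th x0"
  shows "t \<le> th \<Longrightarrow> closed_loop sys pol x0 t \<in> rmpc_domain sys \<Delta>"
proof (induction t)
  case 0 then show ?case using x0 Xbar0_subset_domain[OF tube] by auto
next
  case (Suc t)
  then have "closed_loop sys pol x0 t \<in> rmpc_domain sys \<Delta>" by simp
  from expert_spec[OF tube this] obtain v where v:
    "pre_opt \<Delta> (xbar0 sys \<Delta> (closed_loop sys pol x0 t)) v"
    "closed_loop sys pol x0 t - xbar0 sys \<Delta> (closed_loop sys pol x0 t) \<in> \<Delta>"
    "expert sys \<Delta> (closed_loop sys pol x0 t) = K *v closed_loop sys pol x0 t + v 0" by (elim exE conjE)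
  show ?case
    unfolding closed_loop_disturbed_step[where \<Delta> = \<Delta>]
    by (rule robust_step(2)[OF tube v expert_step_disturbance[OF close]]) (use Suc.prems in simp)
qed

text \<open>The same disturbance, continued by zero, is covered by the definition of \<open>reaching_time\<close>;
  the tube around the nominal state then lies in the terminal set.\<close>

lemma reaches_terminal_set:
  assumes tube: "tube \<epsilon> \<Delta>" and x0: "x0 \<in> Xbar0 sys \<Delta>" "x0 \<in> S"
    and close: "close_to_expert \<epsilon> \<Delta> pol th x0" and reach: "reaching_time sys \<Delta> (cball 0 \<epsilon>) S th"
  shows "closed_loop sys pol x0 th \<in> Obar sys \<Delta>"
proof -
  define w where "w t = (if t < th then B *v (pol t (closed_loop sys pol x0 t) - expert sys \<Delta> (closed_loop sys pol x0 t)) else 0)" for t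
  have w: "\<forall>t. w t \<in> cball 0 \<epsilon>"
    using expert_step_disturbance[OF close] tube by (auto simp: w_def tube_def)
  have "t \<le> th \<Longrightarrow> disturbed_loop sys (expert sys \<Delta>) w x0 t = closed_loop sys pol x0 t" for t
  proof (induction t)
    case (Suc t)
    then show ?case
      unfolding closed_loop_disturbed_step[where \<Delta> = \<Delta>] by (simp add: w_def)
  qed simp
  then have "xbar0 sys \<Delta> (closed_loop sys pol x0 th) \<in> Obar sys \<Delta> \<ominus>\<^sub>s \<Delta>"
    using reach x0(2) w unfolding reaching_time_def by (metis order_refl)
  moreover have "closed_loop sys pol x0 th - xbar0 sys \<Delta> (closed_loop sys pol x0 th) \<in> \<Delta>"
    using expert_spec[OF tube robust_closed_loop[OF tube x0(1) close order_refl]] by (elim exE conjE)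
  ultimately have "xbar0 sys \<Delta> (closed_loop sys pol x0 th)
      + (closed_loop sys pol x0 th - xbar0 sys \<Delta> (closed_loop sys pol x0 th)) \<in> Obar sys \<Delta>"
    unfolding set_erosion_def by blast
  then show ?thesis by simp
qed

lemma reference_is_run:
  assumes x0: "x0 \<in> Xbar0 sys \<Delta>"
  defines "x \<equiv> closed_loop sys (\<lambda>_. mpc_control sys \<Delta>) x0"
  shows "\<exists>v. mpc_run \<Delta> x v \<and> (\<forall>t. mpc_control sys \<Delta> (x t) = K *v x t + v t 0)"
proof -
  have step: "\<exists>v. pre_opt \<Delta> (x t) v \<and> mpc_control sys \<Delta> (x t) = K *v x t + v 0 \<and>
      x (Suc t) = pre_loop (x t) v 1"
    if xt: "x t \<in> Xbar0 sys \<Delta>" for t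
  proof -
    obtain v where v: "pre_opt \<Delta> (x t) v" "mpc_control sys \<Delta> (x t) = K *v x t + v 0"
      using mpc_control_spec[OF xt] by (elim exE conjE)
    have "x (Suc t) = pre_loop (x t) v 1"
      using v(2) unfolding x_def closed_loop.simps closed_loop_input pre_loop_1 by simp
    with v show ?thesis by blast
  qed
  have inX: "x t \<in> Xbar0 sys \<Delta>" for t
  proof (induction t)
    case 0 then show ?case using x0 by (simp add: x_def)
  next
    case (Suc t)
    then show ?case using step[OF Suc] pre_feasible_Xbar0_step unfolding pre_opt_def by metis
  qed
  have "\<forall>t. \<exists>v. pre_opt \<Delta> (x t) v \<and> mpc_control sys \<Delta> (x t) = K *v x t + v 0 \<and> x (Suc t) = pre_loop (x t) v 1"
    using step inX by blast
  from choice[OF this] show ?thesis unfolding mpc_run_def by blast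
qed

lemma closed_loop_switched:
  "t \<le> th \<Longrightarrow> closed_loop sys (switched_policy sys th pol) x0 t = closed_loop sys pol x0 t"
  by (induction t) (simp_all add: switched_policy_def)

lemma closed_loop_after_switch:
  "th \<le> t \<Longrightarrow> closed_loop sys (switched_policy sys th pol) x0 (Suc t) =
      F *v closed_loop sys (switched_policy sys th pol) x0 t"
  by (simp add: switched_policy_def lqr_control_def F_apply)

lemma closed_loop_after_switch_power:
  "closed_loop sys (switched_policy sys th pol) x0 (th + k) = ((*v) F ^^ k) (closed_loop sys pol x0 th)"
  by (induction k) (simp_all add: closed_loop_switched closed_loop_after_switch del: closed_loop.simps(2))

text \<open>Before the switch \<open>y\<close> is the nominal state chosen by the robust problem; after it, \<open>y\<close> is
  the learner's own state, where MPC and the LQR coincide.\<close>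

lemma learner_tracks:
  assumes tube: "tube \<epsilon> \<Delta>" and x0: "x0 \<in> Xbar0 sys \<Delta>" and close: "close_to_expert \<epsilon> \<Delta> pol th x0"
    and sw: "closed_loop sys pol x0 th \<in> Obar sys \<Delta>"
  defines "x \<equiv> closed_loop sys (switched_policy sys th pol) x0"
  shows "\<exists>y w. \<forall>t. pre_opt \<Delta> (y t) (w t) \<and> norm (x t - y t) \<le> \<kappa> * \<epsilon> \<and>
    norm (switched_policy sys th pol t (x t) - K *v x t - w t 0) \<le> \<epsilon> / \<beta>"
proof -
  have \<epsilon>: "0 < \<epsilon>" using tube by (simp add: tube_def)
  have "\<exists>y w. pre_opt \<Delta> y w \<and> norm (x t - y) \<le> \<kappa> * \<epsilon> \<and>
    norm (switched_policy sys th pol t (x t) - K *v x t - w 0) \<le> \<epsilon> / \<beta>" for t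
  proof (cases "t < th")
    case True
    have xt: "x t = closed_loop sys pol x0 t" unfolding x_def using True by (simp add: closed_loop_switched)
    have "x t \<in> rmpc_domain sys \<Delta>"
      unfolding xt by (rule robust_closed_loop[OF tube x0 close]) (use True in simp)
    from expert_spec[OF tube this] obtain v where v: "pre_opt \<Delta> (xbar0 sys \<Delta> (x t)) v"
      "x t - xbar0 sys \<Delta> (x t) \<in> \<Delta>" "expert sys \<Delta> (x t) = K *v x t + v 0" by (elim exE conjE)
    have "norm (expert sys \<Delta> (x t) - pol t (x t)) \<le> \<epsilon> / \<beta>"
      using close True unfolding close_to_expert_def xt by blast
    then have "norm (switched_policy sys th pol t (x t) - K *v x t - v 0) \<le> \<epsilon> / \<beta>"
      using True unfolding v(3) switched_policy_def by (simp add: norm_minus_commute algebra_simps)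
    then show ?thesis using v(1) tube_norm[OF tube v(2)] by blast
  next
    case False
    then have xt: "x t = ((*v) F ^^ (t - th)) (closed_loop sys pol x0 th)"
      unfolding x_def using closed_loop_after_switch_power[of th pol x0 "t - th"] by simp
    have "((*v) F ^^ k) (closed_loop sys pol x0 th) \<in> Obar sys \<Delta>" for k
      by (induction k) (use sw Obar_step in simp_all)
    then have O: "x t \<in> Obar sys \<Delta>" unfolding xt .
    then obtain w where w: "pre_opt \<Delta> (x t) w" using mpc_control_spec[of "x t" \<Delta>] Obar_subset_Xbar0 by blast
    then have "w 0 = 0" using O by (rule pre_opt_Obar[rotated])
    then have "norm (switched_policy sys th pol t (x t) - K *v x t - w 0) \<le> \<epsilon> / \<beta>"
      using False \<epsilon> beta_pos by (simp add: switched_policy_def lqr_control_def)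
    then show ?thesis using w \<epsilon> kappa_pos by (intro exI[of _ "x t"] exI[of _ w]) simp
  qed
  then have "\<forall>t. \<exists>p. pre_opt \<Delta> (fst p) (snd p) \<and> norm (x t - fst p) \<le> \<kappa> * \<epsilon> \<and>
    norm (switched_policy sys th pol t (x t) - K *v x t - snd p 0) \<le> \<epsilon> / \<beta>" by simp
  from choice[OF this] obtain p where "\<forall>t. pre_opt \<Delta> (fst (p t)) (snd (p t)) \<and>
      norm (x t - fst (p t)) \<le> \<kappa> * \<epsilon> \<and>
    norm (switched_policy sys th pol t (x t) - K *v x t - snd (p t) 0) \<le> \<epsilon> / \<beta>" by (elim exE)
  then show ?thesis by (intro exI[of _ "\<lambda>t. fst (p t)"] exI[of _ "\<lambda>t. snd (p t)"])
qed

lemma form_diff_le: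
  fixes M :: "real ^ 'a ^ 'a"
  assumes "norm x \<le> r" "norm y \<le> r"
  shows "x \<bullet> (M *v x) - y \<bullet> (M *v y) \<le> 2 * r * onorm ((*v) M) * norm (x - y)"
proof -
  have "x \<bullet> (M *v x) - y \<bullet> (M *v y) = x \<bullet> (M *v (x - y)) + (x - y) \<bullet> (M *v y)"
    by (simp add: vec.diff inner_diff_left inner_diff_right)
  moreover have "x \<bullet> (M *v (x - y)) \<le> onorm ((*v) M) * (r * norm (x - y))"
    using assms(1) onorm_matrix_nonneg[of M]
      by (intro order_trans[OF form_le_onorm] mult_left_mono mult_right_mono) auto
  moreover have "(x - y) \<bullet> (M *v y) \<le> onorm ((*v) M) * (norm (x - y) * r)"
    using assms(2) onorm_matrix_nonneg[of M] by (intro order_trans[OF form_le_onorm] mult_left_mono) auto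
  ultimately show ?thesis by (simp add: algebra_simps)
qed

lemma stage_cost_diff_le:
  assumes "norm x \<le> r" "norm y \<le> r" "norm u \<le> s" "norm w \<le> s" "norm (x - y) \<le> d" "norm (u - w) \<le> e"
  shows "stage_cost sys x u - stage_cost sys y w
    \<le> 2 * r * onorm ((*v) (Qmat sys)) * d + 2 * s * onorm ((*v) (Rmat sys)) * e"
proof -
  have r: "0 \<le> r" and s: "0 \<le> s" using assms(1,3) norm_ge_zero order_trans by blast+
  have "2 * r * onorm ((*v) (Qmat sys)) * norm (x - y) \<le> 2 * r * onorm ((*v) (Qmat sys)) * d"
    using r assms(5) onorm_matrix_nonneg[of "Qmat sys"] by (intro mult_left_mono) auto
  moreover have "2 * s * onorm ((*v) (Rmat sys)) * norm (u - w) \<le> 2 * s * onorm ((*v) (Rmat sys)) * e"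
    using s assms(6) onorm_matrix_nonneg[of "Rmat sys"] by (intro mult_left_mono) auto
  ultimately show ?thesis
    using form_diff_le[OF assms(1,2), of "Qmat sys"] form_diff_le[OF assms(3,4), of "Rmat sys"]
    unfolding stage_cost_def by linarith
qed

text \<open>With the errors of \<open>tracking_error\<close>, each stage cost differs from its reference value by
  \<open>C4 * \<epsilon>\<close> at most. After time \<open>h\<close> both loops are governed by \<open>F\<close>, and the differences decay
  geometrically.\<close>

lemma small_disturbance_regret:
  "\<exists>C\<ge>0. \<exists>\<epsilon>1>0. \<forall>\<epsilon> \<Delta> T th pol x0. tube \<epsilon> \<Delta> \<longrightarrow> \<epsilon> \<le> \<epsilon>1 \<longrightarrow> norm x0 \<le> R0 \<longrightarrow> x0 \<in> Xbar0 sys \<Delta> \<longrightarrow>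
     close_to_expert \<epsilon> \<Delta> pol th x0 \<longrightarrow> closed_loop sys pol x0 th \<in> Obar sys \<Delta> \<longrightarrow>
     total_cost sys (switched_policy sys th pol) T x0 - total_cost sys (\<lambda>_. mpc_control sys \<Delta>) T x0
       \<le> C * (1 + real th) * \<epsilon>"
proof -
  define fF where "fF = onorm ((*v) F)"
  define fK where "fK = onorm ((*v) K)"
  define fQ where "fQ = onorm ((*v) (Qmat sys))"
  define fR where "fR = onorm ((*v) (Rmat sys))"
  have f0: "0 \<le> fF" "0 \<le> fK" "0 \<le> fQ" "0 \<le> fR"
    unfolding fF_def fK_def fQ_def fR_def by (rule onorm_matrix_nonneg)+
  \<comment> \<open>errors per step: position in the tube after the step, before the step, and the disturbance\<close>
  define c2 where "c2 = \<kappa> + (fF * \<kappa> + 1)"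
  have c2: "0 \<le> c2" unfolding c2_def using f0 kappa_pos by simp
  obtain C t0 R \<epsilon>a where C: "0 \<le> C" and \<epsilon>a: "0 < \<epsilon>a" and track: "\<forall>\<epsilon> \<Delta> x v y w. tube \<epsilon> \<Delta> \<longrightarrow> \<epsilon> \<le> \<epsilon>a \<longrightarrow>
      mpc_run \<Delta> x v \<longrightarrow>
     norm (x 0) \<le> R0 \<longrightarrow> tracks (\<kappa> * \<epsilon>) (c2 * \<epsilon>) \<Delta> x y w \<longrightarrow>
     (\<forall>t. norm (x t) \<le> R \<and> norm (y t - x t) \<le> C * \<epsilon> \<and> norm (w t 0 - v t 0) \<le> C * \<epsilon>) \<and>
     (\<forall>t\<ge>t0. x t \<in> Obar sys \<Delta> \<and> y t \<in> Obar sys \<Delta>)"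
    using tracking_error[OF c2, of R0] by (elim exE conjE)
  obtain b where b: "0 \<le> b" "\<And>u. u \<in> Uset sys \<Longrightarrow> norm u \<le> b" using U_norm_bound by blast
  define E1 where "E1 = \<kappa> + C"
  define E2 where "E2 = 1 / \<beta> + fK * E1 + C"
  have E1: "0 \<le> E1" unfolding E1_def using C kappa_pos by simp
  have E2: "0 \<le> E2" unfolding E2_def using C E1 f0 beta_pos by simp
  define r where "r = \<bar>R\<bar> + E1"
  define s where "s = b + E2"
  have rs: "0 \<le> r" "0 \<le> s" unfolding r_def s_def using E1 E2 b by simp_all
  define C4 where "C4 = 2 * r * fQ * E1 + 2 * s * fR * E2"
  define C5 where "C5 = 2 * r * fQ * (\<tau> * E1) + 2 * s * fR * (fK * (\<tau> * E1))"
  have C45: "0 \<le> C4" "0 \<le> C5" unfolding C4_def C5_def using rs f0 E1 E2 tau_pos by simp_all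
  define D where "D = real (t0 + 1) * C4 + C5 / (1 - \<rho>)"
  have D: "0 \<le> D" unfolding D_def using C45 rho_less_1 by simp
  define \<epsilon>1 where "\<epsilon>1 = min \<epsilon>a 1"
  have \<epsilon>1: "0 < \<epsilon>1" unfolding \<epsilon>1_def using \<epsilon>a by simp
  have claim: "total_cost sys (switched_policy sys th pol) T x0 - total_cost sys (\<lambda>_. mpc_control sys \<Delta>) T x0
       \<le> D * (1 + real th) * \<epsilon>"
    if tube: "tube \<epsilon> \<Delta>" and \<epsilon>: "\<epsilon> \<le> \<epsilon>1" and nx0: "norm x0 \<le> R0" and x0: "x0 \<in> Xbar0 sys \<Delta>"
      and close: "close_to_expert \<epsilon> \<Delta> pol th x0" and sw: "closed_loop sys pol x0 th \<in> Obar sys \<Delta>"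
    for \<epsilon> \<Delta> T th pol x0
  proof -
    have \<epsilon>pos: "0 < \<epsilon>" using tube by (simp add: tube_def)
    have \<epsilon>le: "\<epsilon> \<le> \<epsilon>a" "\<epsilon> \<le> 1" using \<epsilon> by (simp_all add: \<epsilon>1_def)
    define x where "x = closed_loop sys (switched_policy sys th pol) x0"
    define u where "u t = switched_policy sys th pol t (x t)" for t
    define z where "z = closed_loop sys (\<lambda>_. mpc_control sys \<Delta>) x0"
    define q where "q t = mpc_control sys \<Delta> (z t)" for t
    obtain v where run: "mpc_run \<Delta> z v" and q: "\<And>t. q t = K *v z t + v t 0"
      using reference_is_run[OF x0] unfolding z_def[symmetric] q_def by (elim exE conjE) simp
    obtain y w where yw: "\<forall>t. pre_opt \<Delta> (y t) (w t) \<and> norm (x t - y t) \<le> \<kappa> * \<epsilon> \<and>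
        norm (u t - K *v x t - w t 0) \<le> \<epsilon> / \<beta>"
      using learner_tracks[OF tube x0 close sw] unfolding x_def[symmetric] u_def by (elim exE)
    have opty: "pre_opt \<Delta> (y t) (w t)" and xy: "norm (x t - y t) \<le> \<kappa> * \<epsilon>"
      and uw: "norm (u t - K *v x t - w t 0) \<le> \<epsilon> / \<beta>" for t using yw by simp_all
    have xS: "x (Suc t) = F *v x t + B *v (u t - K *v x t)" for t
      unfolding x_def u_def closed_loop.simps closed_loop_input ..
    have tr: "tracks (\<kappa> * \<epsilon>) (c2 * \<epsilon>) \<Delta> z y w"
      unfolding tracks_def
    proof (intro conjI allI opty)
      have "x 0 = x0" "z 0 = x0" by (simp_all add: x_def z_def)
      then show "norm (y 0 - z 0) \<le> \<kappa> * \<epsilon>" using xy[of 0] by (simp add: norm_minus_commute)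
      fix t
      have eq: "y (Suc t) - pre_loop (y t) (w t) 1 = (y (Suc t) - x (Suc t))
          + (F *v (x t - y t) + B *v (u t - K *v x t - w t 0))"
        unfolding xS pre_loop_1 by (simp add: vec.diff)
      have 1: "norm (F *v (x t - y t)) \<le> fF * (\<kappa> * \<epsilon>)"
        unfolding fF_def using xy onorm_matrix_nonneg[of F]
        by (intro order_trans[OF norm_matrix_vector_le] mult_left_mono)
      have 2: "norm (B *v (u t - K *v x t - w t 0)) \<le> \<epsilon>" by (rule norm_B_le[OF uw])
      have 3: "norm (y (Suc t) - x (Suc t)) \<le> \<kappa> * \<epsilon>" using xy by (simp add: norm_minus_commute)
      have "norm (y (Suc t) - pre_loop (y t) (w t) 1) \<le> \<kappa> * \<epsilon> + (fF * (\<kappa> * \<epsilon>) + \<epsilon>)"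
        unfolding eq by (intro order_trans[OF norm_triangle_ineq] add_mono 1 2 3)
      then show "norm (y (Suc t) - pre_loop (y t) (w t) 1) \<le> c2 * \<epsilon>"
        unfolding c2_def by (simp add: algebra_simps)
    qed
    have "norm (z 0) \<le> R0" using nx0 by (simp add: z_def)
    note T = track[rule_format, OF tube \<epsilon>le(1) run this tr]
    have zR: "norm (z t) \<le> R" and yz: "norm (y t - z t) \<le> C * \<epsilon>" and wv: "norm (w t 0 - v t 0) \<le> C * \<epsilon>"
      and zO: "t0 \<le> t \<Longrightarrow> z t \<in> Obar sys \<Delta>" for t
      using T by simp_all
    have xz: "norm (x t - z t) \<le> E1 * \<epsilon>" for t
      using norm_triangle_ineq[of "x t - y t" "y t - z t"] xy[of t] yz[of t] unfolding E1_def
        by (simp add: algebra_simps)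
    have uq: "norm (u t - q t) \<le> E2 * \<epsilon>" for t
    proof -
      have eq: "u t - q t = (u t - K *v x t - w t 0) + (K *v (x t - z t) + (w t 0 - v t 0))"
        unfolding q by (simp add: vec.diff)
      have "norm (K *v (x t - z t)) \<le> fK * (E1 * \<epsilon>)"
        unfolding fK_def using xz onorm_matrix_nonneg[of K]
        by (intro order_trans[OF norm_matrix_vector_le] mult_left_mono)
      then have "norm (u t - q t) \<le> \<epsilon> / \<beta> + (fK * (E1 * \<epsilon>) + C * \<epsilon>)"
        unfolding eq by (intro order_trans[OF norm_triangle_ineq] add_mono uw wv)
      then show ?thesis unfolding E2_def by (simp add: algebra_simps)
    qed
    have E\<epsilon>: "E1 * \<epsilon> \<le> E1" "E2 * \<epsilon> \<le> E2"
      using mult_left_mono[OF \<epsilon>le(2) E1] mult_left_mono[OF \<epsilon>le(2) E2] by simp_all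
    have qb: "norm (q t) \<le> b" for t
    proof -
      have "pre_feasible \<Delta> (z t) (v t)" using run by (simp add: mpc_run_def pre_opt_def)
      then have "pre_input (z t) (v t) 0 \<in> Uset sys" using Ubar_subset[of \<Delta>] unfolding pre_feasible_def by blast
      moreover have "pre_input (z t) (v t) 0 = q t" using N_pos by (simp add: pre_input_def cut_def q)
      ultimately show ?thesis using b(2) by simp
    qed
    have nx: "norm (x t) \<le> r" "norm (z t) \<le> r" "norm (u t) \<le> s" "norm (q t) \<le> s" for t
    proof -
      show "norm (z t) \<le> r" "norm (q t) \<le> s" using zR[of t] qb[of t] E1 E2 by (simp_all add: r_def s_def)
      show "norm (x t) \<le> r"
        using norm_triangle_sub[of "x t" "z t"] zR[of t] xz[of t] E\<epsilon> unfolding r_def by linarith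
      show "norm (u t) \<le> s"
        using norm_triangle_sub[of "u t" "q t"] qb[of t] uq[of t] E\<epsilon> unfolding s_def by linarith
    qed
    define h where "h = max t0 th"
    have zL: "z (Suc t) = F *v z t \<and> q t = K *v z t" if "t0 \<le> t" for t
    proof -
      have "v t 0 = 0" using pre_opt_Obar[OF zO[OF that]] run unfolding mpc_run_def by blast
      then show ?thesis using run pre_loop_1[of "z t" "v t"] q by (simp add: mpc_run_def)
    qed
    have xL: "x (Suc t) = F *v x t \<and> u t = K *v x t" if "th \<le> t" for t
      using closed_loop_after_switch[OF that] that unfolding x_def u_def
      by (simp add: switched_policy_def lqr_control_def del: closed_loop.simps(2))
    have tail: "x (h + k) - z (h + k) = ((*v) F ^^ k) (x h - z h)" for k
    proof (induction k)
      case (Suc k)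
      have "x (Suc (h + k)) - z (Suc (h + k)) = F *v (x (h + k) - z (h + k))"
        using zL[of "h + k"] xL[of "h + k"] by (simp add: h_def vec.diff)
      then show ?case using Suc by simp
    qed simp
    define g where "g t = stage_cost sys (x t) (u t) - stage_cost sys (z t) (q t)" for t
    have g1: "g t \<le> C4 * \<epsilon>" for t
      using stage_cost_diff_le[OF nx xz uq, of t] unfolding g_def C4_def fQ_def fR_def
        by (simp add: algebra_simps)
    have g2: "g (h + k) \<le> C5 * \<rho> ^ k * \<epsilon>" for k
    proof -
      have 1: "norm (x (h + k) - z (h + k)) \<le> \<tau> * \<rho> ^ k * (E1 * \<epsilon>)"
        unfolding tail using tau_pos rho_nonneg xz
        by (intro order_trans[OF norm_F_power] mult_left_mono) auto
      have "u (h + k) - q (h + k) = K *v (x (h + k) - z (h + k))"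
        using zL[of "h + k"] xL[of "h + k"] by (simp add: h_def vec.diff)
      then have "norm (u (h + k) - q (h + k)) \<le> fK * norm (x (h + k) - z (h + k))"
        unfolding fK_def by (simp add: norm_matrix_vector_le)
      then have 2: "norm (u (h + k) - q (h + k)) \<le> fK * (\<tau> * \<rho> ^ k * (E1 * \<epsilon>))"
        using mult_left_mono[OF 1 f0(2)] by linarith
      show ?thesis
        using stage_cost_diff_le[OF nx 1 2] unfolding g_def C5_def fQ_def fR_def by (simp add: algebra_simps)
    qed
    have "(\<Sum>t<T. g t) \<le> (\<Sum>t<h + T. if t < h then C4 * \<epsilon> else C5 * \<rho> ^ (t - h) * \<epsilon>)"
    proof -
      have "(\<Sum>t<T. g t) \<le> (\<Sum>t<T. if t < h then C4 * \<epsilon> else C5 * \<rho> ^ (t - h) * \<epsilon>)"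
      proof (rule sum_mono)
        fix t
        show "g t \<le> (if t < h then C4 * \<epsilon> else C5 * \<rho> ^ (t - h) * \<epsilon>)"
          using g1[of t] g2[of "t - h"] by (cases "t < h") auto
      qed
      also have "\<dots> \<le> (\<Sum>t<h + T. if t < h then C4 * \<epsilon> else C5 * \<rho> ^ (t - h) * \<epsilon>)"
        using C45 \<epsilon>pos rho_nonneg by (intro sum_mono2) auto
      finally show ?thesis .
    qed
    also have "\<dots> = real h * (C4 * \<epsilon>) + (\<Sum>k<T. C5 * \<rho> ^ k * \<epsilon>)"
    proof -
      have "(\<Sum>t<h + n. if t < h then C4 * \<epsilon> else C5 * \<rho> ^ (t - h) * \<epsilon>) =
          real h * (C4 * \<epsilon>) + (\<Sum>k<n. C5 * \<rho> ^ k * \<epsilon>)" for n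
        by (induction n) simp_all
      then show ?thesis .
    qed
    also have "(\<Sum>k<T. C5 * \<rho> ^ k * \<epsilon>) = (C5 * \<epsilon>) * (\<Sum>k<T. \<rho> ^ k)" by (simp add: sum_distrib_left mult_ac)
    also have "\<dots> \<le> (C5 * \<epsilon>) * (1 / (1 - \<rho>))"
      using geometric_sum_le C45 \<epsilon>pos by (intro mult_left_mono) auto
    finally have sum: "(\<Sum>t<T. g t) \<le> real h * (C4 * \<epsilon>) + (C5 * \<epsilon>) * (1 / (1 - \<rho>))" by simp
    have "real h \<le> real t0 + real th" unfolding h_def by simp
    then have "real h \<le> real (t0 + 1) * (1 + real th)"
    proof -
      have "0 \<le> real t0 * real th" by simp
      moreover have "real (t0 + 1) * (1 + real th) = 1 + real t0 + real th + real t0 * real th"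
        by (simp add: algebra_simps)
      ultimately show ?thesis using \<open>real h \<le> real t0 + real th\<close> by linarith
    qed
    then have "real h * (C4 * \<epsilon>) \<le> real (t0 + 1) * (1 + real th) * (C4 * \<epsilon>)"
      using C45 \<epsilon>pos by (intro mult_right_mono) auto
    moreover have "(C5 * \<epsilon>) * (1 / (1 - \<rho>)) * 1 \<le> (C5 * \<epsilon>) * (1 / (1 - \<rho>)) * (1 + real th)"
      using C45 \<epsilon>pos rho_less_1 by (intro mult_left_mono) auto
    moreover have "real (t0 + 1) * (1 + real th) * (C4 * \<epsilon>) + (C5 * \<epsilon>) * (1 / (1 - \<rho>)) * (1 + real th)
        = D * (1 + real th) * \<epsilon>"
      unfolding D_def by (simp add: algebra_simps add_divide_distrib)
    ultimately have "(\<Sum>t<T. g t) \<le> D * (1 + real th) * \<epsilon>" using sum by linarith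
    moreover have "(\<Sum>t<T. g t) = total_cost sys (switched_policy sys th pol) T x0
        - total_cost sys (\<lambda>_. mpc_control sys \<Delta>) T x0"
      unfolding total_cost_def g_def sum_subtractf u_def q_def x_def z_def ..
    ultimately show ?thesis by simp
  qed
  show ?thesis
    by (rule exI[of _ D], rule conjI[OF D], rule exI[of _ \<epsilon>1], rule conjI[OF \<epsilon>1]) (intro allI impI, rule claim)
qed

text \<open>The optimal value of the robust problem does not increase along the closed loop, and it
  dominates \<open>z \<bullet> P z\<close> at the nominal state \<open>z\<close>.\<close>

lemma robust_state_bound:
  "\<exists>R. \<forall>\<epsilon> \<Delta> th pol x0. tube \<epsilon> \<Delta> \<longrightarrow> \<epsilon> < 1 \<longrightarrow> norm x0 \<le> R0 \<longrightarrow> x0 \<in> Xbar0 sys \<Delta> \<longrightarrow>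
     close_to_expert \<epsilon> \<Delta> pol th x0 \<longrightarrow> (\<forall>t\<le>th. norm (closed_loop sys pol x0 t) \<le> R)"
proof -
  obtain E where E: "0 \<le> E" "\<forall>\<Delta> x v. norm x \<le> R0 \<longrightarrow> pre_feasible \<Delta> x v \<longrightarrow> excess v \<le> E"
    using excess_bound[of R0] by (elim exE conjE)
  obtain c where c: "0 < c" "\<And>u. c * (norm u)\<^sup>2 \<le> u \<bullet> (P *v u)"
    using pos_def_lower_bound[OF pos_def_P] by (elim exE conjE) simp
  define V where "V = onorm ((*v) P) * R0\<^sup>2 + E"
  define R where "R = sqrt (V / c) + \<kappa>"
  have claim: "\<forall>t\<le>th. norm (closed_loop sys pol x0 t) \<le> R"
    if tube: "tube \<epsilon> \<Delta>" and \<epsilon>: "\<epsilon> < 1" and nx0: "norm x0 \<le> R0" and x0: "x0 \<in> Xbar0 sys \<Delta>"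
      and close: "close_to_expert \<epsilon> \<Delta> pol th x0" for \<epsilon> \<Delta> th pol x0
  proof -
    define x where "x = closed_loop sys pol x0"
    define z where "z t = xbar0 sys \<Delta> (x t)" for t
    have ex: "\<exists>v. pre_opt \<Delta> (z t) v \<and> x t - z t \<in> \<Delta> \<and> expert sys \<Delta> (x t) = K *v x t + v 0 \<and>
      (\<forall>y w. x t - y \<in> \<Delta> \<longrightarrow> pre_feasible \<Delta> y w \<longrightarrow> z t \<bullet> (P *v z t) + excess v \<le> y \<bullet> (P *v y) + excess w)"
      if "t \<le> th" for t
      using expert_spec[OF tube robust_closed_loop[OF tube x0 close that]] unfolding x_def z_def .
    have descent: "\<exists>v. pre_opt \<Delta> (z t) v \<and> expert sys \<Delta> (x t) = K *v x t + v 0 \<and>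
        z t \<bullet> (P *v z t) + excess v \<le> V"
      if "t \<le> th" for t
      using that
    proof (induction t)
      case 0
      obtain v where v: "pre_opt \<Delta> (z 0) v" "expert sys \<Delta> (x 0) = K *v x 0 + v 0"
        "\<forall>y w. x 0 - y \<in> \<Delta> \<longrightarrow> pre_feasible \<Delta> y w \<longrightarrow> z 0 \<bullet> (P *v z 0) + excess v \<le> y \<bullet> (P *v y) + excess w"
        using ex[OF le0] by (elim exE conjE)
      obtain w where w: "pre_feasible \<Delta> x0 w" using x0 unfolding Xbar0_iff by (elim exE)
      have "z 0 \<bullet> (P *v z 0) + excess v \<le> x0 \<bullet> (P *v x0) + excess w"
        using v(3) w tube_0[OF tube] by (simp add: x_def)
      moreover have "x0 \<bullet> (P *v x0) \<le> onorm ((*v) P) * R0\<^sup>2" using nx0 by (rule form_sq_le)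
      moreover have "excess w \<le> E" using E(2) nx0 w by blast
      ultimately show ?case unfolding V_def by (intro exI[of _ v] conjI v(1,2)) linarith
    next
      case (Suc t)
      obtain v where v: "pre_opt \<Delta> (z t) v" "expert sys \<Delta> (x t) = K *v x t + v 0"
        and V: "z t \<bullet> (P *v z t) + excess v \<le> V" using Suc.IH[OF Suc_leD[OF Suc.prems]] by (elim exE conjE)
      have xz: "x t - z t \<in> \<Delta>" using ex[OF Suc_leD[OF Suc.prems]] by (elim exE conjE)
      obtain v' where v': "pre_opt \<Delta> (z (Suc t)) v'" "expert sys \<Delta> (x (Suc t)) = K *v x (Suc t) + v' 0"
        "\<forall>y w. x (Suc t) - y \<in> \<Delta> \<longrightarrow> pre_feasible \<Delta> y w \<longrightarrow>
          z (Suc t) \<bullet> (P *v z (Suc t)) + excess v' \<le> y \<bullet> (P *v y) + excess w"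
        using ex[OF Suc.prems] by (elim exE conjE)
      let ?y = "pre_loop (z t) v 1"
      have "x (Suc t) - ?y \<in> \<Delta>"
        unfolding x_def closed_loop_disturbed_step[where \<Delta> = \<Delta>]
        by (rule robust_step(1)[OF tube v(1)])
          (use xz v(2) expert_step_disturbance[OF close, of t] Suc.prems in \<open>simp_all add: x_def\<close>)
      moreover have "pre_feasible \<Delta> ?y (shift v)"
        by (rule pre_feasible_shift) (use v(1) in \<open>simp add: pre_opt_def\<close>)
      ultimately have "z (Suc t) \<bullet> (P *v z (Suc t)) + excess v' \<le> ?y \<bullet> (P *v ?y) + excess (shift v)"
        using v'(3) by blast
      also have "?y \<bullet> (P *v ?y) + excess (shift v) \<le> z t \<bullet> (P *v z t) + excess v"
      proof -
        have "?y = A *v z t + B *v (K *v z t + v 0)"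
          unfolding pre_loop_1 closed_loop_input by simp
        then show ?thesis
          using complete_square[of "z t" "K *v z t + v 0"] stage_cost_nonneg[of "z t" "K *v z t + v 0"]
          by (simp add: excess_shift)
      qed
      finally show ?case using V v'(1,2) by (intro exI[of _ v']) simp
    qed
    show ?thesis
    proof (intro allI impI)
      fix t assume t: "t \<le> th"
      obtain v where "z t \<bullet> (P *v z t) + excess v \<le> V" using descent[OF t] by (elim exE conjE)
      then have "c * (norm (z t))\<^sup>2 \<le> V" using c(2)[of "z t"] excess_nonneg[of v] by linarith
      then have "(norm (z t))\<^sup>2 \<le> V / c" using c(1) by (simp add: field_simps)
      then have "norm (z t) \<le> sqrt (V / c)" by (rule real_le_rsqrt)
      moreover have "norm (x t - z t) \<le> \<kappa> * \<epsilon>" using ex[OF t] tube_norm[OF tube] by blast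
      moreover have "\<kappa> * \<epsilon> \<le> \<kappa> * 1" using \<epsilon> kappa_pos by (intro mult_left_mono) auto
      ultimately show "norm (closed_loop sys pol x0 t) \<le> R"
        using norm_triangle_sub[of "x t" "z t"] unfolding R_def x_def[symmetric] by linarith
    qed
  qed
  show ?thesis by (rule exI[of _ R]) (intro allI impI claim)
qed

text \<open>Bounded states and inputs before the switch; afterwards the LQR cost telescopes to at most
  \<open>x \<bullet> P x\<close> at the switch.\<close>

lemma switched_cost_bound:
  "\<exists>C\<ge>0. \<forall>\<epsilon> \<Delta> T th pol x0. tube \<epsilon> \<Delta> \<longrightarrow> \<epsilon> < 1 \<longrightarrow> norm x0 \<le> R0 \<longrightarrow> x0 \<in> Xbar0 sys \<Delta> \<longrightarrow>
     close_to_expert \<epsilon> \<Delta> pol th x0 \<longrightarrow> (\<forall>t<th. \<forall>x. pol t x \<in> Uset sys) \<longrightarrow>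
     total_cost sys (switched_policy sys th pol) T x0 \<le> C * (1 + real th)"
proof -
  obtain R where R: "\<forall>\<epsilon> \<Delta> th pol x0. tube \<epsilon> \<Delta> \<longrightarrow> \<epsilon> < 1 \<longrightarrow> norm x0 \<le> R0 \<longrightarrow> x0 \<in> Xbar0 sys \<Delta> \<longrightarrow>
     close_to_expert \<epsilon> \<Delta> pol th x0 \<longrightarrow> (\<forall>t\<le>th. norm (closed_loop sys pol x0 t) \<le> R)"
    using robust_state_bound[of R0] by (elim exE)
  obtain b where b: "0 \<le> b" "\<And>u. u \<in> Uset sys \<Longrightarrow> norm u \<le> b" using U_norm_bound by blast
  define C1 where "C1 = onorm ((*v) (Qmat sys)) * R\<^sup>2 + onorm ((*v) (Rmat sys)) * b\<^sup>2"
  define C2 where "C2 = onorm ((*v) P) * R\<^sup>2"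
  have C12: "0 \<le> C1" "0 \<le> C2" unfolding C1_def C2_def by (simp_all add: onorm_matrix_nonneg)
  have claim: "total_cost sys (switched_policy sys th pol) T x0 \<le> (C1 + C2) * (1 + real th)"
    if tube: "tube \<epsilon> \<Delta>" and \<epsilon>: "\<epsilon> < 1" and nx0: "norm x0 \<le> R0" and x0: "x0 \<in> Xbar0 sys \<Delta>"
      and close: "close_to_expert \<epsilon> \<Delta> pol th x0" and U: "\<forall>t<th. \<forall>x. pol t x \<in> Uset sys" for \<epsilon> \<Delta> T th pol x0
  proof -
    have bd: "\<forall>t\<le>th. norm (closed_loop sys pol x0 t) \<le> R"
      using R tube \<epsilon> nx0 x0 close by blast
    define x where "x = closed_loop sys (switched_policy sys th pol) x0"
    define g where "g t = stage_cost sys (x t) (switched_policy sys th pol t (x t))" for t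
    have g_nonneg: "0 \<le> g t" for t unfolding g_def by (rule stage_cost_nonneg)
    have g1: "g t \<le> C1" if t: "t < th" for t
    proof -
      have "norm (x t) \<le> R" using bd t closed_loop_switched[of t th pol x0] by (simp add: x_def)
      moreover have "norm (switched_policy sys th pol t (x t)) \<le> b"
        using U b(2) t by (simp add: switched_policy_def)
      ultimately show ?thesis
        using form_sq_le[of "x t" R "Qmat sys"] form_sq_le[of "switched_policy sys th pol t (x t)" b "Rmat sys"]
        unfolding g_def stage_cost_def C1_def by linarith
    qed
    have g2: "(\<Sum>k<n. g (th + k)) = x th \<bullet> (P *v x th) - x (th + n) \<bullet> (P *v x (th + n))" for n
    proof (induction n)
      case (Suc n)
      have "x (Suc (th + n)) = F *v x (th + n)" unfolding x_def by (rule closed_loop_after_switch) simp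
      moreover have "g (th + n) = stage_cost sys (x (th + n)) (K *v x (th + n))"
        by (simp add: g_def switched_policy_def lqr_control_def)
      ultimately show ?case using Suc lqr_cost_step[of "x (th + n)"] by simp
    qed simp
    have "norm (x th) \<le> R" using bd closed_loop_switched[of th th pol x0] by (simp add: x_def)
    then have xth: "x th \<bullet> (P *v x th) \<le> C2" unfolding C2_def by (rule form_sq_le)
    have "total_cost sys (switched_policy sys th pol) T x0 = (\<Sum>t<T. g t)"
      by (simp add: total_cost_def g_def x_def)
    also have "\<dots> \<le> (\<Sum>t<th + T. g t)" using g_nonneg by (intro sum_mono2) auto
    also have "\<dots> = (\<Sum>t<th. g t) + (\<Sum>k<T. g (th + k))"
    proof -
      have "(\<Sum>t<th + n. g t) = (\<Sum>t<th. g t) + (\<Sum>k<n. g (th + k))" for n by (induction n) simp_all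
      then show ?thesis .
    qed
    also have "\<dots> \<le> real th * C1 + C2"
    proof -
      have "(\<Sum>t<th. g t) \<le> real th * C1" using sum_bounded_above[of "{..<th}" g C1] g1 by simp
      moreover have "(\<Sum>k<T. g (th + k)) \<le> C2" using g2[of T] xth P_nonneg[of "x (th + T)"] by linarith
      ultimately show ?thesis by linarith
    qed
    also have "\<dots> \<le> (C1 + C2) * (1 + real th)" using C12 by (simp add: algebra_simps)
    finally show ?thesis .
  qed
  have "0 \<le> C1 + C2" using C12 by simp
  then show ?thesis
    by (intro exI[of _ "C1 + C2"] conjI) (assumption, intro allI impI, rule claim)
qed

text \<open>For \<open>\<epsilon> > \<epsilon>1\<close> the factor \<open>C2 / \<epsilon>1\<close> turns a bound by \<open>C2 * (1 + th)\<close> into one proportional to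
  \<open>\<epsilon>\<close>.\<close>

theorem regret_bound:
  "\<exists>C. \<forall>\<epsilon> \<Delta> T th \<tau>s pol x0. tube \<epsilon> \<Delta> \<longrightarrow> \<epsilon> < 1 \<longrightarrow> norm x0 \<le> R0 \<longrightarrow> x0 \<in> Xbar0 sys \<Delta> \<longrightarrow>
     close_to_expert \<epsilon> \<Delta> pol th x0 \<longrightarrow> closed_loop sys pol x0 th \<in> Obar sys \<Delta> \<longrightarrow>
     (\<forall>t<th. \<forall>x. pol t x \<in> Uset sys) \<longrightarrow> th \<le> \<tau>s \<longrightarrow> 1 \<le> \<tau>s \<longrightarrow>
     total_cost sys (switched_policy sys th pol) T x0 - total_cost sys (\<lambda>_. mpc_control sys \<Delta>) T x0
       \<le> C * real \<tau>s * \<epsilon>"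
proof -
  obtain C1 \<epsilon>1 where C1: "0 \<le> C1" and \<epsilon>1: "0 < \<epsilon>1" and small: "\<forall>\<epsilon> \<Delta> T th pol x0. tube \<epsilon> \<Delta> \<longrightarrow> \<epsilon> \<le> \<epsilon>1 \<longrightarrow>
      norm x0 \<le> R0 \<longrightarrow> x0 \<in> Xbar0 sys \<Delta> \<longrightarrow>
     close_to_expert \<epsilon> \<Delta> pol th x0 \<longrightarrow> closed_loop sys pol x0 th \<in> Obar sys \<Delta> \<longrightarrow>
     total_cost sys (switched_policy sys th pol) T x0 - total_cost sys (\<lambda>_. mpc_control sys \<Delta>) T x0
       \<le> C1 * (1 + real th) * \<epsilon>"
    using small_disturbance_regret[of R0] by (elim exE conjE)
  obtain C2 where C2: "0 \<le> C2" and large: "\<forall>\<epsilon> \<Delta> T th pol x0. tube \<epsilon> \<Delta> \<longrightarrow> \<epsilon> < 1 \<longrightarrow> norm x0 \<le> R0 \<longrightarrow>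
      x0 \<in> Xbar0 sys \<Delta> \<longrightarrow>
     close_to_expert \<epsilon> \<Delta> pol th x0 \<longrightarrow> (\<forall>t<th. \<forall>x. pol t x \<in> Uset sys) \<longrightarrow>
     total_cost sys (switched_policy sys th pol) T x0 \<le> C2 * (1 + real th)"
    using switched_cost_bound[of R0] by (elim exE conjE)
  define C where "C = C1 + C2 / \<epsilon>1"
  have C: "0 \<le> C" "C1 \<le> C" "C2 / \<epsilon>1 \<le> C" using C1 C2 \<epsilon>1 by (simp_all add: C_def)
  have claim: "total_cost sys (switched_policy sys th pol) T x0 - total_cost sys (\<lambda>_. mpc_control sys \<Delta>) T x0
       \<le> (2 * C) * real \<tau>s * \<epsilon>"
    if tube: "tube \<epsilon> \<Delta>" and \<epsilon>: "\<epsilon> < 1" and nx0: "norm x0 \<le> R0" and x0: "x0 \<in> Xbar0 sys \<Delta>"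
      and close: "close_to_expert \<epsilon> \<Delta> pol th x0" and sw: "closed_loop sys pol x0 th \<in> Obar sys \<Delta>"
      and U: "\<forall>t<th. \<forall>x. pol t x \<in> Uset sys" and th: "th \<le> \<tau>s" "1 \<le> \<tau>s" for \<epsilon> \<Delta> T th \<tau>s pol x0
  proof -
    have \<epsilon>pos: "0 < \<epsilon>" using tube by (simp add: tube_def)
    have "total_cost sys (switched_policy sys th pol) T x0 - total_cost sys (\<lambda>_. mpc_control sys \<Delta>) T x0
        \<le> C * (1 + real th) * \<epsilon>"
    proof (cases "\<epsilon> \<le> \<epsilon>1")
      case True
      have "C1 * ((1 + real th) * \<epsilon>) \<le> C * ((1 + real th) * \<epsilon>)"
        using C(2) \<epsilon>pos by (intro mult_right_mono) auto
      then show ?thesis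
        using small[rule_format, OF tube True nx0 x0 close sw, of T]
        unfolding mult.assoc by linarith
    next
      case False
      have "C2 * (1 + real th) = (C2 / \<epsilon>1) * (1 + real th) * \<epsilon>1" using \<epsilon>1 by simp
      also have "\<dots> \<le> C * (1 + real th) * \<epsilon>"
        using C False \<epsilon>1 by (intro mult_mono) auto
      finally have "C2 * (1 + real th) \<le> C * (1 + real th) * \<epsilon>" .
      moreover have "0 \<le> total_cost sys (\<lambda>_. mpc_control sys \<Delta>) T x0"
        unfolding total_cost_def by (intro sum_nonneg stage_cost_nonneg)
      moreover have "total_cost sys (switched_policy sys th pol) T x0 \<le> C2 * (1 + real th)"
        using large tube \<epsilon> nx0 x0 close U by blast
      ultimately show ?thesis by linarith
    qed
    also have "\<dots> \<le> C * (2 * real \<tau>s) * \<epsilon>"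
      using th C(1) \<epsilon>pos by (intro mult_right_mono mult_left_mono) auto
    finally show ?thesis by (simp add: mult_ac)
  qed
  show ?thesis by (rule exI[of _ "2 * C"]) (intro allI impI, rule claim)
qed

end

section \<open>Supports and fresh samples\<close>

text \<open>The complement of the support is covered by the null sets of a countable basis.\<close>

lemma AE_measure_support:
  fixes D :: "'a::second_countable_topology measure"
  assumes "prob_space D" and sets: "sets D = sets borel"
  shows "AE x in D. x \<in> measure_support D"
proof -
  interpret prob_space D by fact
  obtain \<B> :: "'a set set" where \<B>: "countable \<B>" "topological_basis \<B>" using ex_countable_basis by blast
  let ?N = "{b \<in> \<B>. prob b = 0}"
  have "AE x in D. x \<notin> b" if b: "b \<in> ?N" for b
  proof (rule AE_I')
    have "b \<in> sets D" using b \<B> sets by (auto simp: topological_basis_open)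
    then show "b \<in> null_sets D" using b by (auto simp: emeasure_eq_measure)
  qed auto
  then have "AE x in D. \<forall>b\<in>?N. x \<notin> b"
    using \<B>(1) by (subst AE_ball_countable) (auto intro: countable_subset)
  then show ?thesis
  proof eventually_elim
    fix x assume x: "\<forall>b\<in>?N. x \<notin> b"
    have "0 < prob V" if V: "open V" "x \<in> V" for V
    proof -
      obtain b where b: "b \<in> \<B>" "x \<in> b" "b \<subseteq> V" using topological_basisE[OF \<B>(2) V] by metis
      have "prob b \<noteq> 0" using x b by auto
      then have "0 < prob b" using measure_nonneg[of D b] by linarith
      also have "prob b \<le> prob V" using b V sets by (intro finite_measure_mono) auto
      finally show ?thesis .
    qed
    then show "x \<in> measure_support D" unfolding measure_support_def by blast
  qed
qed

lemma measure_support_subset: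
  assumes "prob_space D" and sets: "sets D = sets borel" and C: "closed C" and AE: "AE x in D. x \<in> C"
  shows "measure_support D \<subseteq> C"
proof
  interpret prob_space D by fact
  fix x assume x: "x \<in> measure_support D"
  show "x \<in> C"
  proof (rule ccontr)
    assume "x \<notin> C"
    then have "0 < prob (- C)" using x C unfolding measure_support_def by (auto simp: open_Compl)
    moreover have "prob (- C) = 0"
      using AE C sets by (intro prob_eq_0[THEN iffD2]) (auto simp: borel_closed)
    ultimately show False by simp
  qed
qed

text \<open>An event determined by the coordinates in \<open>J\<close> is independent of the coordinates in \<open>H\<close>. That
  \<open>A\<close> is determined by \<open>J\<close> is expressed pointwise; fixing the other coordinates to an
  arbitrary \<open>c\<close> exhibits \<open>A\<close> as a measurable cylinder over \<open>J\<close>.\<close>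

lemma prob_fresh_coordinates:
  assumes D: "prob_space D" and fin: "finite I" and J: "J \<subseteq> I" and H: "H \<subseteq> I - J"
    and A: "A \<in> sets (PiM I (\<lambda>_. D))" and G: "G \<in> sets D"
    and dep: "\<And>\<omega> \<omega>'. \<omega> \<in> space (PiM I (\<lambda>_. D)) \<Longrightarrow> \<omega>' \<in> space (PiM I (\<lambda>_. D)) \<Longrightarrow>
        (\<forall>j\<in>J. \<omega> j = \<omega>' j) \<Longrightarrow> \<omega> \<in> A \<longleftrightarrow> \<omega>' \<in> A"
  shows "measure (PiM I (\<lambda>_. D)) (A \<inter> {\<omega> \<in> space (PiM I (\<lambda>_. D)). \<forall>i\<in>H. \<omega> i \<in> G})
    = measure (PiM I (\<lambda>_. D)) A * measure D G ^ card H"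
proof -
  interpret D: prob_space D by (rule D)
  interpret P: product_prob_space "\<lambda>_. D" UNIV by standard
  let ?I = "PiM I (\<lambda>_. D)" and ?J = "PiM J (\<lambda>_. D)" and ?C = "PiM (I - J) (\<lambda>_. D)"
  have fJ: "finite J" "finite (I - J)" using fin J finite_subset by auto
  have IJ: "J \<union> (I - J) = I" using J by auto
  interpret PC: prob_space ?C by (rule prob_space_PiM) (rule D)
  interpret PJ: prob_space ?J by (rule prob_space_PiM) (rule D)
  have distr: "distr (?J \<Otimes>\<^sub>M ?C) ?I (merge J (I - J)) = ?I"
    using P.distr_merge[of J "I - J"] fJ unfolding IJ by simp
  have meas: "merge J (I - J) \<in> measurable (?J \<Otimes>\<^sub>M ?C) ?I"
    using measurable_merge[of J "I - J" "\<lambda>_. D"] unfolding IJ .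
  obtain c where c: "c \<in> space ?C" using PC.not_empty by blast
  define A' where "A' = (\<lambda>y. merge J (I - J) (y, c)) -` A \<inter> space ?J"
  have A': "A' \<in> sets ?J"
    unfolding A'_def using measurable_Pair2'[OF c] meas A
      by (intro measurable_sets[OF measurable_compose]) auto
  define F' where "F' = PiE (I - J) (\<lambda>i. if i \<in> H then G else space D)"
  have F': "F' \<in> sets ?C" unfolding F'_def using fJ G by (intro sets_PiM_I_finite) auto
  have mem: "merge J (I - J) (y, z) \<in> space ?I" if "y \<in> space ?J" "z \<in> space ?C" for y z
    using measurable_space[OF meas] that by (auto simp: space_pair_measure)
  have kA: "merge J (I - J) (y, z) \<in> A \<longleftrightarrow> y \<in> A'" if "y \<in> space ?J" "z \<in> space ?C" for y z
  proof -
    have "merge J (I - J) (y, z) \<in> A \<longleftrightarrow> merge J (I - J) (y, c) \<in> A"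
      by (rule dep) (use mem that c in \<open>simp_all add: merge_def\<close>)
    then show ?thesis using that(1) by (simp add: A'_def)
  qed
  have kF: "merge J (I - J) (y, z) \<in> {\<omega> \<in> space ?I. \<forall>i\<in>H. \<omega> i \<in> G} \<longleftrightarrow> z \<in> F'"
    if "y \<in> space ?J" "z \<in> space ?C" for y z
  proof -
    have "merge J (I - J) (y, z) i = z i" if "i \<in> H" for i
      using that H by (auto simp: merge_def)
    then have "merge J (I - J) (y, z) \<in> {\<omega> \<in> space ?I. \<forall>i\<in>H. \<omega> i \<in> G} \<longleftrightarrow> (\<forall>i\<in>H. z i \<in> G)"
      using mem[OF that] by simp
    also have "\<dots> \<longleftrightarrow> z \<in> F'"
      using that(2) H unfolding F'_def space_PiM PiE_iff by (auto split: if_splits)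
    finally show ?thesis .
  qed
  have A'sub: "A' \<subseteq> space ?J" and F'sub: "F' \<subseteq> space ?C"
    using A' F' sets.sets_into_space by blast+
  have preA: "merge J (I - J) -` A \<inter> space (?J \<Otimes>\<^sub>M ?C) = A' \<times> space ?C"
    using kA A'sub by (auto simp: space_pair_measure)
  have preF: "merge J (I - J) -` (A \<inter> {\<omega> \<in> space ?I. \<forall>i\<in>H. \<omega> i \<in> G}) \<inter> space (?J \<Otimes>\<^sub>M ?C) = A' \<times> F'"
  proof (rule set_eqI)
    fix p :: "('b \<Rightarrow> 'a) \<times> ('b \<Rightarrow> 'a)"
    obtain y z where p: "p = (y, z)" by (cases p)
    show "p \<in> merge J (I - J) -` (A \<inter> {\<omega> \<in> space ?I. \<forall>i\<in>H. \<omega> i \<in> G}) \<inter> space (?J \<Otimes>\<^sub>M ?C) \<longleftrightarrow> p \<in> A' \<times> F'"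
    proof (cases "y \<in> space ?J \<and> z \<in> space ?C")
      case True
      then have yz: "y \<in> space ?J" "z \<in> space ?C" by simp_all
      have "merge J (I - J) (y, z) \<in> A \<inter> {\<omega> \<in> space ?I. \<forall>i\<in>H. \<omega> i \<in> G} \<longleftrightarrow> y \<in> A' \<and> z \<in> F'"
        unfolding Int_iff using kA[OF yz] kF[OF yz] by (rule arg_cong2[where f = "(\<and>)"])
      then show ?thesis
        using yz unfolding p vimage_eq Int_iff[of _ "_ -` _"] mem_Times_iff fst_conv snd_conv space_pair_measure
        by (simp only: simp_thms)
    next
      case False
      then have "\<not> (y \<in> A' \<and> z \<in> F')" using A'sub F'sub by (meson subsetD)
      moreover have "(y, z) \<notin> space (?J \<Otimes>\<^sub>M ?C)" using False by (simp add: space_pair_measure)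
      ultimately show ?thesis unfolding p Int_iff by simp
    qed
  qed
  have setF: "{\<omega> \<in> space ?I. \<forall>i\<in>H. \<omega> i \<in> G} \<in> sets ?I"
  proof -
    have "(\<lambda>\<omega>. \<omega> i) -` G \<inter> space ?I \<in> sets ?I" if "i \<in> H" for i
    proof -
      have "i \<in> I" using that H by blast
      then have "(\<lambda>\<omega>. \<omega> i) \<in> measurable ?I D" by (rule measurable_component_singleton)
      then show ?thesis using G by (rule measurable_sets)
    qed
    then have "{\<omega> \<in> space ?I. \<omega> i \<in> G} \<in> sets ?I" if "i \<in> H" for i
      using that by (simp add: vimage_def Int_def conj_commute)
    moreover have "finite H" using fin by (rule rev_finite_subset) (use H in blast)
    ultimately show ?thesis by (rule sets.sets_Collect_finite_All)
  qed
  have ev: "emeasure ?I X = emeasure (?J \<Otimes>\<^sub>M ?C) (merge J (I - J) -` X \<inter> space (?J \<Otimes>\<^sub>M ?C))" if "X \<in> sets ?I" for X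
    using emeasure_distr[OF meas that] unfolding distr .
  have eA: "emeasure ?I A = emeasure ?J A'"
    unfolding ev[OF A] preA using A'
      by (subst PC.emeasure_pair_measure_Times) (auto simp: PC.emeasure_space_1)
  have eF': "emeasure ?C F' = emeasure D G ^ card H"
  proof -
    have "emeasure ?C F' = (\<Prod>i\<in>I - J. emeasure D (if i \<in> H then G else space D))"
      unfolding F'_def using fJ G by (intro P.emeasure_PiM) auto
    also have "\<dots> = (\<Prod>i\<in>I - J. if i \<in> H then emeasure D G else 1)"
      by (intro prod.cong) (auto simp: D.emeasure_space_1)
    also have "\<dots> = emeasure D G ^ card H"
      using fJ H by (subst prod.inter_restrict[symmetric]) (auto simp: Int_absorb1)
    finally show ?thesis .
  qed
  have "emeasure ?I (A \<inter> {\<omega> \<in> space ?I. \<forall>i\<in>H. \<omega> i \<in> G}) = emeasure ?J A' * emeasure ?C F'"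
    unfolding ev[OF sets.Int[OF A setF]] preF using A' F' by (subst PC.emeasure_pair_measure_Times) auto
  also have "\<dots> = emeasure ?I A * emeasure D G ^ card H" unfolding eA eF' ..
  finally show ?thesis
    unfolding measure_def[of ?I] D.emeasure_eq_measure by (simp add: enn2real_mult ennreal_power)
qed

section \<open>Bad events of the training\<close>

lemma closed_loop_cong:
  "(\<And>s. s < t \<Longrightarrow> q s = q' s) \<Longrightarrow> closed_loop sys q x t = closed_loop sys q' x t"
  by (induction t) simp_all

lemma measurable_closed_loop:
  fixes sys :: "('n::finite, 'm::finite) mpc_system"
  assumes "\<And>s. s < t \<Longrightarrow> q s \<in> borel_measurable borel"
  shows "(\<lambda>x. closed_loop sys q x t) \<in> borel_measurable borel"
  using assms
proof (induction t)
  case (Suc t)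
  have lin: "(*v) M \<in> borel_measurable borel" for M :: "real ^ 'a ^ 'b"
    by (intro borel_measurable_continuous_onI matrix_vector_mult_linear_continuous_on)
  have x: "(\<lambda>x. closed_loop sys q x t) \<in> borel_measurable borel" using Suc by simp
  have "(\<lambda>x. q t (closed_loop sys q x t)) \<in> borel_measurable borel"
    by (rule measurable_compose[OF x]) (use Suc.prems in simp)
  with x show ?case
    unfolding closed_loop.simps by (intro borel_measurable_add measurable_compose[OF _ lin])
qed simp

text \<open>Forward-Switch with an arbitrary Borel set \<open>Z\<close> as target of the tests and an arbitrary
  expert of the class.\<close>

locale forward_switch =
  fixes sys :: "('n::finite, 'm::finite) mpc_system" and Z :: "(real ^ 'n) set" and D :: "(real ^ 'n) measure"
    and pstar :: "real ^ 'n \<Rightarrow> real ^ 'm" and Pols :: "(real ^ 'n \<Rightarrow> real ^ 'm) set" and n T l :: nat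
    and pihat :: "(sample_label \<Rightarrow> real ^ 'n) \<Rightarrow> nat \<Rightarrow> real ^ 'n \<Rightarrow> real ^ 'm"
  assumes D: "prob_space D" and sets_D: "sets D = sets borel"
    and finite_Pols: "finite Pols" and pstar: "pstar \<in> Pols"
    and Pols_measurable: "p \<in> Pols \<Longrightarrow> p \<in> borel_measurable borel"
    and Z: "Z \<in> sets borel" and T: "1 \<le> T"
    and run: "forward_switch_run sys Z D pstar Pols n T l pihat"
begin

sublocale D: prob_space D by (rule D)

abbreviation "\<Omega> \<equiv> training_space D n T l"
abbreviation "L \<equiv> sample_labels n T l"

lemma run_minimises:
    "\<lbrakk>\<omega> \<in> space \<Omega>; t < stop_time sys Z T l \<omega> (pihat \<omega>)\<rbrakk> \<Longrightarrow>
       is_arg_min (empirical_loss sys pstar n \<omega> (pihat \<omega>) t) (\<lambda>p. p \<in> Pols) (pihat \<omega> t)"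
  and run_adapted:
    "\<lbrakk>t < T; \<omega> \<in> space \<Omega>; \<omega>' \<in> space \<Omega>; \<forall>j\<in>seen_labels n T l t. \<omega> j = \<omega>' j\<rbrakk> \<Longrightarrow> pihat \<omega> t = pihat \<omega>' t"
  and run_measurable: "\<lbrakk>t < T; p \<in> Pols\<rbrakk> \<Longrightarrow> {\<omega> \<in> space \<Omega>. pihat \<omega> t = p} \<in> sets \<Omega>"
  using run unfolding forward_switch_run_def Let_def by (elim conjE, simp only:)+

lemma space_D: "space D = UNIV"
  using sets_eq_imp_space_eq[OF sets_D] by simp

lemma finite_L: "finite L"
proof -
  have "L \<subseteq> (\<lambda>(t, i). Train t i) ` (SIGMA t:{..<T}. {..<num_train n t}) \<union> (\<lambda>(t, i). Test t i) ` ({..T} \<times> {..<l})"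
    unfolding sample_labels_def by (auto simp: image_iff)
  then show ?thesis by (rule finite_subset) simp
qed

sublocale \<Omega>: prob_space \<Omega>
  unfolding training_space_def by (rule prob_space_PiM) (rule D)

text \<open>Both the training samples and the test samples of index \<open>t\<close> are fresh relative to this set.\<close>

definition past :: "nat \<Rightarrow> sample_label set" where
  "past t = L \<inter> ({Train s i | s i. s < t} \<union> {Test s i | s i. s < t})"

text \<open>The possible values of the first \<open>t\<close> learned controllers, extensional so that there are
  finitely many.\<close>

definition tuples :: "nat \<Rightarrow> (nat \<Rightarrow> real ^ 'n \<Rightarrow> real ^ 'm) set" where
  "tuples t = PiE {..<t} (\<lambda>_. Pols)"

definition learned :: "(nat \<Rightarrow> real ^ 'n \<Rightarrow> real ^ 'm) \<Rightarrow> nat \<Rightarrow> (sample_label \<Rightarrow> real ^ 'n) set" where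
  "learned q t = {\<omega> \<in> space \<Omega>. \<forall>s\<in>{..<t}. pihat \<omega> s = q s}"

lemma finite_tuples: "finite (tuples t)"
  unfolding tuples_def using finite_Pols by (intro finite_PiE) auto

lemma tuples_Pols: "q \<in> tuples t \<Longrightarrow> s < t \<Longrightarrow> q s \<in> Pols"
  unfolding tuples_def by auto

lemma tuples_loop_measurable: "q \<in> tuples t \<Longrightarrow> (\<lambda>x. closed_loop sys q x t) \<in> borel_measurable borel"
  using tuples_Pols Pols_measurable by (intro measurable_closed_loop) blast

lemma sets_learned:
  assumes "t \<le> T" "q \<in> tuples t"
  shows "learned q t \<in> sets \<Omega>"
  unfolding learned_def
proof (rule sets.sets_Collect_finite_All)
  fix s assume "s \<in> {..<t}"
  then have "s < T" "q s \<in> Pols" using assms(1) tuples_Pols[OF assms(2), of s] by auto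
  then show "{\<omega> \<in> space \<Omega>. pihat \<omega> s = q s} \<in> sets \<Omega>"
    by (rule run_measurable)
qed simp

lemma learned_depends_on_past:
  assumes "t \<le> T" "\<omega> \<in> space \<Omega>" "\<omega>' \<in> space \<Omega>" "\<forall>j\<in>past t. \<omega> j = \<omega>' j"
  shows "\<omega> \<in> learned q t \<longleftrightarrow> \<omega>' \<in> learned q t"
proof -
  have "pihat \<omega> s = pihat \<omega>' s" if s: "s < t" for s
  proof -
    have "seen_labels n T l s \<subseteq> past t"
      unfolding seen_labels_def past_def
      by (intro Int_mono Un_mono Collect_mono order_refl impI; elim exE conjE; hypsubst; use s in simp)
    then have "\<forall>j\<in>seen_labels n T l s. \<omega> j = \<omega>' j" using assms(4) by blast
    moreover have "s < T" using s assms(1) by simp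
    ultimately show ?thesis by (intro run_adapted assms(2,3))
  qed
  then have "(\<forall>s\<in>{..<t}. pihat \<omega> s = q s) \<longleftrightarrow> (\<forall>s\<in>{..<t}. pihat \<omega>' s = q s)"
    by (intro ball_cong) simp_all
  then show ?thesis using assms(2,3) unfolding learned_def mem_Collect_eq by simp
qed

text \<open>The first \<open>t\<close> controllers depend on \<open>past t\<close> only.\<close>

lemma prob_learned_fresh:
  assumes t: "t \<le> T" and q: "q \<in> tuples t" and H: "H \<subseteq> L - past t" and G: "G \<in> sets D"
  shows "measure \<Omega> (learned q t \<inter> {\<omega> \<in> space \<Omega>. \<forall>i\<in>H. \<omega> i \<in> G}) =
      measure \<Omega> (learned q t) * measure D G ^ card H"
  unfolding training_space_def
proof (rule prob_fresh_coordinates[OF D finite_L _ H _ G])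
  show "past t \<subseteq> L" by (simp add: past_def)
  show "learned q t \<in> sets (PiM L (\<lambda>_. D))" using sets_learned[OF t q] by (simp add: training_space_def)
  show "\<omega> \<in> learned q t \<longleftrightarrow> \<omega>' \<in> learned q t"
    if "\<omega> \<in> space (PiM L (\<lambda>_. D))" "\<omega>' \<in> space (PiM L (\<lambda>_. D))" "\<forall>j\<in>past t. \<omega> j = \<omega>' j" for \<omega> \<omega>'
    using that by (intro learned_depends_on_past[OF t]) (simp_all only: training_space_def)
qed

lemma sets_coordinates: "H \<subseteq> L \<Longrightarrow> G \<in> sets D \<Longrightarrow> {\<omega> \<in> space \<Omega>. \<forall>i\<in>H. \<omega> i \<in> G} \<in> sets \<Omega>"
proof (rule sets.sets_Collect_finite_All)
  assume H: "H \<subseteq> L" and G: "G \<in> sets D"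
  show "finite H" using H finite_L by (rule finite_subset)
  fix i assume "i \<in> H"
  then have "i \<in> L" using H by blast
  then have "(\<lambda>\<omega>. \<omega> i) \<in> measurable \<Omega> D"
    unfolding training_space_def by (rule measurable_component_singleton)
  then have "(\<lambda>\<omega>. \<omega> i) -` G \<inter> space \<Omega> \<in> sets \<Omega>" using G by (rule measurable_sets)
  then show "{\<omega> \<in> space \<Omega>. \<omega> i \<in> G} \<in> sets \<Omega>" by (simp add: vimage_def Int_def conj_commute)
qed

text \<open>The events \<open>learned q t\<close> are disjoint, so a conditional bound \<open>\<eta>\<close> given each of them is an
  unconditional one. Runs in which some of the first \<open>t\<close> controllers lie outside of the
  class, as may happen after termination, are in none of them.\<close>

lemma learned_union_bound:
  assumes t: "t \<le> T" and \<eta>: "0 \<le> \<eta>"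
    and B: "\<And>q. q \<in> tuples t \<Longrightarrow> B q \<in> sets \<Omega>"
    and bound: "\<And>q. q \<in> tuples t \<Longrightarrow> measure \<Omega> (learned q t \<inter> B q) \<le> measure \<Omega> (learned q t) * \<eta>"
  shows "(\<Union>q\<in>tuples t. learned q t \<inter> B q) \<in> sets \<Omega>"
    and "measure \<Omega> (\<Union>q\<in>tuples t. learned q t \<inter> B q) \<le> \<eta>"
proof -
  have S: "learned q t \<inter> B q \<in> sets \<Omega>" if "q \<in> tuples t" for q
    using sets_learned[OF t that] B[OF that] by auto
  then show "(\<Union>q\<in>tuples t. learned q t \<inter> B q) \<in> sets \<Omega>"
    using finite_tuples by (intro sets.finite_UN) auto
  have disj: "disjoint_family_on (\<lambda>q. learned q t) (tuples t)"
    unfolding disjoint_family_on_def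
  proof (intro ballI impI)
    fix q q' assume q: "q \<in> tuples t" "q' \<in> tuples t" "q \<noteq> q'"
    then obtain s where "s < t" "q s \<noteq> q' s" unfolding tuples_def by (metis PiE_ext lessThan_iff)
    then show "learned q t \<inter> learned q' t = {}" by (auto simp: learned_def)
  qed
  have "measure \<Omega> (\<Union>q\<in>tuples t. learned q t \<inter> B q) \<le> (\<Sum>q\<in>tuples t. measure \<Omega> (learned q t \<inter> B q))"
    using S finite_tuples by (intro \<Omega>.finite_measure_subadditive_finite) auto
  also have "\<dots> \<le> (\<Sum>q\<in>tuples t. measure \<Omega> (learned q t) * \<eta>)" by (intro sum_mono bound)
  also have "\<dots> = (\<Sum>q\<in>tuples t. measure \<Omega> (learned q t)) * \<eta>" by (simp add: sum_distrib_right)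
  also have "(\<Sum>q\<in>tuples t. measure \<Omega> (learned q t)) = measure \<Omega> (\<Union>q\<in>tuples t. learned q t)"
    using sets_learned[OF t] disj finite_tuples by (intro \<Omega>.finite_measure_finite_Union[symmetric]) auto
  also have "\<dots> * \<eta> \<le> 1 * \<eta>" using \<eta> by (intro mult_right_mono \<Omega>.prob_le_1)
  finally show "measure \<Omega> (\<Union>q\<in>tuples t. learned q t \<inter> B q) \<le> \<eta>" by simp
qed

definition far :: "real \<Rightarrow> (nat \<Rightarrow> real ^ 'n \<Rightarrow> real ^ 'm) \<Rightarrow> nat \<Rightarrow> (real ^ 'n \<Rightarrow> real ^ 'm) \<Rightarrow>
    (real ^ 'n) set" where
  "far e q t p = {x. e < norm (pstar (closed_loop sys q x t) - p (closed_loop sys q x t))}"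

definition passing :: "(nat \<Rightarrow> real ^ 'n \<Rightarrow> real ^ 'm) \<Rightarrow> nat \<Rightarrow> (real ^ 'n) set" where
  "passing q t = {x. closed_loop sys q x t \<in> Z}"

lemma sets_far: "q \<in> tuples t \<Longrightarrow> p \<in> Pols \<Longrightarrow> far e q t p \<in> sets D"
proof -
  assume q: "q \<in> tuples t" and p: "p \<in> Pols"
  have [measurable]: "(\<lambda>x. p (closed_loop sys q x t)) \<in> borel_measurable borel"
      "(\<lambda>x. pstar (closed_loop sys q x t)) \<in> borel_measurable borel"
    by (rule measurable_compose[OF tuples_loop_measurable[OF q] Pols_measurable[OF p]],
        rule measurable_compose[OF tuples_loop_measurable[OF q] Pols_measurable[OF pstar]])
  have "(\<lambda>x. norm (pstar (closed_loop sys q x t) - p (closed_loop sys q x t))) \<in> borel_measurable borel"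
    by measurable
  then have "{x \<in> space borel. e < norm (pstar (closed_loop sys q x t) - p (closed_loop sys q x t))} \<in> sets borel"
    by (intro borel_measurable_less) auto
  then show ?thesis by (simp add: far_def sets_D)
qed

lemma sets_passing: "q \<in> tuples t \<Longrightarrow> passing q t \<in> sets D"
  using measurable_sets[OF tuples_loop_measurable Z] by (simp add: passing_def vimage_def sets_D)

lemma Train_fresh: "t < T \<Longrightarrow> Train t ` {..<num_train n t} \<subseteq> L - past t"
  unfolding sample_labels_def past_def by auto

lemma Test_fresh: "1 \<le> t \<Longrightarrow> t \<le> T \<Longrightarrow> Test t ` {..<l} \<subseteq> L - past t"
  unfolding sample_labels_def past_def by auto

text \<open>A run whose controller of stage \<open>t\<close> is far from the expert with probability above \<open>r t\<close>
  belongs to this event, because the controller interpolates its training data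
  (\<open>learner_interpolates\<close>).\<close>

definition overlooked :: "real \<Rightarrow> (nat \<Rightarrow> real) \<Rightarrow> nat \<Rightarrow> (sample_label \<Rightarrow> real ^ 'n) set" where
  "overlooked e r t = (\<Union>q\<in>tuples t. learned q t \<inter>
     (\<Union>p\<in>{p \<in> Pols. r t < measure D (far e q t p)}.
        {\<omega> \<in> space \<Omega>. \<forall>j\<in>Train t ` {..<num_train n t}. \<omega> j \<in> - far e q t p}))"

text \<open>Avoiding this event makes training stop at \<open>t\<close> at the latest, once \<open>Z\<close> is reached at \<open>t\<close>
  with probability \<open>1 - a\<close>.\<close>

definition unlucky_fail :: "real \<Rightarrow> nat \<Rightarrow> (sample_label \<Rightarrow> real ^ 'n) set" where
  "unlucky_fail a t = (\<Union>q\<in>tuples t. learned q t \<inter>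
     (if measure D (- passing q t) \<le> a then \<Union>i<l. {\<omega> \<in> space \<Omega>. \<forall>j\<in>{Test t i}. \<omega> j \<in> - passing q t} else {}))"

text \<open>Avoiding this event makes a passed test at time \<open>t\<close> a certificate for probability \<open>1 - \<delta>\<close>.\<close>

definition unlucky_pass :: "real \<Rightarrow> nat \<Rightarrow> (sample_label \<Rightarrow> real ^ 'n) set" where
  "unlucky_pass \<delta> t = (\<Union>q\<in>tuples t. learned q t \<inter>
     (if measure D (passing q t) < 1 - \<delta> then {\<omega> \<in> space \<Omega>. \<forall>j\<in>Test t ` {..<l}. \<omega> j \<in> passing q t} else {}))"

lemma prob_overlooked:
  assumes t: "t < T" and \<eta>: "0 \<le> \<eta>"
    and miss: "\<And>q p. q \<in> tuples t \<Longrightarrow> p \<in> Pols \<Longrightarrow> r t < measure D (far e q t p) \<Longrightarrow>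
        (1 - measure D (far e q t p)) ^ num_train n t \<le> \<eta> / real (card Pols)"
  shows "overlooked e r t \<in> sets \<Omega>" "measure \<Omega> (overlooked e r t) \<le> \<eta>"
proof -
  have tT: "t \<le> T" using t by simp
  let ?H = "Train t ` {..<num_train n t}"
  have cardH: "card ?H = num_train n t" by (subst card_image) (auto simp: inj_on_def)
  have cF: "- far e q t p \<in> sets D" if "q \<in> tuples t" "p \<in> Pols" for q p
    using sets.compl_sets[OF sets_far[OF that]] by (simp add: space_D Compl_eq_Diff_UNIV)
  have pF: "measure D (- far e q t p) = 1 - measure D (far e q t p)" if "q \<in> tuples t" "p \<in> Pols" for q p
    using D.prob_compl[OF sets_far[OF that]] by (simp add: space_D Compl_eq_Diff_UNIV)
  have HL: "?H \<subseteq> L" using Train_fresh[OF t] by blast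
  let ?E = "\<lambda>q p. {\<omega> \<in> space \<Omega>. \<forall>j\<in>?H. \<omega> j \<in> - far e q t p}"
  let ?S = "\<lambda>q. {p \<in> Pols. r t < measure D (far e q t p)}"
  have E: "?E q p \<in> sets \<Omega>" if "q \<in> tuples t" "p \<in> Pols" for q p
    by (rule sets_coordinates[OF HL cF[OF that]])
  have card0: "0 < card Pols" using pstar finite_Pols by (auto simp: card_gt_0_iff)
  have B: "(\<Union>p\<in>?S q. ?E q p) \<in> sets \<Omega>" if "q \<in> tuples t" for q
    using finite_Pols E[OF that] by (intro sets.finite_UN) auto
  have bound: "measure \<Omega> (learned q t \<inter> (\<Union>p\<in>?S q. ?E q p)) \<le>
      measure \<Omega> (learned q t) * \<eta>" if q: "q \<in> tuples t" for q
  proof -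
    have "measure \<Omega> (learned q t \<inter> (\<Union>p\<in>?S q. ?E q p)) = measure \<Omega> (\<Union>p\<in>?S q. learned q t \<inter> ?E q p)"
      by (rule arg_cong[where f = "measure \<Omega>"]) blast
    also have "\<dots> \<le> (\<Sum>p\<in>?S q. measure \<Omega> (learned q t \<inter> ?E q p))"
      using finite_Pols E[OF q] sets_learned[OF tT q] by (intro \<Omega>.finite_measure_subadditive_finite) auto
    also have "\<dots> \<le> (\<Sum>p\<in>?S q. measure \<Omega> (learned q t) * (\<eta> / real (card Pols)))"
    proof (rule sum_mono)
      fix p assume p: "p \<in> ?S q"
      then have "measure \<Omega> (learned q t \<inter> ?E q p) =
          measure \<Omega> (learned q t) * (1 - measure D (far e q t p)) ^ num_train n t"
        using prob_learned_fresh[OF tT q Train_fresh[OF t] cF[OF q]] pF[OF q] cardH by simp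
      also have "\<dots> \<le> measure \<Omega> (learned q t) * (\<eta> / real (card Pols))"
        using miss[OF q] p by (intro mult_left_mono) auto
      finally show "measure \<Omega> (learned q t \<inter> ?E q p) \<le> measure \<Omega> (learned q t) * (\<eta> / real (card Pols))" .
    qed
    also have "\<dots> = real (card (?S q)) * (measure \<Omega> (learned q t) * (\<eta> / real (card Pols)))" by simp
    also have "\<dots> \<le> real (card Pols) * (measure \<Omega> (learned q t) * (\<eta> / real (card Pols)))"
      using finite_Pols \<eta> by (intro mult_right_mono) (auto intro: card_mono)
    also have "\<dots> = measure \<Omega> (learned q t) * \<eta>" using card0 by simp
    finally show ?thesis .
  qed
  show "overlooked e r t \<in> sets \<Omega>" "measure \<Omega> (overlooked e r t) \<le> \<eta>"
    unfolding overlooked_def by (rule learned_union_bound[OF tT \<eta> B bound]; assumption)+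
qed

lemma prob_unlucky_fail:
  assumes t: "1 \<le> t" "t \<le> T" and a: "0 \<le> a"
  shows "unlucky_fail a t \<in> sets \<Omega>" "measure \<Omega> (unlucky_fail a t) \<le> real l * a"
proof -
  have TF: "{Test t i} \<subseteq> L - past t" if "i < l" for i using Test_fresh[OF t] that by blast
  have cF: "- passing q t \<in> sets D" if "q \<in> tuples t" for q
    using sets.compl_sets[OF sets_passing[OF that]] by (simp add: space_D Compl_eq_Diff_UNIV)
  let ?E = "\<lambda>q i. {\<omega> \<in> space \<Omega>. \<forall>j\<in>{Test t i}. \<omega> j \<in> - passing q t}"
  let ?B = "\<lambda>q. if measure D (- passing q t) \<le> a then \<Union>i<l. ?E q i else {}"
  have E: "?E q i \<in> sets \<Omega>" if "q \<in> tuples t" "i < l" for q i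
    by (rule sets_coordinates[OF _ cF[OF that(1)]]) (use TF[OF that(2)] in blast)
  have B: "?B q \<in> sets \<Omega>" if "q \<in> tuples t" for q
    using E[OF that] by (auto intro!: sets.finite_UN simp del: ball_simps)
  have bound: "measure \<Omega> (learned q t \<inter> ?B q) \<le>
      measure \<Omega> (learned q t) * (real l * a)" if q: "q \<in> tuples t" for q
  proof (cases "measure D (- passing q t) \<le> a")
    case True
    have "measure \<Omega> (learned q t \<inter> ?B q) = measure \<Omega> (\<Union>i<l. learned q t \<inter> ?E q i)"
      by (rule arg_cong[where f = "measure \<Omega>"]) (use True in auto)
    also have "\<dots> \<le> (\<Sum>i<l. measure \<Omega> (learned q t \<inter> ?E q i))"
      using E[OF q] sets_learned[OF t(2) q] by (intro \<Omega>.finite_measure_subadditive_finite) auto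
    also have "\<dots> \<le> (\<Sum>i<l. measure \<Omega> (learned q t) * a)"
    proof (rule sum_mono)
      fix i assume "i \<in> {..<l}"
      then have i: "i < l" by simp
      have "measure \<Omega> (learned q t \<inter> ?E q i) =
          measure \<Omega> (learned q t) * measure D (- passing q t) ^ card {Test t i}"
        by (rule prob_learned_fresh[OF t(2) q TF[OF i] cF[OF q]])
      then show "measure \<Omega> (learned q t \<inter> ?E q i) \<le> measure \<Omega> (learned q t) * a"
        using True by (simp add: mult_left_mono)
    qed
    also have "\<dots> = measure \<Omega> (learned q t) * (real l * a)" by simp
    finally show ?thesis .
  next
    case False then show ?thesis using a by simp
  qed
  have "0 \<le> real l * a" using a by simp
  note U = learned_union_bound[OF t(2) this B bound]
  show "unlucky_fail a t \<in> sets \<Omega>" "measure \<Omega> (unlucky_fail a t) \<le> real l * a"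
    unfolding unlucky_fail_def by (rule U; assumption)+
qed

lemma prob_unlucky_pass:
  assumes t: "1 \<le> t" "t \<le> T" and \<delta>: "\<delta> \<le> 1"
  shows "unlucky_pass \<delta> t \<in> sets \<Omega>" "measure \<Omega> (unlucky_pass \<delta> t) \<le> (1 - \<delta>) ^ l"
proof -
  let ?H = "Test t ` {..<l}"
  have cardH: "card ?H = l" by (subst card_image) (auto simp: inj_on_def)
  let ?E = "\<lambda>q. {\<omega> \<in> space \<Omega>. \<forall>j\<in>?H. \<omega> j \<in> passing q t}"
  let ?B = "\<lambda>q. if measure D (passing q t) < 1 - \<delta> then ?E q else {}"
  have HL: "?H \<subseteq> L" using Test_fresh[OF t] by blast
  have B: "?B q \<in> sets \<Omega>" if "q \<in> tuples t" for q
    using sets_coordinates[OF HL sets_passing[OF that]] by simp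
  have bound: "measure \<Omega> (learned q t \<inter> ?B q) \<le>
      measure \<Omega> (learned q t) * (1 - \<delta>) ^ l" if q: "q \<in> tuples t" for q
  proof (cases "measure D (passing q t) < 1 - \<delta>")
    case True
    have "measure \<Omega> (learned q t \<inter> ?E q) = measure \<Omega> (learned q t) * measure D (passing q t) ^ card ?H"
      by (rule prob_learned_fresh[OF t(2) q Test_fresh[OF t] sets_passing[OF q]])
    also have "\<dots> \<le> measure \<Omega> (learned q t) * (1 - \<delta>) ^ l"
      unfolding cardH using True by (intro mult_left_mono power_mono) auto
    finally show ?thesis using True by simp
  next
    case False then show ?thesis using \<delta> by simp
  qed
  have "0 \<le> (1 - \<delta>) ^ l" using \<delta> by simp
  note U = learned_union_bound[OF t(2) this B bound]
  show "unlucky_pass \<delta> t \<in> sets \<Omega>" "measure \<Omega> (unlucky_pass \<delta> t) \<le> (1 - \<delta>) ^ l"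
    unfolding unlucky_pass_def by (rule U; assumption)+
qed

lemma stop_time_le: "stop_time sys Z T l \<omega> q \<le> T"
proof (cases "\<exists>t\<in>{1..T}. test_passed sys Z l \<omega> q t")
  case True
  then obtain t where t: "t \<in> {1..T} \<and> test_passed sys Z l \<omega> q t" by blast
  have "(LEAST t. t \<in> {1..T} \<and> test_passed sys Z l \<omega> q t) \<le> t" using t by (rule Least_le)
  then show ?thesis using True t by (simp add: stop_time_def)
qed (simp add: stop_time_def)

lemma stop_time_pos: "1 \<le> stop_time sys Z T l \<omega> q"
proof (cases "\<exists>t\<in>{1..T}. test_passed sys Z l \<omega> q t")
  case True
  then have "\<exists>t. t \<in> {1..T} \<and> test_passed sys Z l \<omega> q t" by blast
  from LeastI_ex[OF this] show ?thesis using True by (simp add: stop_time_def)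
qed (use T in \<open>simp add: stop_time_def\<close>)

lemma stop_time_le_passed:
  assumes "1 \<le> t" "t \<le> T" "test_passed sys Z l \<omega> q t"
  shows "stop_time sys Z T l \<omega> q \<le> t"
proof -
  have t: "t \<in> {1..T} \<and> test_passed sys Z l \<omega> q t" using assms by simp
  then have "\<exists>t\<in>{1..T}. test_passed sys Z l \<omega> q t" by blast
  then show ?thesis using Least_le[of "\<lambda>t. t \<in> {1..T} \<and> test_passed sys Z l \<omega> q t", OF t]
    by (simp add: stop_time_def)
qed

lemma stop_time_passed:
  assumes "stop_time sys Z T l \<omega> q < T"
  shows "test_passed sys Z l \<omega> q (stop_time sys Z T l \<omega> q)"
proof -
  have ex: "\<exists>t\<in>{1..T}. test_passed sys Z l \<omega> q t"
    using assms unfolding stop_time_def by (simp split: if_splits)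
  then have "\<exists>t. t \<in> {1..T} \<and> test_passed sys Z l \<omega> q t" by blast
  from LeastI_ex[OF this] show ?thesis using ex by (simp add: stop_time_def)
qed

lemma learner_in_Pols:
  "\<omega> \<in> space \<Omega> \<Longrightarrow> t < stop_time sys Z T l \<omega> (pihat \<omega>) \<Longrightarrow> pihat \<omega> t \<in> Pols"
  using run_minimises[of \<omega> t] by (simp add: is_arg_min_def)

text \<open>The expert has empirical loss zero, hence so has every minimiser.\<close>

lemma learner_interpolates:
  assumes \<omega>: "\<omega> \<in> space \<Omega>" and t: "t < stop_time sys Z T l \<omega> (pihat \<omega>)" and i: "i < num_train n t"
  defines "x \<equiv> closed_loop sys (pihat \<omega>) (\<omega> (Train t i)) t"
  shows "pstar x = pihat \<omega> t x"
proof -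
  let ?loss = "empirical_loss sys pstar n \<omega> (pihat \<omega>) t"
  have "\<not> ?loss pstar < ?loss (pihat \<omega> t)"
    using run_minimises[OF \<omega> t] pstar by (auto simp: is_arg_min_def)
  moreover have "?loss pstar = 0" by (simp add: empirical_loss_def Let_def)
  ultimately have "?loss (pihat \<omega> t) \<le> 0" by simp
  then have "(\<Sum>i<num_train n t. norm (pstar (closed_loop sys (pihat \<omega>) (\<omega> (Train t i)) t)
      - pihat \<omega> t (closed_loop sys (pihat \<omega>) (\<omega> (Train t i)) t))) \<le> 0" (is "?s \<le> 0")
    using i by (simp add: empirical_loss_def Let_def divide_le_0_iff)
  moreover have "norm (pstar x - pihat \<omega> t x) \<le> ?s"
    unfolding x_def using i by (intro member_le_sum) auto
  ultimately have "norm (pstar x - pihat \<omega> t x) \<le> 0" by linarith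
  then show ?thesis by simp
qed

definition stage_close :: "real \<Rightarrow> (nat \<Rightarrow> real ^ 'n \<Rightarrow> real ^ 'm) \<Rightarrow> nat \<Rightarrow> (real ^ 'n) set" where
  "stage_close e q k = {x. \<forall>t<k. norm (pstar (closed_loop sys q x t) - q t (closed_loop sys q x t)) \<le> e}"

lemma sets_loop:
  assumes "\<And>s. s < k \<Longrightarrow> q s \<in> Pols"
  shows "\<And>t. t < k \<Longrightarrow> far e q t (q t) \<in> sets D" and "passing q k \<in> sets D" and "stage_close e q k \<in> sets D"
proof -
  have restrict: "restrict q {..<t} \<in> tuples t" if "t \<le> k" for t
    using assms that by (auto simp: tuples_def)
  have cl: "closed_loop sys (restrict q {..<t}) x t = closed_loop sys q x t" for x t
    by (rule closed_loop_cong) simp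
  show F: "far e q t (q t) \<in> sets D" if "t < k" for t
    using sets_far[OF restrict assms, of t t e] that by (simp add: far_def cl)
  show "passing q k \<in> sets D"
    using sets_passing[OF restrict[OF order_refl]] by (simp add: passing_def cl)
  have "stage_close e q k = space D - (\<Union>t<k. far e q t (q t))"
    by (auto simp: stage_close_def far_def space_D not_less)
  then show "stage_close e q k \<in> sets D" using F by (auto intro!: sets.Diff sets.finite_UN)
qed

lemma prob_stage_close:
  assumes q: "\<And>s. s < k \<Longrightarrow> q s \<in> Pols" and r: "\<And>t. t < k \<Longrightarrow> measure D (far e q t (q t)) \<le> r t"
  shows "1 - (\<Sum>t<k. r t) \<le> measure D (stage_close e q k)"
proof -
  have F: "far e q t (q t) \<in> sets D" if "t < k" for t by (rule sets_loop(1)[of k q]) (use q that in auto)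
  have "measure D (\<Union>t<k. far e q t (q t)) \<le> (\<Sum>t<k. measure D (far e q t (q t)))"
    using F by (intro D.finite_measure_subadditive_finite) auto
  also have "\<dots> \<le> (\<Sum>t<k. r t)" using r by (intro sum_mono) auto
  finally have "measure D (\<Union>t<k. far e q t (q t)) \<le> (\<Sum>t<k. r t)" .
  moreover have "measure D (space D - (\<Union>t<k. far e q t (q t))) = 1 - measure D (\<Union>t<k. far e q t (q t))"
    using F by (intro D.prob_compl sets.finite_UN) auto
  moreover have "stage_close e q k = space D - (\<Union>t<k. far e q t (q t))"
    by (auto simp: stage_close_def far_def space_D not_less)
  ultimately show ?thesis by simp
qed

text \<open>Outside of \<open>B1\<close> all controllers learned before stopping are close to the expert, up to a
  total probability \<open>a\<close>. If the algorithm did not stop by \<open>ts\<close>, then \<open>Z\<close> would be reached at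
  \<open>ts\<close> with probability \<open>1 - a\<close>, and the failed test at \<open>ts\<close> is excluded by \<open>B2\<close>. A passed
  test certifies probability \<open>1 - \<delta>\<close> outside of \<open>B3\<close>. If training ends at \<open>T\<close> without a
  passed test, the premise \<open>ts \<le> T\<close> gives \<open>ts = T\<close>, and closeness to the expert yields the
  probability directly.\<close>

theorem good_event:
  assumes \<delta>: "0 < \<delta>" "\<delta> < 1" and l: "1 \<le> l" and e: "0 \<le> e"
    and r_nonneg: "\<And>t. 0 \<le> r t" and r_sum: "real l * (\<Sum>t<T. r t) \<le> \<delta>"
    and miss: "\<And>t q p. t < T \<Longrightarrow> q \<in> tuples t \<Longrightarrow> p \<in> Pols \<Longrightarrow> r t < measure D (far e q t p) \<Longrightarrow>
        (1 - measure D (far e q t p)) ^ num_train n t \<le> \<delta> / real T / real (card Pols)"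
    and test: "real T * (1 - \<delta>) ^ l \<le> \<delta>"
    and ts: "1 \<le> ts"
    and reach: "\<And>q. (\<And>s. s < ts \<Longrightarrow> q s \<in> Pols) \<Longrightarrow> AE x in D. x \<in> stage_close e q ts \<longrightarrow> x \<in> passing q ts"
  shows "\<exists>E\<in>sets \<Omega>. 1 - 3 * \<delta> \<le> measure \<Omega> E \<and>
    (\<forall>\<omega>\<in>E. let k = stop_time sys Z T l \<omega> (pihat \<omega>) in
       k \<le> ts \<and> (\<forall>s<k. pihat \<omega> s \<in> Pols) \<and>
       (k < T \<or> ts \<le> T \<longrightarrow> 1 - \<delta> \<le> measure D (passing (pihat \<omega>) k)) \<and>
       1 - \<delta> \<le> measure D (stage_close e (pihat \<omega>) k))"
proof -
  define a where "a = (\<Sum>t<T. r t)"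
  have a0: "0 \<le> a" unfolding a_def using r_nonneg by (intro sum_nonneg) auto
  have la: "real l * a \<le> \<delta>" using r_sum by (simp add: a_def)
  have a\<delta>: "a \<le> \<delta>" using mult_right_mono[of 1 "real l" a] la l a0 by simp
  define B1 where "B1 = (\<Union>t<T. overlooked e r t)"
  define B2 where "B2 = (if ts < T then unlucky_fail a ts else {})"
  define B3 where "B3 = (\<Union>t\<in>{1..T}. unlucky_pass \<delta> t)"
  have \<delta>T: "0 \<le> \<delta> / real T" using \<delta> by simp
  have S1: "overlooked e r t \<in> sets \<Omega>" "measure \<Omega> (overlooked e r t) \<le> \<delta> / real T" if t: "t < T" for t
    by (rule prob_overlooked[OF t \<delta>T miss[OF t]]; assumption)+
  have B1: "B1 \<in> sets \<Omega>" unfolding B1_def using S1 by (intro sets.finite_UN) auto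
  have "measure \<Omega> B1 \<le> (\<Sum>t<T. measure \<Omega> (overlooked e r t))"
    unfolding B1_def using S1 by (intro \<Omega>.finite_measure_subadditive_finite) auto
  also have "\<dots> \<le> (\<Sum>t<T. \<delta> / real T)" using S1 by (intro sum_mono) auto
  finally have P1: "measure \<Omega> B1 \<le> \<delta>" using T by simp
  have B2: "B2 \<in> sets \<Omega>" and P2: "measure \<Omega> B2 \<le> \<delta>"
    unfolding B2_def using prob_unlucky_fail[OF ts _ a0] la \<delta> by (auto intro: order_trans)
  have S3: "unlucky_pass \<delta> t \<in> sets \<Omega>" "measure \<Omega> (unlucky_pass \<delta> t) \<le> (1 - \<delta>) ^ l" if "t \<in> {1..T}" for t
    using prob_unlucky_pass[of t \<delta>] that \<delta> by auto
  have B3: "B3 \<in> sets \<Omega>" unfolding B3_def using S3 by (intro sets.finite_UN) auto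
  have "measure \<Omega> B3 \<le> (\<Sum>t\<in>{1..T}. measure \<Omega> (unlucky_pass \<delta> t))"
    unfolding B3_def using S3 by (intro \<Omega>.finite_measure_subadditive_finite) auto
  also have "\<dots> \<le> (\<Sum>t\<in>{1..T}. (1 - \<delta>) ^ l)" using S3 by (intro sum_mono) auto
  finally have P3: "measure \<Omega> B3 \<le> \<delta>" using test by simp
  define E where "E = space \<Omega> - (B1 \<union> (B2 \<union> B3))"
  have E: "E \<in> sets \<Omega>" unfolding E_def using B1 B2 B3 by auto
  have "measure \<Omega> (B1 \<union> (B2 \<union> B3)) \<le> measure \<Omega> B1 + (measure \<Omega> B2 + measure \<Omega> B3)"
    using B1 B2 B3 by (intro order_trans[OF measure_Un_le] add_left_mono) auto
  moreover have "measure \<Omega> E = 1 - measure \<Omega> (B1 \<union> (B2 \<union> B3))"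
    unfolding E_def using B1 B2 B3 by (intro \<Omega>.prob_compl) auto
  ultimately have PE: "1 - 3 * \<delta> \<le> measure \<Omega> E" using P1 P2 P3 by linarith
  have good: "k \<le> ts \<and> (\<forall>s<k. pihat \<omega> s \<in> Pols) \<and>
       (k < T \<or> ts \<le> T \<longrightarrow> 1 - \<delta> \<le> measure D (passing (pihat \<omega>) k)) \<and>
       1 - \<delta> \<le> measure D (stage_close e (pihat \<omega>) k)"
    if \<omega>E: "\<omega> \<in> E" and k: "k = stop_time sys Z T l \<omega> (pihat \<omega>)" for \<omega> k
  proof -
    have \<omega>: "\<omega> \<in> space \<Omega>" and nB: "\<omega> \<notin> B1" "\<omega> \<notin> B2" "\<omega> \<notin> B3" using \<omega>E by (auto simp: E_def)
    define q where "q = pihat \<omega>"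
    have kT: "k \<le> T" "1 \<le> k" unfolding k by (rule stop_time_le, rule stop_time_pos)
    have Pols: "q s \<in> Pols" if "s < k" for s
      unfolding q_def by (rule learner_in_Pols[OF \<omega>]) (use that k in simp)
    \<comment> \<open>the extensional version of the learned controllers, as required by \<open>tuples\<close>\<close>
    define qt where "qt t = restrict q {..<t}" for t
    have qt: "qt t \<in> tuples t" "\<omega> \<in> learned (qt t) t" if "t \<le> k" for t
      using Pols that \<omega> by (auto simp: tuples_def qt_def learned_def q_def)
    have cl: "closed_loop sys (qt t) x t = closed_loop sys q x t" for x t
      unfolding qt_def by (rule closed_loop_cong) simp
    have farq: "far e (qt t) t = far e q t" and passq: "passing (qt t) t = passing q t" for t
      by (simp_all add: far_def[abs_def] passing_def cl)
    have farr: "measure D (far e q t (q t)) \<le> r t" if t: "t < k" for t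
    proof (rule ccontr)
      assume "\<not> ?thesis"
      then have big: "r t < measure D (far e (qt t) t (q t))" by (simp add: farq)
      have tT: "t < T" using t kT by simp
      have "\<omega> j \<in> - far e (qt t) t (q t)" if j: "j \<in> Train t ` {..<num_train n t}" for j
      proof -
        obtain i where i: "j = Train t i" "i < num_train n t" using j by blast
        have "pstar (closed_loop sys q (\<omega> j) t) = q t (closed_loop sys q (\<omega> j) t)"
          using learner_interpolates[OF \<omega> _ i(2)] t k unfolding q_def i(1) by simp
        then show ?thesis using e by (simp add: farq far_def)
      qed
      then have "\<omega> \<in> {\<omega> \<in> space \<Omega>. \<forall>j\<in>Train t ` {..<num_train n t}. \<omega> j \<in> - far e (qt t) t (q t)}"
        using \<omega> by (intro CollectI conjI ballI)
      moreover have "q t \<in> {p \<in> Pols. r t < measure D (far e (qt t) t p)}" using big Pols[OF t] by simp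
      ultimately have "\<omega> \<in> overlooked e r t"
        unfolding overlooked_def using qt[OF less_imp_le[OF t]] by (intro UN_I IntI)
      then show False using nB(1) tT by (auto simp: B1_def)
    qed
    have sum_le: "(\<Sum>t<j. r t) \<le> a" if "j \<le> T" for j
      unfolding a_def using that r_nonneg by (intro sum_mono2) auto
    have close: "1 - a \<le> measure D (stage_close e q j)" if j: "j \<le> k" for j
    proof -
      have "1 - (\<Sum>t<j. r t) \<le> measure D (stage_close e q j)"
        by (rule prob_stage_close) (use Pols farr j in auto)
      then show ?thesis using sum_le[of j] j kT by linarith
    qed
    have reach_ts: "1 - a \<le> measure D (passing q ts)" if "ts \<le> k"
    proof -
      have P: "\<And>s. s < ts \<Longrightarrow> q s \<in> Pols" using Pols that by simp
      have "measure D (stage_close e q ts) \<le> measure D (passing q ts)"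
        using reach[of q] P sets_loop(2)[of ts q] by (intro D.finite_measure_mono_AE) auto
      then show ?thesis using close[OF that] by linarith
    qed
    have passed: "test_passed sys Z l \<omega> q t \<longleftrightarrow> (\<forall>i<l. \<omega> (Test t i) \<in> passing q t)" for t
      by (simp add: test_passed_def passing_def)
    have k_ts: "k \<le> ts"
    proof (rule ccontr)
      assume "\<not> k \<le> ts"
      then have ts_k: "ts < k" by simp
      then have ts_T: "ts < T" using kT by simp
      have "\<not> test_passed sys Z l \<omega> q ts"
        using stop_time_le_passed[OF ts, of \<omega> q] ts_T ts_k k by (auto simp: q_def)
      then obtain i where i: "i < l" "\<omega> (Test ts i) \<in> - passing q ts" unfolding passed by auto
      have "measure D (- passing q ts) = 1 - measure D (passing q ts)"
        using D.prob_compl[OF sets_loop(2)[of ts q]] Pols ts_k by (simp add: space_D Compl_eq_Diff_UNIV)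
      then have "measure D (- passing (qt ts) ts) \<le> a" using reach_ts ts_k by (simp add: passq)
      moreover have "\<exists>i<l. \<omega> \<in> {\<omega> \<in> space \<Omega>. \<forall>j\<in>{Test ts i}. \<omega> j \<in> - passing (qt ts) ts}"
        using i \<omega> by (auto simp: passq)
      ultimately have "\<omega> \<in> unlucky_fail a ts"
        unfolding unlucky_fail_def using qt[of ts] ts_k by (auto intro!: bexI[of _ "qt ts"])
      then show False using nB(2) ts_T by (simp add: B2_def)
    qed
    have "1 - \<delta> \<le> measure D (passing q k)" if cond: "k < T \<or> ts \<le> T"
    proof (cases "test_passed sys Z l \<omega> q k")
      case True
      show ?thesis
      proof (rule ccontr)
        assume "\<not> ?thesis"
        then have "measure D (passing (qt k) k) < 1 - \<delta>" by (simp add: passq)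
        moreover have "\<omega> \<in> {\<omega> \<in> space \<Omega>. \<forall>j\<in>Test k ` {..<l}. \<omega> j \<in> passing (qt k) k}"
          using True \<omega> by (simp add: passed passq)
        ultimately have "\<omega> \<in> unlucky_pass \<delta> k"
          unfolding unlucky_pass_def using qt[of k] by (auto intro!: bexI[of _ "qt k"])
        then show False using nB(3) kT by (auto simp: B3_def)
      qed
    next
      case False
      then have "\<not> k < T" using stop_time_passed[of \<omega> q] by (auto simp: k q_def)
      then have "ts \<le> k" "k = ts" using cond k_ts kT by auto
      then show ?thesis using reach_ts a\<delta> by simp
    qed
    moreover have "1 - \<delta> \<le> measure D (stage_close e q k)" using close[of k] a\<delta> by simp
    ultimately show ?thesis using k_ts Pols by (simp add: q_def)
  qed
  show ?thesis
    by (rule bexI[OF _ E], rule conjI[OF PE], rule ballI, unfold Let_def, rule good[OF _ refl])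
qed

end

section \<open>Sample sizes\<close>

text \<open>Comparison with the telescoping series of \<open>1 / ln (j + 1) - 1 / ln (j + 2)\<close>.\<close>

lemma summable_train_const:
  "summable (\<lambda>j. 1 / (real (Suc j) * (ln (real (Suc j) + 1))\<^sup>2))"
proof (rule summable_comparison_test_ev)
  define f where "f j = 1 / ln (real (Suc j))" for j
  have "f \<longlonglongrightarrow> 0" unfolding f_def by real_asymp
  then have "summable (\<lambda>j. f j - f (Suc j))" by (rule telescope_summable')
  then show "summable (\<lambda>j. 2 * (f j - f (Suc j)))" by (rule summable_mult)
  show "\<forall>\<^sub>F j in sequentially. norm (1 / (real (Suc j) * (ln (real (Suc j) + 1))\<^sup>2)) \<le> 2 * (f j - f (Suc j))"
    using eventually_ge_at_top[of 1]
  proof eventually_elim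
    fix j :: nat assume j: "1 \<le> j"
    define x where "x = real (Suc j)"
    have x: "2 \<le> x" using j by (simp add: x_def)
    have l0: "0 < ln x" and l1: "ln x \<le> ln (x + 1)" using x by simp_all
    have "ln (x / (x + 1)) \<le> x / (x + 1) - 1" using x by (intro ln_le_minus_one) simp
    then have d: "1 / (x + 1) \<le> ln (x + 1) - ln x" using x by (simp add: ln_div field_simps)
    have "1 / x \<le> 2 * (1 / (x + 1))" using x by (simp add: field_simps)
    then have "1 / x / (ln (x + 1))\<^sup>2 \<le> 2 * (1 / (x + 1)) / (ln (x + 1))\<^sup>2"
      by (rule divide_right_mono) simp
    then have "1 / (x * (ln (x + 1))\<^sup>2) \<le> 2 * (1 / (x + 1)) / (ln (x + 1))\<^sup>2" by simp
    also have "\<dots> \<le> 2 * (ln (x + 1) - ln x) / (ln (x + 1))\<^sup>2"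
      using d by (intro divide_right_mono) auto
    also have "\<dots> \<le> 2 * (ln (x + 1) - ln x) / (ln x * ln (x + 1))"
      using l0 l1 unfolding power2_eq_square by (intro divide_left_mono mult_right_mono mult_pos_pos) auto
    also have "\<dots> = 2 * (1 / ln x - 1 / ln (x + 1))" using l0 l1 by (simp add: field_simps)
    finally have "1 / (x * (ln (x + 1))\<^sup>2) \<le> 2 * (1 / ln x - 1 / ln (x + 1))" .
    then show "norm (1 / (real (Suc j) * (ln (real (Suc j) + 1))\<^sup>2)) \<le> 2 * (f j - f (Suc j))"
      unfolding f_def x_def by (simp add: add.commute)
  qed
qed

lemma train_const_pos: "0 < train_const"
  unfolding train_const_def by (rule suminf_pos[OF summable_train_const]) simp

lemma num_train_ge:
  "train_const * real n * real t * (ln (real t + 1))\<^sup>2 + real n \<le> real (num_train n t)"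
proof -
  have "train_const * real n * real t * (ln (real t + 1))\<^sup>2
      \<le> train_const * real n * real t * of_int \<lceil>(ln (real t + 1))\<^sup>2\<rceil>"
    using train_const_pos by (intro mult_left_mono le_of_int_ceiling) simp
  then show ?thesis unfolding num_train_def using real_nat_ceiling_ge order_trans add_right_mono by meson
qed

text \<open>Stage \<open>0\<close> contributes at most \<open>1 / n\<close>, and by the choice of \<open>train_const\<close> so do all later
  stages together.\<close>

lemma sum_inverse_num_train_le:
  assumes n: "1 \<le> n"
  shows "(\<Sum>t<T. 1 / real (num_train n t)) \<le> 2 / real n"
proof (cases T)
  case (Suc m)
  let ?s = "\<lambda>j. 1 / (real (Suc j) * (ln (real (Suc j) + 1))\<^sup>2)"
  have 0: "1 / real (num_train n 0) \<le> 1 / real n"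
    using num_train_ge[of n 0] n by (intro divide_left_mono mult_pos_pos) auto
  have "1 / real (num_train n (Suc j)) \<le> ?s j / (train_const * real n)" for j
  proof -
    let ?d = "train_const * real n * (real (Suc j) * (ln (real (Suc j) + 1))\<^sup>2)"
    have d: "0 < ?d" using train_const_pos n by simp
    have "?d \<le> real (num_train n (Suc j))" using num_train_ge[of n "Suc j"] by (simp add: mult.assoc)
    with d have "inverse (real (num_train n (Suc j))) \<le> inverse ?d" by (intro le_imp_inverse_le)
    then have "1 / real (num_train n (Suc j)) \<le> 1 / ?d" by (simp only: inverse_eq_divide)
    then show ?thesis by (simp add: mult.commute)
  qed
  then have "(\<Sum>j<m. 1 / real (num_train n (Suc j))) \<le> (\<Sum>j<m. ?s j / (train_const * real n))"
    by (rule sum_mono)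
  also have "\<dots> = (\<Sum>j<m. ?s j) / (train_const * real n)" by (simp add: sum_divide_distrib)
  also have "\<dots> \<le> train_const / (train_const * real n)"
    unfolding train_const_def[symmetric]
  proof (rule divide_right_mono)
    show "(\<Sum>j<m. ?s j) \<le> train_const"
      unfolding train_const_def by (rule sum_le_suminf[OF summable_train_const]) auto
  qed (use train_const_pos in simp)
  also have "\<dots> = 1 / real n" using train_const_pos by simp
  finally have "(\<Sum>j<m. 1 / real (num_train n (Suc j))) \<le> 1 / real n" .
  then show ?thesis using 0 unfolding Suc sum.lessThan_Suc_shift by simp
qed simp

lemma power_one_minus_le_exp:
  assumes "0 \<le> p" "p \<le> 1" "a \<le> p * real m"
  shows "(1 - p) ^ m \<le> exp (- a)"
proof -
  have "(1 - p) ^ m \<le> exp (- p) ^ m"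
    using assms exp_ge_add_one_self[of "- p"] by (intro power_mono) auto
  also have "\<dots> = exp (- (p * real m))" by (simp add: exp_of_nat_mult[symmetric] mult.commute)
  also have "\<dots> \<le> exp (- a)" using assms(3) by simp
  finally show ?thesis .
qed

section \<open>Forward-Switch with robust MPC as the expert\<close>

text \<open>It remains to choose the thresholds \<open>r\<close> of \<open>good_event\<close>. If \<open>\<epsilon> / \<beta>\<close> is at least the diameter
  bound \<open>2 * b\<close> of the inputs, no controller is ever far, and \<open>r = 0\<close> works. Otherwise the
  hypothesis on \<open>n\<close> gives \<open>7 * l * a / \<delta> \<le> n\<close> with the logarithm \<open>a\<close> in that hypothesis, and
  \<open>r t = a / num_train n t\<close> makes an overlooked controller as unlikely as \<open>exp (- a)\<close>.\<close>

theorem theorem4p4: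
  fixes sys :: "('n::finite, 'm::finite) mpc_system"
    and S :: "(real ^ 'n) set"
    and \<rho> \<tau> :: real
  assumes "mpc_data sys"
    and "bounded (Uset sys)"
    and "Bmat sys \<noteq> 0"
    and "bounded S"
    and "spectral_radius (AK sys) < \<rho>" and "\<rho> < 1" and "0 < \<tau>"
    and "\<forall>k. onorm ((*v) (AK sys) ^^ k) \<le> \<tau> * \<rho> ^ k"
  shows "\<exists>C::real. \<forall>(\<epsilon>::real) (\<delta>::real) (T::nat) (l::nat) (n::nat) (\<tau>star::nat)
      (\<Delta> :: (real ^ 'n) set) (D :: (real ^ 'n) measure) (Pols :: (real ^ 'n \<Rightarrow> real ^ 'm) set)
      (pihat :: (sample_label \<Rightarrow> real ^ 'n) \<Rightarrow> nat \<Rightarrow> real ^ 'n \<Rightarrow> real ^ 'm).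
    0 < \<epsilon> \<and> \<epsilon> < 1 \<and> 0 < \<delta> \<and> \<delta> < 1 \<and> 1 \<le> T \<and>
    disturbance_invariant sys (cball 0 \<epsilon>) \<Delta> \<and> closed \<Delta> \<and> \<Delta> \<subseteq> cball 0 (\<tau> / (1 - \<rho>) * \<epsilon>) \<and>
    prob_space D \<and> sets D = sets borel \<and> measure_support D = S \<and>
    (AE x0 in D. x0 \<in> Xbar0 sys \<Delta>) \<and>
    reaching_time sys \<Delta> (cball 0 \<epsilon>) S \<tau>star \<and>
    finite Pols \<and> expert sys \<Delta> \<in> Pols \<and>
    (\<forall>p\<in>Pols. p \<in> borel_measurable borel \<and> (\<forall>x. p x \<in> Uset sys)) \<and>
    real l \<ge> 10 * ln (real T / \<delta>) / \<delta> \<and>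
    real n \<ge> 14 * real l * onorm ((*v) (Bmat sys)) * (SUP u\<in>Uset sys. norm u)
                * ln (2 * real T * real l * real (card Pols) / \<delta>) / (\<epsilon> * \<delta>) \<and>
    forward_switch_run sys (Obar sys \<Delta>) D (expert sys \<Delta>) Pols n T l pihat
    \<longrightarrow>
    (\<exists>E \<in> sets (training_space D n T l).
       measure (training_space D n T l) E \<ge> 1 - 3 * \<delta> \<and>
       (\<forall>\<omega>\<in>E.
          let \<tau>hat = stop_time sys (Obar sys \<Delta>) T l \<omega> (pihat \<omega>);
              xhat = closed_loop sys (pihat \<omega>);
              close = (\<lambda>x0. \<forall>t<\<tau>hat. norm (expert sys \<Delta> (xhat x0 t) - pihat \<omega> t (xhat x0 t))
                                        \<le> \<epsilon> / onorm ((*v) (Bmat sys)))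
          in \<tau>hat \<le> \<tau>star \<and>
             (\<tau>hat < T \<or> \<tau>star \<le> T \<longrightarrow> \<P>(x0 in D. xhat x0 \<tau>hat \<in> Obar sys \<Delta>) \<ge> 1 - \<delta>) \<and>
             \<P>(x0 in D. close x0) \<ge> 1 - \<delta> \<and>
             (\<forall>x0\<in>S. xhat x0 \<tau>hat \<in> Obar sys \<Delta> \<and> close x0 \<longrightarrow>
                total_cost sys (switched_policy sys \<tau>hat (pihat \<omega>)) T x0
                  - total_cost sys (\<lambda>_. mpc_control sys \<Delta>) T x0
                \<le> C * real \<tau>star * \<epsilon>)))"
proof -
  interpret M: mpc_bounded sys \<rho> \<tau>
    by unfold_locales (use assms in auto)
  obtain R0 where R0: "\<And>x. x \<in> S \<Longrightarrow> norm x \<le> R0" using assms(4) unfolding bounded_iff by blast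
  obtain C where C: "\<forall>\<epsilon> \<Delta> T th \<tau>s pol x0. M.tube \<epsilon> \<Delta> \<longrightarrow> \<epsilon> < 1 \<longrightarrow> norm x0 \<le> R0 \<longrightarrow> x0 \<in> Xbar0 sys \<Delta> \<longrightarrow>
     M.close_to_expert \<epsilon> \<Delta> pol th x0 \<longrightarrow> closed_loop sys pol x0 th \<in> Obar sys \<Delta> \<longrightarrow>
     (\<forall>t<th. \<forall>x. pol t x \<in> Uset sys) \<longrightarrow> th \<le> \<tau>s \<longrightarrow> 1 \<le> \<tau>s \<longrightarrow>
     total_cost sys (switched_policy sys th pol) T x0 - total_cost sys (\<lambda>_. mpc_control sys \<Delta>) T x0
       \<le> C * real \<tau>s * \<epsilon>"
    using M.regret_bound[of R0] by (elim exE)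
  show ?thesis
  proof (intro exI[of _ C] allI impI, elim conjE)
    fix \<epsilon> \<delta> :: real and T l n \<tau>star :: nat and \<Delta> and D :: "(real ^ 'n) measure"
      and Pols :: "(real ^ 'n \<Rightarrow> real ^ 'm) set"
      and pihat :: "(sample_label \<Rightarrow> real ^ 'n) \<Rightarrow> nat \<Rightarrow> real ^ 'n \<Rightarrow> real ^ 'm"
    assume \<epsilon>: "0 < \<epsilon>" "\<epsilon> < 1" and \<delta>: "0 < \<delta>" "\<delta> < 1" and T: "1 \<le> T"
      and \<Delta>: "disturbance_invariant sys (cball 0 \<epsilon>) \<Delta>" "closed \<Delta>" "\<Delta> \<subseteq> cball 0 (\<tau> / (1 - \<rho>) * \<epsilon>)"
      and D: "prob_space D" "sets D = sets borel" and S: "measure_support D = S"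
      and AE0: "AE x0 in D. x0 \<in> Xbar0 sys \<Delta>"
      and reach: "reaching_time sys \<Delta> (cball 0 \<epsilon>) S \<tau>star"
      and Pols: "finite Pols" "expert sys \<Delta> \<in> Pols" "\<forall>p\<in>Pols. p \<in> borel_measurable borel \<and>
          (\<forall>x. p x \<in> Uset sys)"
      and l: "real l \<ge> 10 * ln (real T / \<delta>) / \<delta>"
      and n: "real n \<ge> 14 * real l * onorm ((*v) (Bmat sys)) * (SUP u\<in>Uset sys. norm u)
                * ln (2 * real T * real l * real (card Pols) / \<delta>) / (\<epsilon> * \<delta>)"
      and run: "forward_switch_run sys (Obar sys \<Delta>) D (expert sys \<Delta>) Pols n T l pihat"
    have tube: "M.tube \<epsilon> \<Delta>" using \<epsilon> \<Delta> by (simp add: M.tube_def M.\<kappa>_def)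
    have SX: "S \<subseteq> Xbar0 sys \<Delta>"
      using measure_support_subset[OF D M.closed_Xbar0 AE0] S by simp
    have AES: "AE x in D. x \<in> S" using AE_measure_support[OF D] S by simp
    have ts: "1 \<le> \<tau>star" using reach by (simp add: reaching_time_def)
    interpret FS: forward_switch sys "Obar sys \<Delta>" D "expert sys \<Delta>" Pols n T l pihat
      by (rule forward_switch.intro[OF D Pols(1,2) _ borel_closed[OF M.closed_Obar] T run])
        (use Pols(3) in blast)
    define e where "e = \<epsilon> / M.\<beta>"
    have e: "0 \<le> e" unfolding e_def using \<epsilon> M.beta_pos by simp
    have stage_close: "x \<in> FS.stage_close e q k \<longleftrightarrow> M.close_to_expert \<epsilon> \<Delta> q k x" for q k x
      by (simp add: FS.stage_close_def M.close_to_expert_def e_def)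
    have reach': "AE x in D. x \<in> FS.stage_close e q \<tau>star \<longrightarrow> x \<in> FS.passing q \<tau>star" for q
      using AES
    proof eventually_elim
      fix x assume x: "x \<in> S"
      show "x \<in> FS.stage_close e q \<tau>star \<longrightarrow> x \<in> FS.passing q \<tau>star"
        unfolding stage_close FS.passing_def
        using M.reaches_terminal_set[OF tube _ x _ reach, of q] x SX by blast
    qed
    have T\<delta>: "1 < real T / \<delta>" using T \<delta> by (simp add: field_simps)
    then have lnT: "0 < ln (real T / \<delta>)" by simp
    then have "0 < 10 * ln (real T / \<delta>) / \<delta>" using \<delta> by simp
    then have l1: "1 \<le> l" using l by linarith
    have test: "real T * (1 - \<delta>) ^ l \<le> \<delta>"
    proof -
      have "ln (real T / \<delta>) \<le> \<delta> * real l" using l lnT \<delta> by (simp add: field_simps)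
      then have "(1 - \<delta>) ^ l \<le> exp (- ln (real T / \<delta>))" using \<delta> by (intro power_one_minus_le_exp) auto
      also have "\<dots> = \<delta> / real T" using T\<delta> \<delta> T by (simp add: exp_minus)
      finally show ?thesis using T by (simp add: field_simps)
    qed
    have card1: "1 \<le> card Pols" using Pols(1,2) by (metis One_nat_def Suc_leI card_gt_0_iff empty_iff)
    define b where "b = (SUP u\<in>Uset sys. norm u)"
    have b: "norm u \<le> b" if "u \<in> Uset sys" for u
      unfolding b_def using that assms(2) by (intro cSUP_upper) (auto simp: bounded_iff bdd_above_def)
    have "\<exists>r. (\<forall>t. 0 \<le> r t) \<and> real l * (\<Sum>t<T. r t) \<le> \<delta> \<and>
        (\<forall>t<T. \<forall>q p. p \<in> Pols \<longrightarrow> r t < measure D (FS.far e q t p) \<longrightarrow>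
        (1 - measure D (FS.far e q t p)) ^ num_train n t \<le> \<delta> / real T / real (card Pols))"
    proof (cases "2 * M.\<beta> * b \<le> \<epsilon>")
      case True
      then have be: "2 * b \<le> e" unfolding e_def using M.beta_pos by (simp add: field_simps)
      have "FS.far e q t p = {}" if "p \<in> Pols" for q t p
      proof -
        have "norm (expert sys \<Delta> x - p x) \<le> e" for x
          using b[of "expert sys \<Delta> x"] b[of "p x"] Pols(2,3) that be norm_triangle_ineq4[of "expert sys \<Delta> x" "p x"]
          by fastforce
        then show ?thesis unfolding FS.far_def by (auto simp: not_less)
      qed
      then show ?thesis using \<delta> by (intro exI[of _ "\<lambda>_. 0"]) simp
    next
      case False
      define a where "a = ln (2 * real T * real l * real (card Pols) / \<delta>)"
      have prod: "1 \<le> real T * real l * real (card Pols)"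
        using T l1 card1 by (simp add: Suc_le_eq flip: of_nat_mult)
      have arg: "1 < 2 * real T * real l * real (card Pols) / \<delta>" using prod \<delta> by (simp add: field_simps)
      then have a: "0 < a" unfolding a_def by simp
      have n7: "7 * real l * a / \<delta> \<le> real n"
      proof -
        have "7 * real l * a / \<delta> * 1 \<le> 7 * real l * a / \<delta> * (2 * M.\<beta> * b / \<epsilon>)"
          using False a \<delta> \<epsilon> by (intro mult_left_mono) (simp_all add: field_simps)
        also have "\<dots> = 14 * real l * M.\<beta> * b * a / (\<epsilon> * \<delta>)" by (simp add: field_simps)
        also have "\<dots> \<le> real n" using n unfolding a_def b_def M.\<beta>_def .
        finally show ?thesis by simp
      qed
      have "0 < 7 * real l * a / \<delta>" using a \<delta> l1 by simp
      then have n1: "1 \<le> n" using n7 by linarith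
      define r where "r t = a * (1 / real (num_train n t))" for t
      have m_pos: "0 < real (num_train n t)" for t
      proof -
        have "real n \<le> real (num_train n t)" using num_train_ge[of n t] train_const_pos
          by (smt (verit) mult_nonneg_nonneg of_nat_0_le_iff zero_le_power2)
        then show ?thesis using n1 by simp
      qed
      have "real l * (\<Sum>t<T. r t) \<le> \<delta>"
      proof -
        have "(\<Sum>t<T. r t) = a * (\<Sum>t<T. 1 / real (num_train n t))" unfolding r_def
          by (rule sum_distrib_left[symmetric])
        also have "\<dots> \<le> a * (2 / real n)" using a sum_inverse_num_train_le[OF n1]
          by (intro mult_left_mono) auto
        finally have "real l * (\<Sum>t<T. r t) \<le> real l * (a * (2 / real n))" by (intro mult_left_mono) auto
        also have "\<dots> \<le> \<delta>"
        proof -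
          have "7 * (real l * a) \<le> real n * \<delta>" using n7 \<delta> by (simp add: field_simps)
          moreover have "0 \<le> real l * a" using a by simp
          ultimately have "2 * (real l * a) \<le> real n * \<delta>" by linarith
          then show ?thesis using n1 by (simp add: field_simps)
        qed
        finally show ?thesis .
      qed
      moreover have "(1 - p) ^ num_train n t \<le> \<delta> / real T / real (card Pols)" if p: "r t < p" "p \<le> 1" for t p
      proof -
        have "0 \<le> r t" unfolding r_def using a by simp
        moreover have "a \<le> p * real (num_train n t)" using p(1) m_pos[of t] unfolding r_def
          by (simp add: field_simps)
        ultimately have "(1 - p) ^ num_train n t \<le> exp (- a)" using p by (intro power_one_minus_le_exp) auto
        also have "\<dots> = \<delta> / (2 * real T * real l * real (card Pols))"
          unfolding a_def using arg \<delta> by (simp add: exp_minus)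
        also have "\<dots> \<le> \<delta> / (real T * real (card Pols))"
        proof (rule divide_left_mono)
          have "1 * (real T * real (card Pols)) \<le> (2 * real l) * (real T * real (card Pols))"
            using l1 by (intro mult_right_mono) auto
          then show "real T * real (card Pols) \<le> 2 * real T * real l * real (card Pols)"
            by (simp add: mult_ac)
        qed (use \<delta> T l1 card1 in simp_all)
        finally show ?thesis by simp
      qed
      ultimately show ?thesis
        using a by (intro exI[of _ r]) (simp add: r_def)
    qed
    then obtain r where r_nonneg: "\<forall>t. 0 \<le> r t" and r_sum: "real l * (\<Sum>t<T. r t) \<le> \<delta>"
      and miss: "\<forall>t<T. \<forall>q p. p \<in> Pols \<longrightarrow> r t < measure D (FS.far e q t p) \<longrightarrow>
        (1 - measure D (FS.far e q t p)) ^ num_train n t \<le> \<delta> / real T / real (card Pols)"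
      by (elim exE conjE)
    have miss': "(1 - measure D (FS.far e q t p)) ^ num_train n t \<le> \<delta> / real T / real (card Pols)"
      if "t < T" "q \<in> FS.tuples t" "p \<in> Pols" "r t < measure D (FS.far e q t p)" for t q p
      using miss that by blast
    have "\<exists>E\<in>sets (training_space D n T l). 1 - 3 * \<delta> \<le> measure (training_space D n T l) E \<and>
      (\<forall>\<omega>\<in>E. let k = stop_time sys (Obar sys \<Delta>) T l \<omega> (pihat \<omega>) in
       k \<le> \<tau>star \<and> (\<forall>s<k. pihat \<omega> s \<in> Pols) \<and>
       (k < T \<or> \<tau>star \<le> T \<longrightarrow> 1 - \<delta> \<le> measure D (FS.passing (pihat \<omega>) k)) \<and>
       1 - \<delta> \<le> measure D (FS.stage_close e (pihat \<omega>) k))"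
      by (rule FS.good_event[OF \<delta> l1 e spec[OF r_nonneg] r_sum miss' test ts reach'])
    then obtain E where E: "E \<in> sets (training_space D n T l)" "1 - 3 * \<delta> \<le>
        measure (training_space D n T l) E"
      and good: "\<forall>\<omega>\<in>E. let k = stop_time sys (Obar sys \<Delta>) T l \<omega> (pihat \<omega>) in
       k \<le> \<tau>star \<and> (\<forall>s<k. pihat \<omega> s \<in> Pols) \<and>
       (k < T \<or> \<tau>star \<le> T \<longrightarrow> 1 - \<delta> \<le> measure D (FS.passing (pihat \<omega>) k)) \<and>
       1 - \<delta> \<le> measure D (FS.stage_close e (pihat \<omega>) k)"
      by (elim bexE conjE)
    show "\<exists>E \<in> sets (training_space D n T l).
       measure (training_space D n T l) E \<ge> 1 - 3 * \<delta> \<and>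
       (\<forall>\<omega>\<in>E.
          let \<tau>hat = stop_time sys (Obar sys \<Delta>) T l \<omega> (pihat \<omega>);
              xhat = closed_loop sys (pihat \<omega>);
              close = (\<lambda>x0. \<forall>t<\<tau>hat. norm (expert sys \<Delta> (xhat x0 t) - pihat \<omega> t (xhat x0 t))
                                        \<le> \<epsilon> / onorm ((*v) (Bmat sys)))
          in \<tau>hat \<le> \<tau>star \<and>
             (\<tau>hat < T \<or> \<tau>star \<le> T \<longrightarrow> \<P>(x0 in D. xhat x0 \<tau>hat \<in> Obar sys \<Delta>) \<ge> 1 - \<delta>) \<and>
             \<P>(x0 in D. close x0) \<ge> 1 - \<delta> \<and>
             (\<forall>x0\<in>S. xhat x0 \<tau>hat \<in> Obar sys \<Delta> \<and> close x0 \<longrightarrow>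
                total_cost sys (switched_policy sys \<tau>hat (pihat \<omega>)) T x0
                  - total_cost sys (\<lambda>_. mpc_control sys \<Delta>) T x0
                \<le> C * real \<tau>star * \<epsilon>))"
    proof (rule bexI[OF _ E(1)], rule conjI[OF E(2)], rule ballI)
      fix \<omega> assume \<omega>: "\<omega> \<in> E"
      define k where "k = stop_time sys (Obar sys \<Delta>) T l \<omega> (pihat \<omega>)"
      have k: "k \<le> \<tau>star" and kPols: "\<forall>s<k. pihat \<omega> s \<in> Pols"
        and pass: "k < T \<or> \<tau>star \<le> T \<longrightarrow> 1 - \<delta> \<le> measure D (FS.passing (pihat \<omega>) k)"
        and close: "1 - \<delta> \<le> measure D (FS.stage_close e (pihat \<omega>) k)"
        using bspec[OF good \<omega>] unfolding Let_def k_def[symmetric] by simp_all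
      have "total_cost sys (switched_policy sys k (pihat \<omega>)) T x0 - total_cost sys (\<lambda>_. mpc_control sys \<Delta>) T x0
          \<le> C * real \<tau>star * \<epsilon>"
        if x0: "x0 \<in> S" and O: "closed_loop sys (pihat \<omega>) x0 k \<in> Obar sys \<Delta>"
          and cl: "M.close_to_expert \<epsilon> \<Delta> (pihat \<omega>) k x0" for x0
      proof -
        have "\<forall>t<k. \<forall>x. pihat \<omega> t x \<in> Uset sys" using kPols Pols(3) by blast
        moreover have "x0 \<in> Xbar0 sys \<Delta>" using x0 SX by blast
        ultimately show ?thesis
          using C[rule_format, OF tube \<epsilon>(2) R0[OF x0] _ cl O _ k ts] by simp
      qed
      then show "let \<tau>hat = stop_time sys (Obar sys \<Delta>) T l \<omega> (pihat \<omega>);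
              xhat = closed_loop sys (pihat \<omega>);
              close = (\<lambda>x0. \<forall>t<\<tau>hat. norm (expert sys \<Delta> (xhat x0 t) - pihat \<omega> t (xhat x0 t))
                                        \<le> \<epsilon> / onorm ((*v) (Bmat sys)))
          in \<tau>hat \<le> \<tau>star \<and>
             (\<tau>hat < T \<or> \<tau>star \<le> T \<longrightarrow> \<P>(x0 in D. xhat x0 \<tau>hat \<in> Obar sys \<Delta>) \<ge> 1 - \<delta>) \<and>
             \<P>(x0 in D. close x0) \<ge> 1 - \<delta> \<and>
             (\<forall>x0\<in>S. xhat x0 \<tau>hat \<in> Obar sys \<Delta> \<and> close x0 \<longrightarrow>
                total_cost sys (switched_policy sys \<tau>hat (pihat \<omega>)) T x0
                  - total_cost sys (\<lambda>_. mpc_control sys \<Delta>) T x0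
                \<le> C * real \<tau>star * \<epsilon>)"
        using k pass close
        unfolding Let_def k_def[symmetric] FS.space_D FS.passing_def FS.stage_close_def e_def
          M.close_to_expert_def M.\<beta>_def by simp
    qed
  qed
qed

end
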